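(* Suppose that $\varphi:\mathbb{D}\to\mathbb{D}$ is a holomorphic function. The composition operator $C_\varphi$ is compact on $\mathcal{Z}^{v_{\log}}$ if and only if $$\max\left\{\lim_{n\to\infty}\frac{(n+2)(n+1)\,\|J'_{\varphi'}(\varphi^n)\|_{\mathcal{Z}^{v_{\log}}}}{\|g_{n+2}\|_{\mathcal{Z}^{w_{\log}}}},\ \lim_{n\to\infty}\frac{(n+1)\,\|I'_{\varphi'}(\varphi^n)\|_{\mathcal{Z}^{v_{\log}}}}{\|g_{n+1}\|_{\mathcal{Z}^{v_{\log}}}}\right\}=0.$$
   Context: $\mathbb{D}$ is the open unit disk of $\mathbb{C}$ and $H(\mathbb{D})$ is the space of holomorphic functions on $\mathbb{D}$. The weights used are $v_{\log}(z)=(1-|z|)\log\left(\frac{2}{1-|z|}\right)$ and $w_{\log}(z)=\left[\log\log\left(\frac{4}{1-|z|^2}\right)\right]^{-1}$, $z\in\mathbb{D}$. For $v\in\{v_{\log},w_{\log}\}$, $\mathcal{Z}^v$ is the Banach space of all $f\in H(\mathbb{D})$ with $\sup_{z\in\mathbb{D}}v(z)|f''(z)|<\infty$, normed by $\|f\|_{\mathcal{Z}^v}=|f(0)|+|f'(0)|+\sup_{z\in\mathbb{D}}v(z)|f''(z)|$. $C_\varphi(f)=f\circ\varphi$. For holomorphic $u:\mathbb{D}\to\mathbb{C}$ and $f\in H(\mathbb{D})$, define the holomorphic functions $I_u(f)(z)=\int_0^z f'(s)u(s)\,ds$, $J_u(f)(z)=\int_0^z f(s)u'(s)\,ds$, $I'_u(f)(z)=\int_0^z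 I_u(f)(s)\,ds$ and $J'_u(f)(z)=\int_0^z J_u(f)(s)\,ds$ (here the prime on $I'_u,J'_u$ is part of the name, not a derivative). In the claim $u=\varphi'$, the derivative of $\varphi$. $\varphi^n$ is the pointwise $n$-th power of $\varphi$, and $g_n(z)=z^n$ for $n\in\{1,2,3,\dots\}$.
   Formalization: The right-hand side also requires J'_{φ'}(φ^n) and I'_{φ'}(φ^n) to lie in Z^{v_log} for every n ≥ 0; without n = 0 the claim fails, e.g. for φ(z) = (1−z)^{3/4}/4, where both limits are 0 but φ is not in Z^{v_log}. *)

theory Defs
  imports "HOL-Complex_Analysis.Complex_Analysis"
begin

abbreviation unit_disk :: "complex set" where
  "unit_disk \<equiv> ball 0 1"

definition v_log :: "complex \<Rightarrow> real" where
  "v_log z = (1 - norm z) * ln (2 / (1 - norm z))"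

definition w_log :: "complex \<Rightarrow> real" where
  "w_log z = inverse (ln (ln (4 / (1 - (norm z)\<^sup>2))))"

text \<open>
  A function on the disk is represented by a total function that is
  \<^const>\<open>undefined\<close> outside the disk, so that equality of representatives is
  equality on the disk.
\<close>

definition zygmund_space :: "(complex \<Rightarrow> real) \<Rightarrow> (complex \<Rightarrow> complex) set" where
  "zygmund_space v =
     {f \<in> extensional unit_disk. f holomorphic_on unit_disk \<and>
        bdd_above ((\<lambda>z. v z * norm (deriv (deriv f) z)) ` unit_disk)}"

text \<open>
  Only meaningful on \<^term>\<open>zygmund_space v\<close>: the supremum of an unbounded set
  of reals is unspecified. The value depends only on the function on the disk.
\<close>

definition zygmund_norm :: "(complex \<Rightarrow> real) \<Rightarrow> (complex \<Rightarrow> complex) \<Rightarrow> real" where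
  "zygmund_norm v f =
     norm (f 0) + norm (deriv f 0) + (SUP z\<in>unit_disk. v z * norm (deriv (deriv f) z))"

text \<open>
  The norm distance; the value 0 off the space is a filler, since
  \<^locale>\<open>Metric_space\<close> asks for a total nonnegative function.
\<close>

definition zygmund_dist ::
  "(complex \<Rightarrow> real) \<Rightarrow> (complex \<Rightarrow> complex) \<Rightarrow> (complex \<Rightarrow> complex) \<Rightarrow> real" where
  "zygmund_dist v f g =
     (if f \<in> zygmund_space v \<and> g \<in> zygmund_space v then zygmund_norm v (\<lambda>z. f z - g z) else 0)"

definition zygmund_topology :: "(complex \<Rightarrow> real) \<Rightarrow> (complex \<Rightarrow> complex) topology" where
  "zygmund_topology v = Metric_space.mtopology (zygmund_space v) (zygmund_dist v)"

text \<open>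
  Intended for linear operators; boundedness then follows from relative compactness
  of the image of the unit ball.
\<close>

definition compact_on_zygmund ::
  "(complex \<Rightarrow> real) \<Rightarrow> ((complex \<Rightarrow> complex) \<Rightarrow> (complex \<Rightarrow> complex)) \<Rightarrow> bool" where
  "compact_on_zygmund v T \<longleftrightarrow>
     T ` zygmund_space v \<subseteq> zygmund_space v \<and>
     compactin (zygmund_topology v)
       (zygmund_topology v closure_of (T ` {f \<in> zygmund_space v. zygmund_norm v f \<le> 1}))"

definition composition_op ::
  "(complex \<Rightarrow> complex) \<Rightarrow> (complex \<Rightarrow> complex) \<Rightarrow> (complex \<Rightarrow> complex)" where
  "composition_op \<phi> f = (\<lambda>z\<in>unit_disk. f (\<phi> z))"

text \<open>
  The integrands below are holomorphic on the disk, so the integral from 0 to z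
  may be taken along the segment.
\<close>

definition op_I :: "(complex \<Rightarrow> complex) \<Rightarrow> (complex \<Rightarrow> complex) \<Rightarrow> (complex \<Rightarrow> complex)" where
  "op_I u f = (\<lambda>z\<in>unit_disk. contour_integral (linepath 0 z) (\<lambda>s. deriv f s * u s))"

definition op_J :: "(complex \<Rightarrow> complex) \<Rightarrow> (complex \<Rightarrow> complex) \<Rightarrow> (complex \<Rightarrow> complex)" where
  "op_J u f = (\<lambda>z\<in>unit_disk. contour_integral (linepath 0 z) (\<lambda>s. f s * deriv u s))"

definition op_I' :: "(complex \<Rightarrow> complex) \<Rightarrow> (complex \<Rightarrow> complex) \<Rightarrow> (complex \<Rightarrow> complex)" where
  "op_I' u f = (\<lambda>z\<in>unit_disk. contour_integral (linepath 0 z) (op_I u f))"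

definition op_J' :: "(complex \<Rightarrow> complex) \<Rightarrow> (complex \<Rightarrow> complex) \<Rightarrow> (complex \<Rightarrow> complex)" where
  "op_J' u f = (\<lambda>z\<in>unit_disk. contour_integral (linepath 0 z) (op_J u f))"

definition g_pow :: "nat \<Rightarrow> complex \<Rightarrow> complex" where
  "g_pow n = (\<lambda>z\<in>unit_disk. z ^ n)"

lemma v_log_pos:
  assumes "z \<in> unit_disk"
  shows "0 < v_log z"
proof -
  have "0 < 1 - norm z" "1 - norm z < 2"
    using assms norm_ge_zero[of z] by (simp, linarith)
  thus ?thesis
    unfolding v_log_def by (intro mult_pos_pos ln_gt_zero) (auto simp: less_divide_eq)
qed

lemma w_log_pos:
  assumes "z \<in> unit_disk"
  shows "0 < w_log z"
proof -
  have t: "0 < 1 - (norm z)\<^sup>2" "1 - (norm z)\<^sup>2 \<le> 1"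
    using assms by (auto simp: abs_square_less_1)
  have "exp 1 < (4::real)"
    using exp_le by linarith
  also have "4 \<le> 4 / (1 - (norm z)\<^sup>2)"
    using t by (simp add: le_divide_eq)
  finally have "1 < ln (4 / (1 - (norm z)\<^sup>2))"
    using t ln_less_cancel_iff[of "exp 1" "4 / (1 - (norm z)\<^sup>2)"] by simp
  thus ?thesis
    unfolding w_log_def by (simp add: ln_gt_zero)
qed

lemma deriv_diff_disk:
  assumes "f holomorphic_on unit_disk" "g holomorphic_on unit_disk" "z \<in> unit_disk"
  shows "deriv (\<lambda>z. f z - g z) z = deriv f z - deriv g z"
  using assms by (intro deriv_diff) (auto intro: holomorphic_on_imp_differentiable_at)

lemma deriv2_diff_disk:
  assumes "f holomorphic_on unit_disk" "g holomorphic_on unit_disk" "z \<in> unit_disk"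
  shows "deriv (deriv (\<lambda>z. f z - g z)) z = deriv (deriv f) z - deriv (deriv g) z"
proof -
  have "\<forall>\<^sub>F w in nhds z. w \<in> unit_disk"
    using assms(3) by (intro eventually_nhds_in_open) auto
  hence "\<forall>\<^sub>F w in nhds z. deriv (\<lambda>z. f z - g z) w = deriv f w - deriv g w"
    by eventually_elim (rule deriv_diff_disk[OF assms(1,2)])
  hence "deriv (deriv (\<lambda>z. f z - g z)) z = deriv (\<lambda>w. deriv f w - deriv g w) z"
    by (intro deriv_cong_ev) auto
  also have "\<dots> = deriv (deriv f) z - deriv (deriv g) z"
    using assms by (intro deriv_diff_disk holomorphic_deriv) auto
  finally show ?thesis .
qed

lemma zygmund_bdd_diff:
  assumes v: "\<And>z. z \<in> unit_disk \<Longrightarrow> 0 < v z"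
    and f: "f \<in> zygmund_space v" and g: "g \<in> zygmund_space v"
  shows "bdd_above ((\<lambda>z. v z * norm (deriv (deriv (\<lambda>z. f z - g z)) z)) ` unit_disk)"
proof -
  obtain A B where A: "\<And>z. z \<in> unit_disk \<Longrightarrow> v z * norm (deriv (deriv f) z) \<le> A"
    and B: "\<And>z. z \<in> unit_disk \<Longrightarrow> v z * norm (deriv (deriv g) z) \<le> B"
    using f g unfolding zygmund_space_def bdd_above_def by blast
  show ?thesis
  proof (intro bdd_aboveI2[of _ _ "A + B"])
    fix z assume z: "z \<in> unit_disk"
    have "v z * norm (deriv (deriv f) z - deriv (deriv g) z)
        \<le> v z * (norm (deriv (deriv f) z) + norm (deriv (deriv g) z))"
      using v[OF z] by (intro mult_left_mono norm_triangle_ineq4) auto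
    thus "v z * norm (deriv (deriv (\<lambda>z. f z - g z)) z) \<le> A + B"
      using A[OF z] B[OF z] f g z
      by (simp add: zygmund_space_def deriv2_diff_disk algebra_simps)
  qed
qed

lemma Metric_space_zygmund:
  assumes v: "\<And>z. z \<in> unit_disk \<Longrightarrow> 0 < v z"
  shows "Metric_space (zygmund_space v) (zygmund_dist v)"
    (is "Metric_space ?Z ?d")
proof -
  define S where "S f g = (SUP z\<in>unit_disk. v z * norm (deriv (deriv f) z - deriv (deriv g) z))"
    for f g :: "complex \<Rightarrow> complex"
  have hol: "f holomorphic_on unit_disk" if "f \<in> ?Z" for f
    using that by (simp add: zygmund_space_def)
  have d: "?d f g = norm (f 0 - g 0) + norm (deriv f 0 - deriv g 0) + S f g"
    if "f \<in> ?Z" "g \<in> ?Z" for f g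
  proof -
    have "(SUP z\<in>unit_disk. v z * norm (deriv (deriv (\<lambda>z. f z - g z)) z)) = S f g"
      unfolding S_def using hol[OF that(1)] hol[OF that(2)]
      by (intro arg_cong[where f = Sup] image_cong) (auto simp: deriv2_diff_disk)
    thus ?thesis
      unfolding zygmund_dist_def zygmund_norm_def
      using that hol[OF that(1)] hol[OF that(2)] by (simp add: deriv_diff_disk)
  qed
  have upper: "v z * norm (deriv (deriv f) z - deriv (deriv g) z) \<le> S f g"
    if "f \<in> ?Z" "g \<in> ?Z" "z \<in> unit_disk" for f g z
    unfolding S_def
  proof (rule cSUP_upper[OF that(3)])
    have "(\<lambda>z. v z * norm (deriv (deriv (\<lambda>z. f z - g z)) z)) ` unit_disk
        = (\<lambda>z. v z * norm (deriv (deriv f) z - deriv (deriv g) z)) ` unit_disk"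
      using hol[OF that(1)] hol[OF that(2)] by (intro image_cong) (auto simp: deriv2_diff_disk)
    moreover have "bdd_above ((\<lambda>z. v z * norm (deriv (deriv (\<lambda>z. f z - g z)) z)) ` unit_disk)"
      using that v by (intro zygmund_bdd_diff) auto
    ultimately show "bdd_above ((\<lambda>z. v z * norm (deriv (deriv f) z - deriv (deriv g) z)) ` unit_disk)"
      by simp
  qed
  have S0: "0 \<le> S f g" if "f \<in> ?Z" "g \<in> ?Z" for f g
    using upper[OF that, of 0] v[of 0]
    by (smt (verit) centre_in_ball mult_nonneg_nonneg norm_ge_zero)
  have nonneg: "0 \<le> ?d f g" if "f \<in> ?Z" "g \<in> ?Z" for f g
    using S0[OF that] d[OF that] by simp
  have tri: "?d f h \<le> ?d f g + ?d g h" if "f \<in> ?Z" "g \<in> ?Z" "h \<in> ?Z" for f g h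
  proof -
    have "S f h \<le> S f g + S g h"
      unfolding S_def[of f h]
    proof (rule cSUP_least)
      fix z assume z: "z \<in> unit_disk"
      have "norm (deriv (deriv f) z - deriv (deriv h) z)
          \<le> norm (deriv (deriv f) z - deriv (deriv g) z) + norm (deriv (deriv g) z - deriv (deriv h) z)"
        by (metis diff_add_cancel add_diff_eq norm_triangle_ineq)
      hence "v z * norm (deriv (deriv f) z - deriv (deriv h) z)
          \<le> v z * norm (deriv (deriv f) z - deriv (deriv g) z)
            + v z * norm (deriv (deriv g) z - deriv (deriv h) z)"
        using v[OF z] by (metis distrib_left mult_left_mono less_imp_le)
      also have "\<dots> \<le> S f g + S g h"
        using that z by (intro add_mono upper)
      finally show "v z * norm (deriv (deriv f) z - deriv (deriv h) z) \<le> S f g + S g h" .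
    qed auto
    moreover have "norm (f 0 - h 0) \<le> norm (f 0 - g 0) + norm (g 0 - h 0)"
      by (metis diff_add_cancel add_diff_eq norm_triangle_ineq)
    moreover have "norm (deriv f 0 - deriv h 0)
        \<le> norm (deriv f 0 - deriv g 0) + norm (deriv g 0 - deriv h 0)"
      by (metis diff_add_cancel add_diff_eq norm_triangle_ineq)
    ultimately show ?thesis using that by (simp add: d)
  qed
  have eq: "f = g" if fg: "f \<in> ?Z" "g \<in> ?Z" and d0: "?d f g = 0" for f g
  proof -
    have z0: "S f g = 0" "f 0 = g 0" "deriv f 0 = deriv g 0"
      using d0 d[OF fg] S0[OF fg] norm_ge_zero[of "f 0 - g 0"] norm_ge_zero[of "deriv f 0 - deriv g 0"]
      by (smt (verit) norm_eq_zero right_minus_eq)+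
    have d2: "deriv (deriv f) z = deriv (deriv g) z" if "z \<in> unit_disk" for z
      using upper[OF fg that] z0(1) v[OF that]
      by (simp add: mult_le_0_iff)
    have prim: "F z = G z" if F: "F holomorphic_on unit_disk" and G: "G holomorphic_on unit_disk"
      and dd: "\<And>z. z \<in> unit_disk \<Longrightarrow> deriv F z = deriv G z" and 0: "F 0 = G 0"
      and z: "z \<in> unit_disk" for F G z
    proof -
      have "\<exists>c. \<forall>x\<in>unit_disk. F x - G x = c"
      proof (rule has_field_derivative_zero_constant)
        fix x assume x: "x \<in> unit_disk"
        have "(F has_field_derivative deriv F x) (at x)" "(G has_field_derivative deriv G x) (at x)"
          using F G x by (auto intro: holomorphic_derivI)
        from DERIV_diff[OF this]
        have "((\<lambda>x. F x - G x) has_field_derivative 0) (at x)"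
          using dd[OF x] by simp
        thus "((\<lambda>x. F x - G x) has_field_derivative 0) (at x within unit_disk)"
          by (rule has_field_derivative_at_within)
      qed auto
      thus ?thesis using 0 z by (metis centre_in_ball eq_iff_diff_eq_0 zero_less_one)
    qed
    have d1: "deriv f z = deriv g z" if "z \<in> unit_disk" for z
      using prim[of "deriv f" "deriv g" z] hol fg d2 z0 that by (auto intro: holomorphic_deriv)
    show ?thesis
    proof (rule extensionalityI)
      show "f \<in> extensional unit_disk" "g \<in> extensional unit_disk"
        using fg by (auto simp: zygmund_space_def)
      show "f z = g z" if "z \<in> unit_disk" for z
        using prim[of f g z] hol fg d1 z0 that by auto
    qed
  qed
  have z: "?d f f = 0" if "f \<in> ?Z" for f
    using d[OF that that] by (simp add: S_def)
  have c: "?d f g = ?d g f" for f g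
  proof (cases "f \<in> ?Z \<and> g \<in> ?Z")
    case True
    thus ?thesis using d[of f g] d[of g f] by (simp add: S_def norm_minus_commute)
  qed (auto simp: zygmund_dist_def)
  have n: "0 \<le> ?d f g" for f g
    using nonneg[of f g] by (cases "f \<in> ?Z \<and> g \<in> ?Z") (auto simp: zygmund_dist_def)
  show ?thesis
    by unfold_locales (use n c z eq tri in blast)+
qed

end

theory Submission
  imports Defs
begin

text \<open>
  Write v and w for the two weights. For f with v-norm at most 1 the chain rule gives
  (f o \<phi>)'' = f''(\<phi>) \<phi>'^2 + f'(\<phi>) \<phi>'', where |f''| is at most 1/v, and integrating this
  along a radius bounds |f'| by a multiple of 1/w. So the operator is governed by the two
  coefficients \<psi>1 = v |\<phi>'|^2 and \<psi>2 = v |\<phi>''|, to be compared with v(\<phi>) and w(\<phi>) where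
  \<phi> approaches the unit circle. The proof passes through the pointwise condition \<open>vanishing\<close>:
  \<psi>1 and \<psi>2 are bounded, \<psi>1 = o(v(\<phi>)) and \<psi>2 = o(w(\<phi>)) as |\<phi>| tends to 1.

  The two operator norms of the theorem are, up to factors that cancel, the suprema of
  \<psi>2 |\<phi>|^n and of \<psi>1 |\<phi>|^n, and the norms of the monomials are the suprema of w |z|^n
  and of v |z|^n. If the quotients tend to 0, \<open>vanishing\<close> follows because a monomial localizes:
  for n close to 1/(1 - |a|) the factor |a|^n is bounded below, while the supremum of v |z|^n is
  at most a constant times v(a), and likewise for w (\<open>peak_bounded_v_log\<close>,
  \<open>peak_bounded_w_log\<close>, \<open>little_o_from_monomials\<close>). From \<open>vanishing\<close> the operator is compact:
  by Montel's theorem every sequence in the unit ball has a subsequence converging locally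
  uniformly to an element of the ball, and for the differences the part of the disk where |\<phi>|
  is near 1 is controlled by \<open>vanishing\<close>, the rest by uniform convergence
  (\<open>vanishing_imp_compact\<close>).

  Conversely, a compact operator sends every sequence of the ball that tends to 0 pointwise to a
  norm null sequence (\<open>compact_imp_null\<close>). Applied to the normalized monomials z^(n+2) this
  yields the limit for \<psi>1, because the first derivatives of these functions tend to 0 uniformly
  and the term with \<psi>2 disappears; hence \<psi>1 = o(v(\<phi>)). Applied to functions whose derivative at
  a is of the maximal order 1/w(a) (\<open>loglog_test_functions\<close>) it yields \<psi>2 = o(w(\<phi>)), since the
  term with \<psi>1 is by then known to be negligible. This is \<open>vanishing\<close>, from which the limit for
  \<psi>2 follows by splitting the disk at a level of |\<phi>|.
\<close>

section \<open>Weights and monomials\<close>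

text \<open>
  The function t ln(c/t) increases as long as t is at most c/e. Here the gain ln(c/s) - ln(c/t) is
  at most t/s - 1, and ln(c/t) is at least 1 on this range.
\<close>
lemma id_times_ln_div_mono:
  fixes s t c :: real
  assumes "0 < s" "s \<le> t" "t * exp 1 \<le> c"
  shows "s * ln (c / s) \<le> t * ln (c / t)"
proof -
  have t: "0 < t" using assms by simp
  have c: "0 < c" using assms(3) t by (smt (verit) exp_gt_zero mult_pos_pos)
  have 1: "1 \<le> ln (c / t)"
    using assms(3) t c by (subst ln_ge_iff) (auto simp: field_simps)
  have "ln (c / s) = ln (c / t) + ln (t / s)"
    using assms t c by (simp add: ln_div)
  also have "\<dots> \<le> ln (c / t) + (t / s - 1)"
    using assms t by (intro add_left_mono ln_le_minus_one) auto
  finally have "s * ln (c / s) \<le> s * (ln (c / t) + (t / s - 1))"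
    using assms by (intro mult_left_mono) auto
  also have "\<dots> = s * ln (c / t) + (t - s) * 1"
    using assms by (simp add: field_simps)
  also have "\<dots> \<le> s * ln (c / t) + (t - s) * ln (c / t)"
    using assms 1 by (intro add_left_mono mult_left_mono) auto
  finally show ?thesis by (simp add: algebra_simps)
qed

text \<open>
  The power is at most e^(-n \<sigma>), and n is at least 1/s - 1; the factor e pays for the -1.
\<close>
lemma power_le_exp_neg:
  fixes s \<sigma> :: real
  assumes "0 < s" "0 \<le> \<sigma>" "\<sigma> \<le> 1" "1 / s \<le> real n + 1"
  shows "(1 - \<sigma>) ^ n \<le> exp 1 * exp (- (\<sigma> / s))"
proof -
  have "1 - \<sigma> \<le> exp (- \<sigma>)" using exp_ge_add_one_self[of "-\<sigma>"] by simp
  hence "(1 - \<sigma>) ^ n \<le> exp (- \<sigma>) ^ n" using assms by (intro power_mono) auto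
  also have "\<dots> = exp (- (real n * \<sigma>))" by (simp add: exp_of_nat_mult[symmetric])
  also have "\<dots> \<le> exp (1 + - (\<sigma> / s))"
  proof -
    have "\<sigma> * (1 / s) \<le> \<sigma> * (real n + 1)" using assms by (intro mult_left_mono) auto
    thus ?thesis using assms by (simp add: algebra_simps)
  qed
  finally show ?thesis by (simp only: exp_add)
qed

text \<open>
  A radius r within 1/n of the circle loses only a constant factor under the n-th power, because
  1/r is at most exp(2(1 - r)) for r at least 1/2.
\<close>
lemma power_ge_exp_neg2:
  fixes r :: real
  assumes "1 / 2 \<le> r" "r < 1" "real n * (1 - r) \<le> 1"
  shows "exp (- 2) \<le> r ^ n"
proof -
  have "exp (- 2 * (1 - r)) \<le> r"
  proof -
    have "1 / r \<le> exp (2 * (1 - r))"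
    proof -
      have "1 / r = 1 + (1 - r) / r" using assms by (simp add: field_simps)
      also have "(1 - r) / r \<le> 2 * (1 - r)"
      proof -
        have "(1 - r) * (1 / r) \<le> (1 - r) * 2"
          using assms by (intro mult_left_mono) (auto simp: field_simps)
        thus ?thesis by (simp add: mult.commute)
      qed
      also have "1 + 2 * (1 - r) \<le> exp (2 * (1 - r))" by (rule exp_ge_add_one_self)
      finally show ?thesis by simp
    qed
    hence "inverse (exp (2 * (1 - r))) \<le> inverse (1 / r)"
      using assms by (intro le_imp_inverse_le) auto
    moreover have "exp (- 2 * (1 - r)) = inverse (exp (2 * (1 - r)))"
      by (simp only: mult_minus_left exp_minus)
    ultimately show ?thesis using assms by simp
  qed
  hence "exp (- 2 * (1 - r)) ^ n \<le> r ^ n" by (intro power_mono) auto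
  moreover have "exp (- 2) \<le> exp (- 2 * (1 - r)) ^ n"
    using assms by (simp add: exp_of_nat_mult[symmetric] algebra_simps)
  ultimately show ?thesis by linarith
qed

text \<open>
  The weight varies so slowly that, once n reaches 1/(1 - |a|) - 1, the power |z|^n outweighs the
  growth of \<mu>(z) away from the circle of radius |a|. If moreover n is at most 1/(1 - |a|), then
  |a|^n stays away from 0, so that \<mu>(z) |z|^n is, up to a constant, maximal at the points of
  modulus |a|.
\<close>
definition peak_bounded :: "(complex \<Rightarrow> real) \<Rightarrow> bool" where
  "peak_bounded \<mu> \<longleftrightarrow> (\<exists>C>0. \<forall>a\<in>unit_disk. \<forall>z\<in>unit_disk. \<forall>n.
     1 / (1 - norm a) \<le> real n + 1 \<longrightarrow> \<mu> z * norm z ^ n \<le> C * \<mu> a)"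

text \<open>
  With s = 1 - |a| and 1 - |z| = x s, the quotient of v(z) |z|^n and v(a) is at most a constant
  times x e^(-x) (1 + ln(1/x) / ln(2/s)). This is bounded: x ln(1/x) is at most 1, and ln(2/s) is
  at least ln 2.
\<close>
lemma peak_bounded_v_log: "peak_bounded v_log"
  unfolding peak_bounded_def
proof (intro exI conjI ballI allI impI)
  have ln2: "0 < ln (2::real)" by simp
  show "0 < exp 1 * (1 + 1 / ln (2::real))"
    using ln2 by (intro mult_pos_pos add_pos_pos) auto
  fix a z :: complex and n :: nat
  assume a: "a \<in> unit_disk" and z: "z \<in> unit_disk" and n: "1 / (1 - norm a) \<le> real n + 1"
  define s \<sigma> where "s = 1 - norm a" and "\<sigma> = 1 - norm z"
  have s: "0 < s" "s \<le> 1" and \<sigma>: "0 < \<sigma>" "\<sigma> \<le> 1" using a z by (auto simp: s_def \<sigma>_def)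
  define x where "x = \<sigma> / s"
  have x: "0 < x" using s \<sigma> by (simp add: x_def)
  have \<sigma>x: "\<sigma> = x * s" using s by (simp add: x_def)
  have l: "ln 2 \<le> ln (2 / s)" using s by (simp add: field_simps)
  have "x * ln (1 / x) \<le> x * (1 / x - 1)"
    using x by (intro mult_left_mono ln_le_minus_one) auto
  hence "x * ln (1 / x) \<le> 1" using x by (simp add: right_diff_distrib)
  moreover have "ln (2 / \<sigma>) = ln (2 / s) + ln (1 / x)"
    using s x by (simp add: \<sigma>x ln_div ln_mult)
  ultimately have *: "x * ln (2 / \<sigma>) \<le> x * ln (2 / s) + 1"
    by (simp add: algebra_simps)
  have ex: "x \<le> exp x" "1 \<le> exp x" using exp_ge_add_one_self[of x] x by linarith+
  have "x * exp (- x) * ln (2 / \<sigma>) = exp (- x) * (x * ln (2 / \<sigma>))" by simp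
  also have "\<dots> \<le> exp (- x) * (x * ln (2 / s) + 1)"
    using * by (intro mult_left_mono) auto
  also have "\<dots> = (x * exp (- x)) * ln (2 / s) + exp (- x)" by (simp add: algebra_simps)
  also have "\<dots> \<le> 1 * ln (2 / s) + ln (2 / s) / ln 2"
  proof (intro add_mono mult_right_mono)
    show "x * exp (- x) \<le> 1" using ex by (simp add: exp_minus field_simps)
    show "0 \<le> ln (2 / s)" using l ln2 by linarith
    have "exp (- x) \<le> 1" using x by simp
    also have "1 \<le> ln (2 / s) / ln 2" using l ln2 by (subst le_divide_eq) auto
    finally show "exp (- x) \<le> ln (2 / s) / ln 2" .
  qed
  finally have **: "x * exp (- x) * ln (2 / \<sigma>) \<le> (1 + 1 / ln 2) * ln (2 / s)"
    by (simp add: algebra_simps)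
  have "v_log z * norm z ^ n = \<sigma> * ln (2 / \<sigma>) * (1 - \<sigma>) ^ n"
    by (simp add: v_log_def \<sigma>_def)
  also have "\<dots> \<le> \<sigma> * ln (2 / \<sigma>) * (exp 1 * exp (- (\<sigma> / s)))"
    using s \<sigma> n by (intro mult_left_mono power_le_exp_neg) (auto simp: s_def field_simps)
  also have "\<dots> = exp 1 * s * (x * exp (- x) * ln (2 / \<sigma>))"
    using s by (simp add: \<sigma>x)
  also have "\<dots> \<le> exp 1 * s * ((1 + 1 / ln 2) * ln (2 / s))"
    using s ** by (intro mult_left_mono) auto
  finally show "v_log z * norm z ^ n \<le> exp 1 * (1 + 1 / ln 2) * v_log a"
    by (simp add: v_log_def s_def mult_ac)
qed

lemma loglog_pos: 
  fixes y :: real assumes "4 \<le> y" shows "1 < ln y" "0 < ln (ln y)"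
proof -
  have "exp 1 < y" using exp_le assms by linarith
  thus "1 < ln y" using ln_less_cancel_iff[of "exp 1" y] assms by simp
  thus "0 < ln (ln y)" by simp
qed

lemma four_le_radial:
  assumes "z \<in> unit_disk" shows "4 \<le> 4 / (1 - (norm z)\<^sup>2)"
proof -
  have "0 < 1 - (norm z)\<^sup>2" "1 - (norm z)\<^sup>2 \<le> 1" using assms by (auto simp: abs_square_less_1)
  thus ?thesis by (simp add: le_divide_eq)
qed

text \<open>
  Since ln y is at least 1, ln(x y) is at most x ln y; taking another logarithm turns the factor
  into a summand.
\<close>
lemma loglog_mult_le:
  fixes x y :: real
  assumes "1 \<le> x" "4 \<le> y"
  shows "ln (ln (x * y)) \<le> (x - 1) + ln (ln y)"
proof -
  have y: "1 < ln y" using loglog_pos assms by blast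
  have "ln (x * y) = ln x + ln y" using assms by (simp add: ln_mult)
  also have "ln x \<le> x - 1" using assms by (intro ln_le_minus_one) auto
  also have "x - 1 \<le> (x - 1) * ln y"
    using assms y mult_left_mono[of 1 "ln y" "x - 1"] by auto
  finally have le: "ln (x * y) \<le> x * ln y" by (simp add: algebra_simps)
  have pos: "0 < ln (x * y)" using assms by (smt (verit) ln_gt_zero mult_le_cancel_right1)
  have "ln (ln (x * y)) \<le> ln (x * ln y)"
    using le pos by (simp add: ln_mono)
  also have "\<dots> = ln x + ln (ln y)" using assms y by (simp add: ln_mult)
  also have "ln x \<le> x - 1" using assms by (intro ln_le_minus_one) auto
  finally show ?thesis by simp
qed

lemma inverse_w_log: "inverse (w_log z) = ln (ln (4 / (1 - (norm z)\<^sup>2)))"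
  by (simp add: w_log_def)

lemma w_log_antimono:
  assumes "z \<in> unit_disk" "norm a \<le> norm z"
  shows "w_log z \<le> w_log a"
proof -
  have a: "a \<in> unit_disk" using assms by simp
  have p: "0 < 1 - (norm z)\<^sup>2" using assms by (auto simp: abs_square_less_1)
  have q: "1 - (norm z)\<^sup>2 \<le> 1 - (norm a)\<^sup>2" using assms by (simp add: power_mono)
  hence "4 / (1 - (norm a)\<^sup>2) \<le> 4 / (1 - (norm z)\<^sup>2)"
    using p by (intro divide_left_mono mult_pos_pos) linarith+
  hence "ln (4 / (1 - (norm a)\<^sup>2)) \<le> ln (4 / (1 - (norm z)\<^sup>2))"
    using four_le_radial[OF a] by - (rule ln_mono, linarith+)
  hence "ln (ln (4 / (1 - (norm a)\<^sup>2))) \<le> ln (ln (4 / (1 - (norm z)\<^sup>2)))"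
    using loglog_pos[OF four_le_radial[OF a]] by - (rule ln_mono, linarith+)
  thus ?thesis unfolding w_log_def
    using loglog_pos[OF four_le_radial[OF a]] by (intro le_imp_inverse_le) auto
qed

text \<open>
  Nearer to the circle than a the weight w is smaller than w(a) anyway. Farther away, at distance
  x (1 - |a|) from the circle, w can exceed w(a) by a factor growing at most linearly in x, which
  the exponential decay of |z|^n absorbs.
\<close>
lemma peak_bounded_w_log: "peak_bounded w_log"
  unfolding peak_bounded_def
proof (intro exI conjI ballI allI impI)
  define c0 :: real where "c0 = ln (ln 4)"
  have c0: "0 < c0" using loglog_pos(2)[of 4] by (simp add: c0_def)
  show "0 < exp 1 * (1 + 1 / c0)"
    using c0 by (intro mult_pos_pos add_pos_pos) auto
  fix a z :: complex and n :: nat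
  assume a: "a \<in> unit_disk" and z: "z \<in> unit_disk" and n: "1 / (1 - norm a) \<le> real n + 1"
  define s \<sigma> where "s = 1 - norm a" and "\<sigma> = 1 - norm z"
  have s: "0 < s" "s \<le> 1" and \<sigma>: "0 < \<sigma>" "\<sigma> \<le> 1" using a z by (auto simp: s_def \<sigma>_def)
  define x where "x = \<sigma> / s"
  have x: "0 < x" using s \<sigma> by (simp add: x_def)
  define A Z where "A = inverse (w_log a)" and "Z = inverse (w_log z)"
  have c0Z: "c0 \<le> Z"
    using w_log_antimono[OF z, of 0] w_log_pos[OF z] w_log_pos[of 0]
    by (simp add: Z_def c0_def w_log_def le_imp_inverse_le)
  have A: "0 < A" using w_log_pos[OF a] by (simp add: A_def)
  have key: "A \<le> (1 + x / c0) * Z"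
  proof (cases "\<sigma> \<le> s")
    case True
    hence "w_log z \<le> w_log a" by (intro w_log_antimono z) (simp add: s_def \<sigma>_def)
    hence "A \<le> Z" using w_log_pos[OF z] by (simp add: A_def Z_def le_imp_inverse_le)
    also have "\<dots> \<le> (1 + x / c0) * Z" using x c0 c0Z by (simp add: algebra_simps)
    finally show ?thesis .
  next
    case False
    hence x1: "1 \<le> x" using s by (simp add: x_def)
    have sa: "1 - (norm a)\<^sup>2 = s * (2 - s)" and sz: "1 - (norm z)\<^sup>2 = \<sigma> * (2 - \<sigma>)"
      by (simp_all add: s_def \<sigma>_def power2_eq_square algebra_simps)
    have pz: "0 < \<sigma> * (2 - \<sigma>)" "0 < s * (2 - s)" using \<sigma> s by auto
    have "4 / (1 - (norm a)\<^sup>2) \<le> x * (4 / (1 - (norm z)\<^sup>2))"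
    proof -
      have "\<sigma> * (2 - \<sigma>) \<le> x * (s * (2 - s))"
        using False s \<sigma> by (simp add: x_def)
      thus ?thesis unfolding sa sz using pz by (simp add: field_simps)
    qed
    hence "ln (4 / (1 - (norm a)\<^sup>2)) \<le> ln (x * (4 / (1 - (norm z)\<^sup>2)))"
      using four_le_radial[OF a] by - (rule ln_mono, linarith+)
    hence "A \<le> ln (ln (x * (4 / (1 - (norm z)\<^sup>2))))"
      unfolding A_def inverse_w_log
      using loglog_pos[OF four_le_radial[OF a]] by - (rule ln_mono, linarith+)
    also have "\<dots> \<le> (x - 1) + Z"
      unfolding Z_def inverse_w_log by (rule loglog_mult_le[OF x1 four_le_radial[OF z]])
    also have "\<dots> \<le> x / c0 * Z + Z"
      using mult_left_mono[OF c0Z, of "x / c0"] x c0 by simp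
    finally show ?thesis by (simp add: algebra_simps)
  qed
  have "exp (- x) * A \<le> exp (- x) * ((1 + x / c0) * Z)"
    using key by (intro mult_left_mono) auto
  also have "\<dots> = (exp (- x) + x * exp (- x) / c0) * Z" by (simp add: algebra_simps)
  also have "\<dots> \<le> (1 + 1 / c0) * Z"
  proof (intro mult_right_mono add_mono divide_right_mono)
    have "x \<le> exp x" using exp_ge_add_one_self[of x] by linarith
    thus "x * exp (- x) \<le> 1" by (simp add: exp_minus field_simps)
  qed (use x c0 c0Z in auto)
  finally have **: "exp (- x) * A \<le> (1 + 1 / c0) * Z" .
  have Z: "0 < Z" using c0 c0Z by simp
  have "w_log z * norm z ^ n = inverse Z * (1 - \<sigma>) ^ n"
    by (simp add: Z_def \<sigma>_def)
  also have "\<dots> \<le> inverse Z * (exp 1 * exp (- x))"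
    unfolding x_def using s \<sigma> n Z by (intro mult_left_mono power_le_exp_neg) (auto simp: s_def)
  also have "\<dots> \<le> inverse Z * (exp 1 * ((1 + 1 / c0) * Z * inverse A))"
    using ** Z A by (intro mult_left_mono) (auto simp: field_simps)
  also have "\<dots> = exp 1 * (1 + 1 / c0) * inverse A"
    using Z by simp
  finally show "w_log z * norm z ^ n \<le> exp 1 * (1 + 1 / c0) * w_log a"
    by (simp add: A_def)
qed

text \<open>
  For a positive bounded weight this is, up to the factor (n+2)(n+1), the Zygmund norm of the
  monomial of degree n+2.
\<close>
definition peak :: "(complex \<Rightarrow> real) \<Rightarrow> nat \<Rightarrow> real" where
  "peak \<mu> n = (SUP z\<in>unit_disk. \<mu> z * norm z ^ n)"

lemma w_log_le: "z \<in> unit_disk \<Longrightarrow> w_log z \<le> w_log 0"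
  by (rule w_log_antimono) auto

lemma v_log_le: "z \<in> unit_disk \<Longrightarrow> v_log z \<le> 2"
proof -
  assume "z \<in> unit_disk"
  hence s: "0 < 1 - norm z" by simp
  have "v_log z \<le> (1 - norm z) * (2 / (1 - norm z) - 1)"
    unfolding v_log_def using s by (intro mult_left_mono ln_le_minus_one) auto
  also have "\<dots> = 2 - (1 - norm z)" using s by (simp add: field_simps)
  also have "\<dots> \<le> 2" using s by simp
  finally show ?thesis .
qed

lemma peak_upper:
  assumes "\<And>z. z \<in> unit_disk \<Longrightarrow> 0 < \<mu> z" "\<And>z. z \<in> unit_disk \<Longrightarrow> \<mu> z \<le> B" "z \<in> unit_disk"
  shows "\<mu> z * norm z ^ n \<le> peak \<mu> n"
  unfolding peak_def
proof (rule cSUP_upper[OF assms(3)], rule bdd_aboveI2)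
  fix z :: complex assume z: "z \<in> unit_disk"
  have "\<mu> z * norm z ^ n \<le> B * 1"
    using z assms(1,2)[OF z] by (intro mult_mono power_le_one) auto
  thus "\<mu> z * norm z ^ n \<le> B" by simp
qed

lemma peak_pos:
  assumes "\<And>z. z \<in> unit_disk \<Longrightarrow> 0 < \<mu> z" "\<And>z. z \<in> unit_disk \<Longrightarrow> \<mu> z \<le> B"
  shows "0 < peak \<mu> n"
proof -
  have h: "(1 / 2 :: complex) \<in> unit_disk" by (simp add: norm_divide)
  have "0 < \<mu> (1 / 2) * norm (1 / 2 :: complex) ^ n"
    using assms(1)[OF h] by (intro mult_pos_pos) auto
  also have "\<dots> \<le> peak \<mu> n" using assms h by (rule peak_upper)
  finally show ?thesis .
qed

lemmas peak_v_log_pos = peak_pos[of v_log, OF v_log_pos v_log_le]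
lemmas peak_w_log_pos = peak_pos[of w_log, OF w_log_pos w_log_le]

lemma peak_le:
  assumes "\<And>z. z \<in> unit_disk \<Longrightarrow> \<mu> z * norm z ^ n \<le> K"
  shows "peak \<mu> n \<le> K"
  unfolding peak_def using assms by (intro cSUP_least) auto

text \<open>
  The point 1 - 1/(n+2) is chosen at distance at most 1/n from the circle and, also for n = 0, with
  modulus at least 1/2, as \<open>power_ge_exp_neg2\<close> requires.
\<close>
lemma peak_ge_at:
  assumes "\<And>z. z \<in> unit_disk \<Longrightarrow> 0 < \<mu> z" "\<And>z. z \<in> unit_disk \<Longrightarrow> \<mu> z \<le> B"
  defines "a \<equiv> \<lambda>n::nat. complex_of_real (1 - 1 / (real n + 2))"
  shows "exp (- 2) * \<mu> (a n) \<le> peak \<mu> n"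
proof -
  have na: "norm (a n) = 1 - 1 / (real n + 2)"
    unfolding a_def norm_of_real by (simp add: abs_if field_simps)
  have a: "a n \<in> unit_disk" by (simp add: na)
  have "exp (- 2) \<le> norm (a n) ^ n"
    unfolding na by (intro power_ge_exp_neg2) (auto simp: field_simps)
  hence "exp (- 2) * \<mu> (a n) \<le> norm (a n) ^ n * \<mu> (a n)"
    using assms(1)[OF a] by (intro mult_right_mono) auto
  also have "\<dots> \<le> peak \<mu> n" using peak_upper[OF assms(1,2) a] by (simp add: mult.commute)
  finally show ?thesis .
qed

lemma peak_v_log_lower: "exp (- 2) / 2 * ln (real n) \<le> (real n + 1) * peak v_log n"
proof (cases "n = 0")
  case True
  thus ?thesis using peak_v_log_pos[of 0] by simp
next
  case False
  define a where "a = complex_of_real (1 - 1 / (real n + 2))"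
  have na: "norm a = 1 - 1 / (real n + 2)"
    unfolding a_def norm_of_real by (simp add: abs_if field_simps)
  have l0: "0 \<le> ln (real n)" using False by simp
  have "v_log a = ln (2 * (real n + 2)) / (real n + 2)" by (simp add: v_log_def na)
  moreover have "ln (real n) \<le> ln (2 * (real n + 2))" using False by simp
  ultimately have "ln (real n) / (real n + 2) \<le> v_log a" by (simp add: divide_right_mono)
  hence "exp (- 2) * (ln (real n) / (real n + 2)) \<le> exp (- 2) * v_log a"
    by (rule mult_left_mono) simp
  also have "\<dots> \<le> peak v_log n"
    unfolding a_def by (rule peak_ge_at[OF v_log_pos v_log_le])
  finally have "(real n + 1) * (exp (- 2) * (ln (real n) / (real n + 2)))
      \<le> (real n + 1) * peak v_log n" by (intro mult_left_mono) auto
  moreover have "exp (- 2) / 2 * ln (real n)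
      \<le> (real n + 1) * (exp (- 2) * (ln (real n) / (real n + 2)))"
  proof -
    have "1 / 2 \<le> (real n + 1) / (real n + 2)" by (simp add: field_simps)
    hence "exp (- 2) * ln (real n) * (1 / 2) \<le> exp (- 2) * ln (real n) * ((real n + 1) / (real n + 2))"
      using l0 by (intro mult_left_mono) auto
    thus ?thesis by (simp add: mult_ac)
  qed
  ultimately show ?thesis by linarith
qed

text \<open>
  Though the suprema of v |z|^n tend to 0, they do so more slowly than 1/n, by a factor ln n. This
  is what makes the first derivatives of the normalized monomials tend to 0.
\<close>
lemma peak_v_log_growth: "filterlim (\<lambda>n. (real n + 1) * peak v_log n) at_top sequentially"
proof (rule filterlim_at_top_mono)
  show "filterlim (\<lambda>n. exp (- 2) / 2 * ln (real n)) at_top sequentially"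
    by (rule filterlim_tendsto_pos_mult_at_top[OF tendsto_const])
      (auto intro!: filterlim_compose[OF ln_at_top filterlim_real_sequentially])
qed (rule always_eventually, rule allI, rule peak_v_log_lower)

lemma peak_w_log_lower: "exp (- 2) / (4 * (real n + 2)) \<le> peak w_log n"
proof -
  define a where "a = complex_of_real (1 - 1 / (real n + 2))"
  have na: "norm a = 1 - 1 / (real n + 2)"
    unfolding a_def norm_of_real by (simp add: abs_if field_simps)
  have a: "a \<in> unit_disk" by (simp add: na)
  have "1 / (real n + 2) = 1 - norm a" by (simp add: na)
  also have "norm a ^ 2 \<le> norm a ^ 1" using a by (intro power_decreasing) auto
  hence "1 - norm a \<le> 1 - (norm a)\<^sup>2" by simp
  finally have b: "1 / (real n + 2) \<le> 1 - (norm a)\<^sup>2" .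
  have "4 / (1 - (norm a)\<^sup>2) \<le> 4 / (1 / (real n + 2))"
    using b a by (intro divide_left_mono mult_pos_pos) (auto simp: abs_square_less_1)
  hence b': "4 / (1 - (norm a)\<^sup>2) \<le> 4 * (real n + 2)" by simp
  note l = loglog_pos[OF four_le_radial[OF a]]
  have "inverse (w_log a) \<le> ln (4 / (1 - (norm a)\<^sup>2))"
    unfolding inverse_w_log using ln_le_minus_one[of "ln (4 / (1 - (norm a)\<^sup>2))"] l by linarith
  also have "\<dots> \<le> 4 / (1 - (norm a)\<^sup>2)"
    using ln_le_minus_one[of "4 / (1 - (norm a)\<^sup>2)"] four_le_radial[OF a] by linarith
  finally have "inverse (w_log a) \<le> 4 * (real n + 2)" using b' by linarith
  hence "inverse (4 * (real n + 2)) \<le> w_log a"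
    using w_log_pos[OF a] le_imp_inverse_le[of "inverse (w_log a)" "4 * (real n + 2)"] by simp
  hence "exp (- 2) * inverse (4 * (real n + 2)) \<le> exp (- 2) * w_log a" by simp
  also have "\<dots> \<le> peak w_log n"
    unfolding a_def by (rule peak_ge_at[OF w_log_pos w_log_le])
  finally show ?thesis by (simp add: divide_inverse)
qed

lemma power_over_peak_w_log:
  fixes r :: real
  assumes "0 \<le> r" "r < 1"
  shows "(\<lambda>n. r ^ n / peak w_log n) \<longlonglongrightarrow> 0"
proof -
  have lim: "(\<lambda>n. 4 * exp 2 * (real n * r ^ n + 2 * r ^ n)) \<longlonglongrightarrow> 4 * exp 2 * (0 + 2 * 0)"
    using assms by (intro tendsto_intros powser_times_n_limit_0 LIMSEQ_power_zero) auto
  show ?thesis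
  proof (rule tendsto_sandwich[OF _ _ tendsto_const])
    show "(\<lambda>n. 4 * exp 2 * (real n * r ^ n + 2 * r ^ n)) \<longlonglongrightarrow> 0" using lim by simp
    show "\<forall>\<^sub>F n in sequentially. 0 \<le> r ^ n / peak w_log n"
      using assms peak_w_log_pos
      by (intro always_eventually allI divide_nonneg_pos) auto
    show "\<forall>\<^sub>F n in sequentially. r ^ n / peak w_log n \<le> 4 * exp 2 * (real n * r ^ n + 2 * r ^ n)"
    proof (intro always_eventually allI)
      fix n
      have "r ^ n / peak w_log n \<le> r ^ n / (exp (- 2) / (4 * (real n + 2)))"
        using assms peak_w_log_lower[of n] peak_w_log_pos[of n]
        by (intro divide_left_mono mult_pos_pos) auto
      also have "\<dots> = 4 * exp 2 * (real n * r ^ n + 2 * r ^ n)"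
        by (simp add: exp_minus field_simps)
      finally show "r ^ n / peak w_log n \<le> 4 * exp 2 * (real n * r ^ n + 2 * r ^ n)" .
    qed
  qed
qed

text \<open>
  The relation \<psi> = o(\<mu>(\<phi>)) as |\<phi>| tends to 1. It holds vacuously if the image of \<phi> has compact
  closure in the disk.
\<close>
definition little_o_along ::
  "(complex \<Rightarrow> complex) \<Rightarrow> (complex \<Rightarrow> real) \<Rightarrow> (complex \<Rightarrow> real) \<Rightarrow> bool" where
  "little_o_along \<phi> \<psi> \<mu> \<longleftrightarrow>
     (\<forall>\<epsilon>>0. \<exists>r<1. \<forall>z\<in>unit_disk. r < norm (\<phi> z) \<longrightarrow> \<psi> z \<le> \<epsilon> * \<mu> (\<phi> z))"

text \<open>
  At a point z, test with n = floor(1/(1 - |\<phi>(z)|)): then |\<phi>(z)|^n is at least exp(-2), and the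
  supremum of \<mu> |.|^n is at most a constant times \<mu>(\<phi>(z)). As |\<phi>(z)| tends to 1, this n tends to
  infinity, so the quotient N n / peak \<mu> n becomes small.
\<close>
lemma little_o_from_monomials:
  assumes pos: "\<And>z. z \<in> unit_disk \<Longrightarrow> 0 < \<mu> z" and bd: "\<And>z. z \<in> unit_disk \<Longrightarrow> \<mu> z \<le> B"
    and pk: "peak_bounded \<mu>"
    and \<phi>: "\<phi> ` unit_disk \<subseteq> unit_disk"
    and N: "\<And>n z. z \<in> unit_disk \<Longrightarrow> \<psi> z * norm (\<phi> z) ^ n \<le> N n"
    and lim: "(\<lambda>n. N n / peak \<mu> n) \<longlonglongrightarrow> 0"
  shows "little_o_along \<phi> \<psi> \<mu>"
  unfolding little_o_along_def
proof (intro allI impI)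
  fix \<epsilon> :: real assume \<epsilon>: "0 < \<epsilon>"
  obtain C where C: "0 < C" and pkC: "\<And>a z n. \<lbrakk>a \<in> unit_disk; z \<in> unit_disk;
      1 / (1 - norm a) \<le> real n + 1\<rbrakk> \<Longrightarrow> \<mu> z * norm z ^ n \<le> C * \<mu> a"
    using pk unfolding peak_bounded_def by blast
  define \<delta> where "\<delta> = \<epsilon> * exp (- 2) / C"
  have \<delta>: "0 < \<delta>" using \<epsilon> C by (simp add: \<delta>_def)
  from order_tendstoD(2)[OF lim \<delta>] obtain n0 where n0: "\<And>n. n \<ge> n0 \<Longrightarrow> N n / peak \<mu> n < \<delta>"
    by (auto simp: eventually_sequentially)
  define r where "r = 1 - 1 / (real n0 + 2)"
  have r: "1 / 2 \<le> r" "r < 1" by (auto simp: r_def field_simps)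
  show "\<exists>r<1. \<forall>z\<in>unit_disk. r < norm (\<phi> z) \<longrightarrow> \<psi> z \<le> \<epsilon> * \<mu> (\<phi> z)"
  proof (intro exI[of _ r] conjI ballI impI r)
    fix z :: complex assume z: "z \<in> unit_disk" and rz: "r < norm (\<phi> z)"
    have a: "\<phi> z \<in> unit_disk" using \<phi> z by blast
    define s where "s = 1 - norm (\<phi> z)"
    have s: "0 < s" using a by (simp add: s_def)
    \<comment> \<open>The exponent whose monomial peaks near the circle of radius 1 - s.\<close>
    define n where "n = nat \<lfloor>1 / s\<rfloor>"
    have fl: "0 \<le> \<lfloor>1 / s\<rfloor>" using s by simp
    have n1: "real n \<le> 1 / s" "1 / s \<le> real n + 1"
      unfolding n_def using fl by linarith+
    have "s < 1 / (real n0 + 2)" using rz by (simp add: s_def r_def)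
    hence "real n0 + 2 < 1 / s" using s by (simp add: field_simps)
    hence n: "n \<ge> n0" using n1 by linarith
    have pkn: "peak \<mu> n \<le> C * \<mu> (\<phi> z)"
      using n1(2) by (intro peak_le pkC a) (auto simp: s_def)
    have pk0: "0 < peak \<mu> n" using pos bd by (rule peak_pos)
    have e: "exp (- 2) \<le> norm (\<phi> z) ^ n"
      using rz r a n1(1) s by (intro power_ge_exp_neg2) (auto simp: s_def field_simps)
    show "\<psi> z \<le> \<epsilon> * \<mu> (\<phi> z)"
    proof (cases "\<psi> z \<le> 0")
      case True
      have "0 \<le> \<epsilon> * \<mu> (\<phi> z)" using \<epsilon> pos[OF a] by simp
      thus ?thesis using True by linarith
    next
      case False
      have "\<psi> z * exp (- 2) \<le> \<psi> z * norm (\<phi> z) ^ n"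
        using e False by (intro mult_left_mono) auto
      also have "\<dots> \<le> N n" by (rule N[OF z])
      also have "\<dots> \<le> \<delta> * peak \<mu> n" using n0[OF n] pk0 by (simp add: field_simps)
      also have "\<dots> \<le> \<delta> * (C * \<mu> (\<phi> z))" using \<delta> pkn by (intro mult_left_mono) auto
      also have "\<dots> = \<epsilon> * \<mu> (\<phi> z) * exp (- 2)" using C by (simp add: \<delta>_def)
      finally show ?thesis by simp
    qed
  qed
qed

text \<open>
  Where |\<phi>| > r the estimate \<psi> \<le> \<epsilon> w(\<phi>) may be multiplied by |\<phi>|^n. Elsewhere |\<phi>|^n is at most
  r^n, which is negligible against the slowly decaying suprema of w |z|^n.
\<close>
lemma monomials_from_little_o_w_log:
  assumes \<phi>: "\<phi> ` unit_disk \<subseteq> unit_disk"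
    and K: "\<And>z. z \<in> unit_disk \<Longrightarrow> \<psi> z \<le> K" and \<psi>0: "\<And>z. z \<in> unit_disk \<Longrightarrow> 0 \<le> \<psi> z"
    and o: "little_o_along \<phi> \<psi> w_log"
  shows "(\<lambda>n. (SUP z\<in>unit_disk. \<psi> z * norm (\<phi> z) ^ n) / peak w_log n) \<longlonglongrightarrow> 0"
proof -
  have K0: "0 \<le> K" using K[of 0] \<psi>0[of 0] by simp
  have pk: "0 < peak w_log n" for n by (rule peak_w_log_pos)
  have le: "\<psi> z * norm (\<phi> z) ^ n \<le> K" if "z \<in> unit_disk" for z n
  proof -
    have "\<psi> z * norm (\<phi> z) ^ n \<le> K * 1"
      using K[OF that] \<psi>0[OF that] K0 \<phi> that
      by (intro mult_mono power_le_one) (auto simp: image_subset_iff less_imp_le)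
    thus ?thesis by simp
  qed
  have S0: "0 \<le> (SUP z\<in>unit_disk. \<psi> z * norm (\<phi> z) ^ n)" for n
  proof -
    have "0 \<le> \<psi> 0 * norm (\<phi> 0) ^ n" using \<psi>0 by simp
    also have "\<dots> \<le> (SUP z\<in>unit_disk. \<psi> z * norm (\<phi> z) ^ n)"
      using le by (intro cSUP_upper bdd_aboveI2[of _ _ K]) auto
    finally show ?thesis .
  qed
  show ?thesis
  proof (rule LIMSEQ_I)
    fix \<epsilon> :: real assume \<epsilon>: "0 < \<epsilon>"
    obtain r where r1: "r < 1"
      and r: "\<And>z. z \<in> unit_disk \<Longrightarrow> r < norm (\<phi> z) \<Longrightarrow> \<psi> z \<le> \<epsilon> / 2 * w_log (\<phi> z)"
      using o \<epsilon> unfolding little_o_along_def by (meson half_gt_zero)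
    define \<rho> where "\<rho> = max r 0"
    have \<rho>: "0 \<le> \<rho>" "\<rho> < 1" using r1 by (auto simp: \<rho>_def)
    have "(\<lambda>n. K * (\<rho> ^ n / peak w_log n)) \<longlonglongrightarrow> K * 0"
      by (intro tendsto_intros power_over_peak_w_log \<rho>)
    hence "\<forall>\<^sub>F n in sequentially. K * (\<rho> ^ n / peak w_log n) < \<epsilon> / 2"
      using \<epsilon> by (intro order_tendstoD) auto
    then obtain n0 where n0: "\<And>n. n \<ge> n0 \<Longrightarrow> K * (\<rho> ^ n / peak w_log n) < \<epsilon> / 2"
      by (auto simp: eventually_sequentially)
    show "\<exists>no. \<forall>n\<ge>no. norm ((SUP z\<in>unit_disk. \<psi> z * norm (\<phi> z) ^ n) / peak w_log n - 0) < \<epsilon>"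
    proof (intro exI[of _ n0] allI impI)
      fix n assume n: "n \<ge> n0"
      have "(SUP z\<in>unit_disk. \<psi> z * norm (\<phi> z) ^ n) \<le> \<epsilon> / 2 * peak w_log n"
      proof (rule cSUP_least)
        fix z :: complex assume z: "z \<in> unit_disk"
        have a: "\<phi> z \<in> unit_disk" using \<phi> z by blast
        show "\<psi> z * norm (\<phi> z) ^ n \<le> \<epsilon> / 2 * peak w_log n"
        proof (cases "\<rho> < norm (\<phi> z)")
          case True
          hence "\<psi> z * norm (\<phi> z) ^ n \<le> \<epsilon> / 2 * w_log (\<phi> z) * norm (\<phi> z) ^ n"
            using r[OF z] by (intro mult_right_mono) (auto simp: \<rho>_def)
          also have "\<dots> = \<epsilon> / 2 * (w_log (\<phi> z) * norm (\<phi> z) ^ n)" by simp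
          also have "\<dots> \<le> \<epsilon> / 2 * peak w_log n"
            using \<epsilon> peak_upper[OF w_log_pos w_log_le a] by (intro mult_left_mono) auto
          finally show ?thesis .
        next
          case False
          hence "\<psi> z * norm (\<phi> z) ^ n \<le> K * \<rho> ^ n"
            using K[OF z] \<psi>0[OF z] K0 by (intro mult_mono power_mono) auto
          also have "\<dots> \<le> \<epsilon> / 2 * peak w_log n" using n0[OF n] pk[of n] by (simp add: field_simps)
          finally show ?thesis .
        qed
      qed auto
      hence "(SUP z\<in>unit_disk. \<psi> z * norm (\<phi> z) ^ n) / peak w_log n \<le> \<epsilon> / 2"
        using pk[of n] by (subst pos_divide_le_eq) auto
      thus "norm ((SUP z\<in>unit_disk. \<psi> z * norm (\<phi> z) ^ n) / peak w_log n - 0) < \<epsilon>"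
        using divide_nonneg_pos[OF S0[of n] pk[of n]] \<epsilon>
        unfolding real_norm_def diff_0_right by linarith
    qed
  qed
qed

section \<open>Zygmund functions on the disk\<close>

lemma disk_cong_deriv:
  assumes eq: "\<And>z. z \<in> unit_disk \<Longrightarrow> f z = g z" and z: "z \<in> unit_disk"
  shows "deriv f z = deriv g z" "deriv (deriv f) z = deriv (deriv g) z"
proof -
  have ev: "\<forall>\<^sub>F w in nhds z. w \<in> unit_disk" if "z \<in> unit_disk" for z :: complex
    using that by (intro eventually_nhds_in_open) auto
  have d: "deriv f z = deriv g z" if "z \<in> unit_disk" for z
    using ev[OF that] eq by (intro deriv_cong_ev) (auto elim: eventually_mono)
  show "deriv f z = deriv g z" by (rule d[OF z])
  show "deriv (deriv f) z = deriv (deriv g) z"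
    using ev[OF z] d by (intro deriv_cong_ev) (auto elim: eventually_mono)
qed

text \<open>
  The second derivative at z depends on the first one in a neighbourhood, whence hypotheses on the
  whole disk.
\<close>
lemma disk_derivs:
  assumes f: "\<And>z. z \<in> unit_disk \<Longrightarrow> (f has_field_derivative f1 z) (at z)"
    and f1: "\<And>z. z \<in> unit_disk \<Longrightarrow> (f1 has_field_derivative f2 z) (at z)"
  shows "f holomorphic_on unit_disk"
    and "z \<in> unit_disk \<Longrightarrow> deriv f z = f1 z"
    and "z \<in> unit_disk \<Longrightarrow> deriv (deriv f) z = f2 z"
proof -
  show "f holomorphic_on unit_disk"
    unfolding holomorphic_on_def field_differentiable_def
    using f by (blast intro: has_field_derivative_at_within)
  have d: "deriv f z = f1 z" if "z \<in> unit_disk" for z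
    by (rule DERIV_imp_deriv[OF f[OF that]])
  show "z \<in> unit_disk \<Longrightarrow> deriv f z = f1 z" by (rule d)
  assume z: "z \<in> unit_disk"
  have "deriv (deriv f) z = deriv f1 z"
    by (rule disk_cong_deriv(1)[OF d z])
  thus "deriv (deriv f) z = f2 z" using DERIV_imp_deriv[OF f1[OF z]] by simp
qed

text \<open>
  The bound on the Zygmund norm, spelled out pointwise and without a supremum. It passes to
  pointwise limits of f and its derivatives, applies to functions that are not extensional, such
  as differences of members and compositions, and includes finiteness of the norm.
\<close>
definition zygmund_le :: "(complex \<Rightarrow> real) \<Rightarrow> real \<Rightarrow> (complex \<Rightarrow> complex) \<Rightarrow> bool" where
  "zygmund_le v N f \<longleftrightarrow> f holomorphic_on unit_disk \<and>
     (\<forall>z\<in>unit_disk. norm (f 0) + norm (deriv f 0) + v z * norm (deriv (deriv f) z) \<le> N)"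

lemma zygmund_leD:
  assumes "zygmund_le v N f"
  shows "f holomorphic_on unit_disk"
    and "z \<in> unit_disk \<Longrightarrow> norm (f 0) + norm (deriv f 0) + v z * norm (deriv (deriv f) z) \<le> N"
  using assms by (auto simp: zygmund_le_def)

lemma zygmund_le_at_0:
  assumes "zygmund_le v N f" "0 \<le> v 0"
  shows "norm (f 0) \<le> N" "norm (deriv f 0) \<le> N" "0 \<le> N"
proof -
  have "0 \<le> v 0 * norm (deriv (deriv f) 0)" using assms by simp
  thus "norm (f 0) \<le> N" "norm (deriv f 0) \<le> N" "0 \<le> N"
    using zygmund_leD(2)[OF assms(1), of 0] norm_ge_zero[of "f 0"] norm_ge_zero[of "deriv f 0"]
    by (simp_all, linarith+)
qed

lemma zygmund_norm_le:
  assumes "zygmund_le v N f" shows "zygmund_norm v f \<le> N"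
proof -
  have "(SUP z\<in>unit_disk. v z * norm (deriv (deriv f) z)) \<le> N - norm (f 0) - norm (deriv f 0)"
    using assms by (intro cSUP_least) (auto simp: zygmund_le_def algebra_simps)
  thus ?thesis by (simp add: zygmund_norm_def)
qed

lemma zygmund_le_norm:
  assumes "f holomorphic_on unit_disk"
    and "bdd_above ((\<lambda>z. v z * norm (deriv (deriv f) z)) ` unit_disk)"
  shows "zygmund_le v (zygmund_norm v f) f"
  unfolding zygmund_le_def zygmund_norm_def
  using assms by (auto intro!: cSUP_upper)

lemma zygmund_space_le_norm: "f \<in> zygmund_space v \<Longrightarrow> zygmund_le v (zygmund_norm v f) f"
  by (rule zygmund_le_norm) (auto simp: zygmund_space_def)

lemma zygmund_spaceI:
  assumes "f \<in> extensional unit_disk" "zygmund_le v N f"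
  shows "f \<in> zygmund_space v"
proof -
  have "bdd_above ((\<lambda>z. v z * norm (deriv (deriv f) z)) ` unit_disk)"
  proof (rule bdd_aboveI2)
    fix z assume "z \<in> unit_disk"
    from zygmund_leD(2)[OF assms(2) this] show "v z * norm (deriv (deriv f) z) \<le> N"
      using norm_ge_zero[of "f 0"] norm_ge_zero[of "deriv f 0"] by linarith
  qed
  thus ?thesis using assms by (auto simp: zygmund_space_def zygmund_le_def)
qed

lemma zygmund_le_cong:
  assumes eq: "\<And>z. z \<in> unit_disk \<Longrightarrow> f z = g z"
  shows "zygmund_le v N f \<longleftrightarrow> zygmund_le v N g"
proof -
  have "f holomorphic_on unit_disk \<longleftrightarrow> g holomorphic_on unit_disk"
    using eq by (intro holomorphic_cong) auto
  moreover have "deriv f 0 = deriv g 0" "f 0 = g 0"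
    using disk_cong_deriv(1)[of f g 0, OF eq] eq[of 0] by auto
  moreover have "deriv (deriv f) z = deriv (deriv g) z" if "z \<in> unit_disk" for z
    using disk_cong_deriv(2)[OF eq that] .
  ultimately show ?thesis by (simp add: zygmund_le_def)
qed

lemma zygmund_le_restrict: "zygmund_le v N (restrict f unit_disk) \<longleftrightarrow> zygmund_le v N f"
  by (rule zygmund_le_cong) auto

lemma zygmund_le_diff:
  assumes v: "\<And>z. z \<in> unit_disk \<Longrightarrow> 0 \<le> v z"
    and f: "zygmund_le v A f" and g: "zygmund_le v B g"
  shows "zygmund_le v (A + B) (\<lambda>z. f z - g z)"
  unfolding zygmund_le_def
proof (intro conjI ballI)
  note h = zygmund_leD(1)[OF f] zygmund_leD(1)[OF g]
  show "(\<lambda>z. f z - g z) holomorphic_on unit_disk" using h by (intro holomorphic_intros)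
  fix z assume z: "z \<in> unit_disk"
  have "v z * norm (deriv (deriv f) z - deriv (deriv g) z)
      \<le> v z * norm (deriv (deriv f) z) + v z * norm (deriv (deriv g) z)"
    unfolding distrib_left[symmetric] using v[OF z] by (intro mult_left_mono norm_triangle_ineq4) auto
  thus "norm (f 0 - g 0) + norm (deriv (\<lambda>z. f z - g z) 0)
      + v z * norm (deriv (deriv (\<lambda>z. f z - g z)) z) \<le> A + B"
    using zygmund_leD(2)[OF f z] zygmund_leD(2)[OF g z] h z
      norm_triangle_ineq4[of "f 0" "g 0"] norm_triangle_ineq4[of "deriv f 0" "deriv g 0"]
    by (simp add: deriv_diff_disk deriv2_diff_disk)
qed

text \<open>
  Along a radius, 1/((1-t) ln(2/(1-t))) is the derivative of ln(ln 2 - ln(1-t)), so f' grows at most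
  like this function, which 1/w dominates.
\<close>
lemma zygmund_le_v_log_deriv:
  assumes f: "zygmund_le v_log N f" and z: "z \<in> unit_disk"
  shows "norm (deriv f z) \<le> N * (1 - ln (ln 2) + inverse (w_log z))"
proof -
  note hf = zygmund_leD(1)[OF f]
  have hf': "deriv f holomorphic_on unit_disk" using hf by (intro holomorphic_deriv) auto
  have lnln2: "ln (ln 2) \<le> (0::real)"
    using ln_le_minus_one[of "2::real"] by simp
  have f0: "norm (deriv f 0) \<le> N" and N: "0 \<le> N"
    using zygmund_le_at_0[OF f] v_log_pos[of 0] by auto
  have L: "0 < inverse (w_log z)" using w_log_pos[OF z] by simp
  show ?thesis
  proof (cases "z = 0")
    case True
    have "N * 1 \<le> N * (1 - ln (ln 2) + inverse (w_log z))"
      using N lnln2 L by (intro mult_left_mono) linarith+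
    thus ?thesis using f0 True by simp
  next
    case False
    define R where "R = norm z"
    have R: "0 < R" "R < 1" using z False by (auto simp: R_def)
    define u where "u = z / of_real R"
    have u: "norm u = 1" "of_real R * u = z" using R by (auto simp: u_def R_def norm_divide)
    define h where "h = (\<lambda>t. N * ln (ln 2 - ln (1 - t)))"
    have tu: "of_real t * u \<in> unit_disk" if "0 \<le> t" "t \<le> R" for t
      using that R u by (simp add: norm_mult)
    have pos: "0 < ln 2 - ln (1 - t)" if "0 \<le> t" "t \<le> R" for t
    proof -
      have "ln (1 - t) \<le> 0" using that R by simp
      moreover have "0 < ln (2::real)" by simp
      ultimately show ?thesis by linarith
    qed
    have der: "((\<lambda>t. deriv f (of_real t * u)) has_vector_derivative deriv (deriv f) (of_real t * u) * u) (at t)"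
      if "0 \<le> t" "t \<le> R" for t
    proof -
      have 1: "(deriv f has_field_derivative deriv (deriv f) (of_real t * u)) (at (of_real t * u))"
        using tu[OF that] hf' by (intro holomorphic_derivI) auto
      have 2: "((\<lambda>t. of_real t * u) has_vector_derivative u) (at t)"
        by (auto intro!: derivative_eq_intros)
      show ?thesis using field_vector_diff_chain_at[OF 2 1] by (simp add: o_def mult.commute)
    qed
    have derh: "(h has_vector_derivative N * (1 / (ln 2 - ln (1 - t)) * (1 / (1 - t)))) (at t)"
      if "0 \<le> t" "t \<le> R" for t
      unfolding has_real_derivative_iff_has_vector_derivative[symmetric] h_def
      using that R pos[OF that] by (auto intro!: derivative_eq_intros)
    \<comment> \<open>Mean value inequality along the radius through z, with h as majorant.\<close>
    have "norm (deriv f (of_real R * u) - deriv f (of_real 0 * u)) \<le> h R - h 0"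
    proof (rule differentiable_bound_general[OF R(1)])
      show "continuous_on {0..R} (\<lambda>t. deriv f (of_real t * u))"
        by (auto intro!: continuous_at_imp_continuous_on has_vector_derivative_continuous[OF der])
      show "continuous_on {0..R} h"
        by (auto intro!: continuous_at_imp_continuous_on has_vector_derivative_continuous[OF derh])
      fix t assume t: "0 < t" "t < R"
      show "((\<lambda>t. deriv f (of_real t * u)) has_vector_derivative deriv (deriv f) (of_real t * u) * u) (at t)"
        using t by (intro der) auto
      show "(h has_vector_derivative N * (1 / (ln 2 - ln (1 - t)) * (1 / (1 - t)))) (at t)"
        using t by (intro derh) auto
      have nt: "norm (of_real t * u) = t" using t u by (simp add: norm_mult)
      have v: "v_log (of_real t * u) = (1 - t) * (ln 2 - ln (1 - t))"
        unfolding v_log_def nt using t R by (simp add: ln_div)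
      have "v_log (of_real t * u) * norm (deriv (deriv f) (of_real t * u)) \<le> N"
        using zygmund_leD(2)[OF f tu[of t]] t norm_ge_zero[of "f 0"] norm_ge_zero[of "deriv f 0"]
        by linarith
      hence "norm (deriv (deriv f) (of_real t * u)) \<le> N / v_log (of_real t * u)"
        using v_log_pos[OF tu[of t]] t by (simp add: field_simps)
      also have "\<dots> = N * (1 / (ln 2 - ln (1 - t)) * (1 / (1 - t)))"
        unfolding v by simp
      finally show "norm (deriv (deriv f) (of_real t * u) * u) \<le> N * (1 / (ln 2 - ln (1 - t)) * (1 / (1 - t)))"
        using u by (simp add: norm_mult)
    qed
    hence "norm (deriv f z - deriv f 0) \<le> N * (ln (ln 2 - ln (1 - R)) - ln (ln 2))"
      by (simp add: u h_def right_diff_distrib)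
    also have "\<dots> \<le> N * (inverse (w_log z) - ln (ln 2))"
    proof (intro mult_left_mono diff_right_mono N)
      have "ln 2 - ln (1 - R) = ln (2 / (1 - R))" using R by (simp add: ln_div)
      also have "\<dots> \<le> ln (4 / (1 - (norm z)\<^sup>2))"
      proof (rule ln_mono)
        have "(1 - R) * (1 + R) \<le> (1 - R) * 2" using R by (intro mult_left_mono) auto
        hence *: "1 - R\<^sup>2 \<le> 2 * (1 - R)" by (simp add: power2_eq_square algebra_simps)
        have "0 < 1 - R\<^sup>2" using R by (simp add: abs_square_less_1)
        hence "4 / (2 * (1 - R)) \<le> 4 / (1 - R\<^sup>2)"
          using R * by (intro divide_left_mono mult_pos_pos) auto
        moreover have "4 / (2 * (1 - R)) = 2 / (1 - R)" using R by (simp add: divide_simps)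
        ultimately show "2 / (1 - R) \<le> 4 / (1 - (norm z)\<^sup>2)" unfolding R_def by metis
      qed (use R in auto)
      finally show "ln (ln 2 - ln (1 - R)) \<le> inverse (w_log z)"
        unfolding inverse_w_log using pos[of R] R by (intro ln_mono) auto
    qed
    finally have "norm (deriv f z - deriv f 0) \<le> N * (inverse (w_log z) - ln (ln 2))" .
    moreover have "norm (deriv f z) \<le> norm (deriv f z - deriv f 0) + norm (deriv f 0)"
      by (metis diff_add_cancel norm_triangle_ineq)
    ultimately show ?thesis using f0 by (simp add: algebra_simps)
  qed
qed

text \<open>
  Both f' and f are at most a constant times N/w. The bound for f is far from sharp (f is
  bounded), but it suffices for local boundedness and for showing that norm convergence implies
  pointwise convergence.
\<close>
lemma zygmund_growth:
  obtains K where "0 < K"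
    "\<And>f N z. zygmund_le v_log N f \<Longrightarrow> z \<in> unit_disk \<Longrightarrow> norm (deriv f z) * w_log z \<le> K * N"
    "\<And>f N z. zygmund_le v_log N f \<Longrightarrow> z \<in> unit_disk \<Longrightarrow> norm (f z) * w_log z \<le> K * N"
proof -
  define c where "c = w_log 0"
  have c: "0 < c" using w_log_pos[of 0] by (simp add: c_def)
  have lnln2: "ln (ln 2) \<le> (0::real)"
    using ln_le_minus_one[of "2::real"] by simp
  \<comment> \<open>K - c is the constant for f'; the summand c accounts for the value f(0).\<close>
  define K where "K = (1 - ln (ln 2)) * c + 1 + c"
  have N0: "0 \<le> N" "norm (f 0) \<le> N" if "zygmund_le v_log N f" for f N
    using zygmund_le_at_0[OF that] v_log_pos[of 0] by auto
  have d: "norm (deriv f z) * w_log z \<le> (K - c) * N"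
    if f: "zygmund_le v_log N f" and z: "z \<in> unit_disk" for f N z
  proof -
    note N = N0[OF f] and w = w_log_pos[OF z]
    have "norm (deriv f z) * w_log z \<le> N * (1 - ln (ln 2) + inverse (w_log z)) * w_log z"
      using zygmund_le_v_log_deriv[OF f z] w by (intro mult_right_mono) auto
    also have "\<dots> = N * ((1 - ln (ln 2)) * w_log z + 1)"
      using w by (simp add: algebra_simps)
    also have "\<dots> \<le> N * ((1 - ln (ln 2)) * c + 1)"
      unfolding c_def using N lnln2 w_log_le[OF z]
      by (intro mult_left_mono add_right_mono) linarith+
    finally show ?thesis by (simp add: K_def mult.commute)
  qed
  have e: "norm (f z) * w_log z \<le> K * N"
    if f: "zygmund_le v_log N f" and z: "z \<in> unit_disk" for f N z
  proof -
    note N = N0[OF f] and w = w_log_pos[OF z]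
    have "0 \<le> (1 - ln (ln 2)) * c" using lnln2 c by (intro mult_nonneg_nonneg) linarith+
    hence K: "0 \<le> K - c" by (simp add: K_def)
    have "norm (f z - f 0) \<le> (K - c) * N / w_log z * norm (z - 0)"
    proof (rule field_differentiable_bound[of "cball 0 (norm z)" f "deriv f"])
      fix x :: complex assume x: "x \<in> cball 0 (norm z)"
      hence xd: "x \<in> unit_disk" using z by simp
      show "(f has_field_derivative deriv f x) (at x within cball 0 (norm z))"
        using holomorphic_derivI[OF zygmund_leD(1)[OF f] _ xd] by (rule has_field_derivative_at_within) simp
      have "norm (deriv f x) \<le> (K - c) * N / w_log x"
        using d[OF f xd] w_log_pos[OF xd] by (simp add: field_simps)
      also have "\<dots> \<le> (K - c) * N / w_log z"
        using K N w x w_log_pos[OF xd] w_log_antimono[OF z, of x]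
        by (intro divide_left_mono mult_nonneg_nonneg mult_pos_pos) auto
      finally show "norm (deriv f x) \<le> (K - c) * N / w_log z" .
    qed auto
    also have "\<dots> \<le> (K - c) * N / w_log z * 1"
      using K N w z by (intro mult_left_mono divide_nonneg_pos mult_nonneg_nonneg) auto
    finally have "norm (f z - f 0) * w_log z \<le> (K - c) * N" using w by (simp add: field_simps)
    moreover have "norm (f 0) * w_log z \<le> N * c"
      unfolding c_def using N w w_log_le[OF z] by (intro mult_mono) auto
    moreover have "norm (f z) * w_log z \<le> (norm (f z - f 0) + norm (f 0)) * w_log z"
      using w norm_triangle_ineq[of "f z - f 0" "f 0"] by (intro mult_right_mono) auto
    ultimately show ?thesis by (simp add: algebra_simps)
  qed
  show ?thesis
  proof (rule that[of K])
    have "0 \<le> (1 - ln (ln 2)) * c" using lnln2 c by (intro mult_nonneg_nonneg) linarith+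
    thus "0 < K" unfolding K_def using c by linarith
    show "norm (deriv f z) * w_log z \<le> K * N" if "zygmund_le v_log N f" "z \<in> unit_disk" for f N z
    proof -
      have "0 \<le> c * N" using N0(1)[OF that(1)] c by simp
      thus ?thesis using d[OF that] by (simp add: algebra_simps)
    qed
  qed (rule e)
qed

lemma comp_derivs:
  assumes f: "f holomorphic_on unit_disk" and \<phi>: "\<phi> holomorphic_on unit_disk"
    and im: "\<phi> ` unit_disk \<subseteq> unit_disk"
  shows "(\<lambda>z. f (\<phi> z)) holomorphic_on unit_disk"
    and "z \<in> unit_disk \<Longrightarrow> deriv (\<lambda>z. f (\<phi> z)) z = deriv f (\<phi> z) * deriv \<phi> z"
    and "z \<in> unit_disk \<Longrightarrow> deriv (deriv (\<lambda>z. f (\<phi> z))) z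
           = deriv (deriv f) (\<phi> z) * (deriv \<phi> z)\<^sup>2 + deriv f (\<phi> z) * deriv (deriv \<phi>) z"
proof -
  have f': "deriv f holomorphic_on unit_disk" and \<phi>': "deriv \<phi> holomorphic_on unit_disk"
    using f \<phi> by (auto intro: holomorphic_deriv)
  have D: "(g has_field_derivative deriv g z) (at z)"
    if "g holomorphic_on unit_disk" "z \<in> unit_disk" for g z
    using that by (intro holomorphic_derivI) auto
  have a: "\<phi> z \<in> unit_disk" if "z \<in> unit_disk" for z using im that by blast
  have 1: "((\<lambda>z. f (\<phi> z)) has_field_derivative deriv f (\<phi> z) * deriv \<phi> z) (at z)"
    if z: "z \<in> unit_disk" for z
    using DERIV_chain2[OF D[OF f a[OF z]] D[OF \<phi> z]] .
  have 2: "((\<lambda>z. deriv f (\<phi> z) * deriv \<phi> z) has_field_derivative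
     deriv (deriv f) (\<phi> z) * (deriv \<phi> z)\<^sup>2 + deriv f (\<phi> z) * deriv (deriv \<phi>) z) (at z)"
    if z: "z \<in> unit_disk" for z
    using DERIV_mult[OF DERIV_chain2[OF D[OF f' a[OF z]] D[OF \<phi> z]] D[OF \<phi>' z]]
    by (simp add: power2_eq_square algebra_simps)
  show "(\<lambda>z. f (\<phi> z)) holomorphic_on unit_disk"
    and "z \<in> unit_disk \<Longrightarrow> deriv (\<lambda>z. f (\<phi> z)) z = deriv f (\<phi> z) * deriv \<phi> z"
    and "z \<in> unit_disk \<Longrightarrow> deriv (deriv (\<lambda>z. f (\<phi> z))) z
           = deriv (deriv f) (\<phi> z) * (deriv \<phi> z)\<^sup>2 + deriv f (\<phi> z) * deriv (deriv \<phi>) z"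
    using disk_derivs[OF 1 2] by blast+
qed

lemma disk_primitive:
  assumes "g holomorphic_on unit_disk" and z: "z \<in> unit_disk"
  shows "((\<lambda>z\<in>unit_disk. contour_integral (linepath 0 z) g) has_field_derivative g z) (at z)"
proof -
  obtain G where G: "\<And>x. x \<in> unit_disk \<Longrightarrow> (G has_field_derivative g x) (at x within unit_disk)"
    using holomorphic_convex_primitive'[OF convex_ball open_ball assms(1)] by blast
  have eq: "contour_integral (linepath 0 w) g = G w - G 0" if w: "w \<in> unit_disk" for w
  proof -
    have "closed_segment 0 w \<subseteq> unit_disk"
      using w by (intro closed_segment_subset) auto
    hence "(g has_contour_integral (G (pathfinish (linepath 0 w)) - G (pathstart (linepath 0 w)))) (linepath 0 w)"
      by (intro contour_integral_primitive[OF G]) auto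
    thus ?thesis by (simp add: contour_integral_unique)
  qed
  have "((\<lambda>w. G w - G 0) has_field_derivative g z) (at z)"
    using G[OF z] DERIV_diff[OF _ DERIV_const, of G "g z" z UNIV "G 0"]
    by (simp add: at_within_open[OF z open_ball])
  moreover have "\<forall>\<^sub>F w in nhds z. w \<in> unit_disk"
    using z by (intro eventually_nhds_in_open) auto
  hence "\<forall>\<^sub>F w in nhds z. (\<lambda>z\<in>unit_disk. contour_integral (linepath 0 z) g) w = G w - G 0"
    by eventually_elim (auto simp: eq)
  ultimately show ?thesis
    by (subst DERIV_cong_ev[OF refl _ refl])
qed

lemma disk_double_primitive:
  assumes g: "g holomorphic_on unit_disk"
  defines "P \<equiv> \<lambda>g. (\<lambda>z\<in>unit_disk. contour_integral (linepath 0 z) g)"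
  shows "P (P g) \<in> extensional unit_disk" "P (P g) holomorphic_on unit_disk"
    "P (P g) 0 = 0" "deriv (P (P g)) 0 = 0"
    "z \<in> unit_disk \<Longrightarrow> deriv (deriv (P (P g))) z = g z"
proof -
  have 2: "(P g has_field_derivative g z) (at z)" if "z \<in> unit_disk" for z
    unfolding P_def by (rule disk_primitive[OF g that])
  hence hol: "P g holomorphic_on unit_disk"
    unfolding holomorphic_on_def field_differentiable_def
    by (blast intro: has_field_derivative_at_within)
  have 1: "(P (P g) has_field_derivative P g z) (at z)" if "z \<in> unit_disk" for z
    using disk_primitive[OF hol that] by (simp add: P_def)
  show "P (P g) \<in> extensional unit_disk" by (simp add: P_def)
  show "P (P g) 0 = 0" by (simp add: P_def)
  show "P (P g) holomorphic_on unit_disk" by (rule disk_derivs(1)[OF 1 2])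
  have "P g 0 = 0" by (simp add: P_def)
  thus "deriv (P (P g)) 0 = 0" using disk_derivs(2)[of "P (P g)" "P g" g 0, OF 1 2] by simp
  show "z \<in> unit_disk \<Longrightarrow> deriv (deriv (P (P g))) z = g z" by (rule disk_derivs(3)[OF 1 2])
qed

lemma op_J'_props:
  assumes u: "u holomorphic_on unit_disk" and f: "f holomorphic_on unit_disk"
  shows "op_J' u f \<in> extensional unit_disk" "op_J' u f holomorphic_on unit_disk"
    "op_J' u f 0 = 0" "deriv (op_J' u f) 0 = 0"
    "z \<in> unit_disk \<Longrightarrow> deriv (deriv (op_J' u f)) z = f z * deriv u z"
proof -
  have "(\<lambda>s. f s * deriv u s) holomorphic_on unit_disk"
    using u f by (intro holomorphic_intros holomorphic_deriv) auto
  note P = disk_double_primitive[OF this]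
  show "op_J' u f \<in> extensional unit_disk"
    "op_J' u f holomorphic_on unit_disk"
    "op_J' u f 0 = 0" "deriv (op_J' u f) 0 = 0"
    "z \<in> unit_disk \<Longrightarrow> deriv (deriv (op_J' u f)) z = f z * deriv u z"
    unfolding op_J'_def op_J_def by (fact P)+
qed

lemma op_I'_props:
  assumes u: "u holomorphic_on unit_disk" and f: "f holomorphic_on unit_disk"
  shows "op_I' u f \<in> extensional unit_disk" "op_I' u f holomorphic_on unit_disk"
    "op_I' u f 0 = 0" "deriv (op_I' u f) 0 = 0"
    "z \<in> unit_disk \<Longrightarrow> deriv (deriv (op_I' u f)) z = deriv f z * u z"
proof -
  have "(\<lambda>s. deriv f s * u s) holomorphic_on unit_disk"
    using u f by (intro holomorphic_intros holomorphic_deriv) auto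
  note P = disk_double_primitive[OF this]
  show "op_I' u f \<in> extensional unit_disk"
    "op_I' u f holomorphic_on unit_disk"
    "op_I' u f 0 = 0" "deriv (op_I' u f) 0 = 0"
    "z \<in> unit_disk \<Longrightarrow> deriv (deriv (op_I' u f)) z = deriv f z * u z"
    unfolding op_I'_def op_I_def by (fact P)+
qed

lemma SUP_mult_left_real:
  fixes f :: "'a \<Rightarrow> real"
  assumes "0 \<le> c" "S \<noteq> {}" "bdd_above (f ` S)"
  shows "(SUP x\<in>S. c * f x) = c * (SUP x\<in>S. f x)"
proof (cases "c = 0")
  case False
  hence c: "0 < c" using assms by simp
  show ?thesis
  proof (rule antisym)
    show "(SUP x\<in>S. c * f x) \<le> c * (SUP x\<in>S. f x)"
      using assms by (intro cSUP_least mult_left_mono cSUP_upper) auto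
    have "(SUP x\<in>S. f x) \<le> (SUP x\<in>S. c * f x) / c"
    proof (rule cSUP_least)
      fix x assume x: "x \<in> S"
      obtain M where "\<And>x. x \<in> S \<Longrightarrow> f x \<le> M" using assms(3) by (auto simp: bdd_above_def)
      hence "bdd_above ((\<lambda>x. c * f x) ` S)"
        using c by (intro bdd_aboveI2[of _ _ "c * M"] mult_left_mono) auto
      hence "c * f x \<le> (SUP x\<in>S. c * f x)" using x by (intro cSUP_upper) auto
      thus "f x \<le> (SUP x\<in>S. c * f x) / c" using c by (simp add: field_simps)
    qed (use assms in auto)
    thus "c * (SUP x\<in>S. f x) \<le> (SUP x\<in>S. c * f x)" using c by (simp add: field_simps)
  qed
qed (use assms in simp)

text \<open>
  For functions vanishing to second order at 0, as the monomials and the twice integrated functions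
  do, only the supremum contributes to the norm.
\<close>
lemma zygmund_norm_flat:
  assumes "f 0 = 0" "deriv f 0 = 0"
    and "\<And>z. z \<in> unit_disk \<Longrightarrow> v z * norm (deriv (deriv f) z) = c * g z"
    and "0 \<le> c" "\<And>z. z \<in> unit_disk \<Longrightarrow> g z \<le> B"
  shows "zygmund_norm v f = c * (SUP z\<in>unit_disk. g z)"
proof -
  have "(SUP z\<in>unit_disk. v z * norm (deriv (deriv f) z)) = (SUP z\<in>unit_disk. c * g z)"
    using assms(3) by (intro SUP_cong refl) auto
  hence "zygmund_norm v f = (SUP z\<in>unit_disk. c * g z)"
    unfolding zygmund_norm_def using assms(1,2) by simp
  also have "\<dots> = c * (SUP z\<in>unit_disk. g z)"
    using assms by (intro SUP_mult_left_real bdd_aboveI2[of _ _ B]) auto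
  finally show ?thesis .
qed

lemma monomial_derivs:
  fixes n :: nat
  shows "deriv (\<lambda>z::complex. z ^ (n + 2)) z = of_nat (n + 2) * z ^ (n + 1)"
    "deriv (deriv (\<lambda>z::complex. z ^ (n + 2))) z = of_nat (n + 2) * of_nat (n + 1) * z ^ n"
proof -
  have D: "((\<lambda>z::complex. z ^ Suc m) has_field_derivative of_nat (Suc m) * z ^ m) (at z)" for m z
    using DERIV_power[OF DERIV_ident, where n = "Suc m"] by simp
  have d: "deriv (\<lambda>z::complex. z ^ Suc m) = (\<lambda>z. of_nat (Suc m) * z ^ m)" for m
    by (rule ext, rule DERIV_imp_deriv, rule D)
  have e: "deriv (\<lambda>z::complex. c * z ^ Suc m) z = c * (of_nat (Suc m) * z ^ m)" for m c z
    by (rule DERIV_imp_deriv, rule DERIV_cmult, rule D)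
  show "deriv (\<lambda>z::complex. z ^ (n + 2)) z = of_nat (n + 2) * z ^ (n + 1)"
    using d[of "Suc n"] by simp
  have "deriv (\<lambda>z::complex. z ^ (n + 2)) = (\<lambda>z. of_nat (n + 2) * z ^ Suc n)"
    using d[of "Suc n"] by simp
  thus "deriv (deriv (\<lambda>z::complex. z ^ (n + 2))) z = of_nat (n + 2) * of_nat (n + 1) * z ^ n"
    using e[of "of_nat (n + 2)" n z] by (simp add: mult_ac)
qed

lemma zygmund_norm_g_pow:
  assumes "\<And>z. z \<in> unit_disk \<Longrightarrow> 0 < v z" "\<And>z. z \<in> unit_disk \<Longrightarrow> v z \<le> B"
  shows "zygmund_norm v (g_pow (n + 2)) = real (n + 2) * real (n + 1) * peak v n"
  unfolding peak_def
proof (rule zygmund_norm_flat)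
  have eq: "g_pow (n + 2) z = z ^ (n + 2)" if "z \<in> unit_disk" for z
    using that by (simp add: g_pow_def)
  show "g_pow (n + 2) 0 = 0" by (simp add: g_pow_def)
  show "deriv (g_pow (n + 2)) 0 = 0"
    using disk_cong_deriv(1)[of "g_pow (n + 2)" "\<lambda>z. z ^ (n + 2)" 0, OF eq] monomial_derivs(1)[of n 0] by simp
  show "v z * norm (deriv (deriv (g_pow (n + 2))) z) = real (n + 2) * real (n + 1) * (v z * norm z ^ n)"
    if z: "z \<in> unit_disk" for z
  proof -
    have "deriv (deriv (g_pow (n + 2))) z = of_nat (n + 2) * of_nat (n + 1) * z ^ n"
      using disk_cong_deriv(2)[of "g_pow (n + 2)" "\<lambda>z. z ^ (n + 2)", OF eq z] monomial_derivs(2)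
      by metis
    hence "norm (deriv (deriv (g_pow (n + 2))) z) = real (n + 2) * real (n + 1) * norm z ^ n"
      by (simp only: norm_mult norm_power norm_of_nat)
    thus ?thesis by (simp only: mult_ac)
  qed
  show "v z * norm z ^ n \<le> B" if "z \<in> unit_disk" for z
  proof -
    have "v z * norm z ^ n \<le> B * 1"
      using that assms[OF that] by (intro mult_mono power_le_one) auto
    thus ?thesis by simp
  qed
qed simp

lemma zygmund_le_mono: "zygmund_le v A f \<Longrightarrow> A \<le> B \<Longrightarrow> zygmund_le v B f"
  by (force simp: zygmund_le_def)

lemma compact_subset_disk:
  assumes "compact S" "S \<subseteq> unit_disk"
  obtains \<rho> where "0 \<le> \<rho>" "\<rho> < 1" "S \<subseteq> cball 0 \<rho>"
proof (cases "S = {}")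
  case True
  thus ?thesis using that[of 0] by auto
next
  case False
  have "continuous_on S (norm :: complex \<Rightarrow> real)" by (intro continuous_intros)
  from continuous_attains_sup[OF assms(1) False this]
  obtain x where x: "x \<in> S" "\<And>y. y \<in> S \<Longrightarrow> norm y \<le> norm x" by blast
  show ?thesis using x assms(2) by (intro that[of "norm x"]) auto
qed

text \<open>
  Cauchy's inequalities on discs of radius (1 - r)/2 transfer smallness on a slightly larger disc
  to the derivatives.
\<close>
lemma locally_uniform_derivs:
  fixes h :: "nat \<Rightarrow> complex \<Rightarrow> complex"
  assumes hol: "\<And>k. h k holomorphic_on unit_disk"
    and unif: "\<And>S. compact S \<Longrightarrow> S \<subseteq> unit_disk \<Longrightarrow> uniform_limit S h (\<lambda>_. 0) sequentially"
    and r: "0 \<le> r" "r < 1" and \<eta>: "0 < \<eta>"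
  shows "\<forall>\<^sub>F k in sequentially. \<forall>\<zeta>\<in>cball 0 r.
     norm (h k \<zeta>) \<le> \<eta> \<and> norm (deriv (h k) \<zeta>) \<le> \<eta> \<and> norm (deriv (deriv (h k)) \<zeta>) \<le> \<eta>"
proof -
  define d where "d = (1 - r) / 2"
  have d: "0 < d" "d \<le> 1" "r + d < 1" using r by (auto simp: d_def field_simps)
  \<comment> \<open>Compensates the factor 2/d^2 from the Cauchy inequality for the second derivative.\<close>
  define \<beta> where "\<beta> = \<eta> * d\<^sup>2 / 2"
  have \<beta>: "0 < \<beta>" using \<eta> d by (simp add: \<beta>_def)
  have d2: "d\<^sup>2 \<le> d" using d by (simp add: power2_eq_square mult_left_le)
  have "\<beta> \<le> \<eta> * d\<^sup>2 / 2 + \<eta> * d\<^sup>2 / 2" using \<eta> by (simp add: \<beta>_def)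
  also have "\<dots> \<le> \<eta> * d" using d2 \<eta> by simp
  finally have \<beta>1: "\<beta> \<le> \<eta> * d" .
  also have "\<dots> \<le> \<eta>" using d \<eta> by simp
  finally have \<beta>0: "\<beta> \<le> \<eta>" .
  have "cball 0 (r + d) \<subseteq> unit_disk" using d by auto
  hence "uniform_limit (cball 0 (r + d)) h (\<lambda>_. 0) sequentially" by (intro unif) auto
  from uniform_limitD[OF this \<beta>]
  show ?thesis
  proof eventually_elim
    case (elim k)
    hence B: "norm (h k x) \<le> \<beta>" if "norm x \<le> r + d" for x
      using that by (auto simp: dist_norm less_imp_le)
    show ?case
    proof
      fix \<zeta> :: complex assume "\<zeta> \<in> cball 0 r"
      hence \<zeta>: "norm \<zeta> \<le> r" by simp
      have sub: "cball \<zeta> d \<subseteq> unit_disk"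
      proof
        fix x assume "x \<in> cball \<zeta> d"
        hence "norm (x - \<zeta>) \<le> d" by (simp add: dist_norm norm_minus_commute)
        thus "x \<in> unit_disk" using \<zeta> d norm_triangle_ineq[of "x - \<zeta>" \<zeta>] by simp
      qed
      have "norm ((deriv ^^ m) (h k) \<zeta>) \<le> fact m * \<beta> / d ^ m" for m
      proof (rule Cauchy_inequality[OF _ _ d(1)])
        show "h k holomorphic_on ball \<zeta> d"
          using hol sub ball_subset_cball by (blast intro: holomorphic_on_subset)
        show "continuous_on (cball \<zeta> d) (h k)"
          using hol sub by (blast intro: holomorphic_on_imp_continuous_on holomorphic_on_subset)
        fix x assume "norm (\<zeta> - x) = d"
        thus "norm (h k x) \<le> \<beta>"
          using \<zeta> norm_triangle_ineq[of "x - \<zeta>" \<zeta>] by (intro B) (simp add: norm_minus_commute)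
      qed
      from this[of 1] this[of 2]
      have "norm (deriv (h k) \<zeta>) \<le> \<beta> / d" "norm (deriv (deriv (h k)) \<zeta>) \<le> 2 * \<beta> / d\<^sup>2"
        by (simp_all add: numeral_2_eq_2)
      moreover have "\<beta> / d \<le> \<eta>" using \<beta>1 d by (simp add: field_simps)
      moreover have "2 * \<beta> / d\<^sup>2 = \<eta>" using d by (simp add: \<beta>_def)
      ultimately show "norm (h k \<zeta>) \<le> \<eta> \<and> norm (deriv (h k) \<zeta>) \<le> \<eta> \<and> norm (deriv (deriv (h k)) \<zeta>) \<le> \<eta>"
        using B[of \<zeta>] \<zeta> d \<beta>0 by auto
    qed
  qed
qed

text \<open>
  The unit ball is a normal family by \<open>zygmund_growth\<close> and Montel's theorem. The limit stays in
  the ball because the inequalities defining \<^const>\<open>zygmund_le\<close> are pointwise.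
\<close>
lemma zygmund_ball_normal:
  fixes F :: "nat \<Rightarrow> complex \<Rightarrow> complex"
  assumes F: "\<And>k. zygmund_le v_log 1 (F k)"
  obtains g r where "zygmund_le v_log 1 g" "strict_mono (r :: nat \<Rightarrow> nat)"
    "\<And>S. compact S \<Longrightarrow> S \<subseteq> unit_disk \<Longrightarrow> uniform_limit S (\<lambda>k z. F (r k) z - g z) (\<lambda>_. 0) sequentially"
proof -
  obtain K where K: "0 < K" 
    "\<And>f N z. zygmund_le v_log N f \<Longrightarrow> z \<in> unit_disk \<Longrightarrow> norm (f z) * w_log z \<le> K * N"
    using zygmund_growth by metis
  have loc: "\<exists>B. \<forall>h\<in>{f. zygmund_le v_log 1 f}. \<forall>z\<in>S. norm (h z) \<le> B"
    if S: "compact S" "S \<subseteq> unit_disk" for S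
  proof -
    obtain \<rho> where \<rho>: "0 \<le> \<rho>" "\<rho> < 1" "S \<subseteq> cball 0 \<rho>"
      using compact_subset_disk[OF S] .
    define p where "p = complex_of_real \<rho>"
    have p: "p \<in> unit_disk" "norm p = \<rho>" using \<rho> by (auto simp: p_def)
    have "norm (h z) \<le> K / w_log p" if h: "zygmund_le v_log 1 h" and z: "z \<in> S" for h z
    proof -
      have zd: "z \<in> unit_disk" and zr: "norm z \<le> norm p" using z S \<rho> p by auto
      have "norm (h z) * w_log p \<le> norm (h z) * w_log z"
        using w_log_antimono[OF p(1) zr] by (intro mult_left_mono) auto
      also have "\<dots> \<le> K" using K(2)[OF h zd] by simp
      finally show ?thesis using w_log_pos[OF p(1)] by (simp add: field_simps)
    qed
    thus ?thesis by blast
  qed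
  have holH: "h holomorphic_on unit_disk" if "h \<in> {f. zygmund_le v_log 1 f}" for h
    using that by (simp add: zygmund_leD(1))
  have rng: "range F \<subseteq> {f. zygmund_le v_log 1 f}" using F by auto
  obtain g r where g: "g holomorphic_on unit_disk" and r: "strict_mono (r :: nat \<Rightarrow> nat)"
    and lim: "\<And>S. \<lbrakk>compact S; S \<subseteq> unit_disk\<rbrakk> \<Longrightarrow> uniform_limit S (F \<circ> r) g sequentially"
    using Montel[OF open_ball holH loc rng] by metis
  have unif: "uniform_limit S (\<lambda>k z. F (r k) z - g z) (\<lambda>_. 0) sequentially"
    if "compact S" "S \<subseteq> unit_disk" for S
    using lim[OF that] by (simp add: uniform_limit_iff dist_norm)
  have hF: "F k holomorphic_on unit_disk" for k by (rule zygmund_leD(1)[OF F])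
  have hd: "(\<lambda>z. F (r k) z - g z) holomorphic_on unit_disk" for k
    using hF g by (intro holomorphic_intros)
  have conv: "(\<lambda>k. F (r k) z) \<longlonglongrightarrow> g z" "(\<lambda>k. deriv (F (r k)) z) \<longlonglongrightarrow> deriv g z"
    "(\<lambda>k. deriv (deriv (F (r k))) z) \<longlonglongrightarrow> deriv (deriv g) z" if z: "z \<in> unit_disk" for z
  proof -
    have ev: "\<forall>\<^sub>F k in sequentially. norm (F (r k) z - g z) \<le> \<eta> \<and>
        norm (deriv (F (r k)) z - deriv g z) \<le> \<eta> \<and>
        norm (deriv (deriv (F (r k))) z - deriv (deriv g) z) \<le> \<eta>" if "0 < \<eta>" for \<eta>
      using locally_uniform_derivs[OF hd unif, of "norm z" \<eta>] z that hF g
      by (auto simp: deriv_diff_disk deriv2_diff_disk elim!: eventually_mono)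
    have ev': "\<forall>\<^sub>F k in sequentially. norm (F (r k) z - g z) < \<eta> \<and>
        norm (deriv (F (r k)) z - deriv g z) < \<eta> \<and>
        norm (deriv (deriv (F (r k))) z - deriv (deriv g) z) < \<eta>" if "0 < \<eta>" for \<eta>
      using ev[of "\<eta> / 2"] that by (auto elim!: eventually_mono)
    show "(\<lambda>k. F (r k) z) \<longlonglongrightarrow> g z" "(\<lambda>k. deriv (F (r k)) z) \<longlonglongrightarrow> deriv g z"
      "(\<lambda>k. deriv (deriv (F (r k))) z) \<longlonglongrightarrow> deriv (deriv g) z"
      unfolding tendsto_iff dist_norm by (auto intro: eventually_mono[OF ev'])
  qed
  have "zygmund_le v_log 1 g"
    unfolding zygmund_le_def
  proof (intro conjI ballI g)
    fix z assume z: "z \<in> unit_disk"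
    have z0: "0 \<in> unit_disk" by simp
    have "(\<lambda>k. norm (F (r k) 0) + norm (deriv (F (r k)) 0) + v_log z * norm (deriv (deriv (F (r k))) z))
      \<longlonglongrightarrow> norm (g 0) + norm (deriv g 0) + v_log z * norm (deriv (deriv g) z)"
      by (intro tendsto_intros conv z z0)
    thus "norm (g 0) + norm (deriv g 0) + v_log z * norm (deriv (deriv g) z) \<le> 1"
      by (rule LIMSEQ_le_const2) (use zygmund_leD(2)[OF F z] in blast)
  qed
  thus ?thesis using that r unif by blast
qed


section \<open>Test functions with derivative of maximal growth\<close>

text \<open>
  A holomorphic version of ln ln(16/(1-x)). The constant 16 keeps the inner logarithm in the half
  plane Re > 1 for all \<zeta> in the disk, and exceeds 2e, so that t ln(16/t) increases on the range
  of |1 - \<zeta>|.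
\<close>
definition loglog_kernel :: "complex \<Rightarrow> complex" where
  "loglog_kernel \<zeta> = Ln (Ln (16 / (1 - \<zeta>)))"

definition loglog :: "real \<Rightarrow> real" where
  "loglog \<rho> = ln (ln (16 / (1 - \<rho>)))"

lemma ln_16_ge: "2 \<le> ln (16::real)"
proof -
  have "exp 2 = exp 1 * exp (1::real)" by (simp add: exp_add[symmetric])
  also have "\<dots> \<le> 3 * 3" using exp_le by (intro mult_mono) auto
  finally show ?thesis by (subst ln_ge_iff) auto
qed

lemma ln_radial_ge: "0 \<le> \<rho> \<Longrightarrow> \<rho> < 1 \<Longrightarrow> 2 \<le> ln (16 / (1 - \<rho>))" for \<rho> :: real
proof -
  assume \<rho>: "0 \<le> \<rho>" "\<rho> < 1"
  have "16 \<le> 16 / (1 - \<rho>)" using \<rho> by (simp add: field_simps)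
  hence "ln 16 \<le> ln (16 / (1 - \<rho>))" by (intro ln_mono) auto
  thus ?thesis using ln_16_ge by linarith
qed

lemma loglog_ge: "0 \<le> \<rho> \<Longrightarrow> \<rho> < 1 \<Longrightarrow> ln 2 \<le> loglog \<rho>"
  unfolding loglog_def using ln_radial_ge[of \<rho>] by (intro ln_mono) auto

lemma loglog_gt_0: "0 \<le> \<rho> \<Longrightarrow> \<rho> < 1 \<Longrightarrow> 0 < loglog \<rho>"
  using loglog_ge[of \<rho>] ln_gt_zero[of "2::real"] by linarith

text \<open>
  Replacing |a| by |a|^2 changes the distance to the circle by a factor at most 2, hence the
  iterated logarithm by a bounded factor.
\<close>
lemma loglog_le_double_square:
  assumes "0 \<le> \<rho>" "\<rho> < 1"
  shows "loglog \<rho> \<le> 2 * loglog (\<rho>\<^sup>2)"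
proof -
  have r2: "0 \<le> \<rho>\<^sup>2" "\<rho>\<^sup>2 < 1" using assms by (auto simp: abs_square_less_1)
  have "(1 - \<rho>) * (1 + \<rho>) \<le> (1 - \<rho>) * 2" using assms by (intro mult_left_mono) auto
  hence "1 - \<rho>\<^sup>2 \<le> 2 * (1 - \<rho>)" by (simp add: power2_eq_square algebra_simps)
  hence "16 / (1 - \<rho>) \<le> 2 * (16 / (1 - \<rho>\<^sup>2))"
    using assms r2 by (simp add: field_simps)
  hence "ln (16 / (1 - \<rho>)) \<le> ln (2 * (16 / (1 - \<rho>\<^sup>2)))"
    using assms by (intro ln_mono) auto
  also have "\<dots> = ln 2 + ln (16 / (1 - \<rho>\<^sup>2))"
    using r2 by (subst ln_mult) auto
  also have "\<dots> \<le> 2 * ln (16 / (1 - \<rho>\<^sup>2))"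
    using ln_radial_ge[OF r2] ln_le_minus_one[of "2::real"] by simp
  finally have "ln (16 / (1 - \<rho>)) \<le> 2 * ln (16 / (1 - \<rho>\<^sup>2))" .
  hence "loglog \<rho> \<le> ln (2 * ln (16 / (1 - \<rho>\<^sup>2)))"
    unfolding loglog_def using ln_radial_ge[OF assms] by (intro ln_mono) auto
  also have "\<dots> = ln 2 + loglog (\<rho>\<^sup>2)"
    unfolding loglog_def using ln_radial_ge[OF r2] by (subst ln_mult) auto
  also have "\<dots> \<le> 2 * loglog (\<rho>\<^sup>2)" using loglog_ge[OF r2] by simp
  finally show ?thesis .
qed

lemma inverse_w_log_le_loglog: "z \<in> unit_disk \<Longrightarrow> inverse (w_log z) \<le> loglog ((norm z)\<^sup>2)"
proof -
  assume z: "z \<in> unit_disk"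
  have p: "0 < 1 - (norm z)\<^sup>2" using z by (auto simp: abs_square_less_1)
  note l = loglog_pos[OF four_le_radial[OF z]]
  have "4 / (1 - (norm z)\<^sup>2) \<le> 16 / (1 - (norm z)\<^sup>2)"
    using p by (intro divide_right_mono) auto
  hence "ln (4 / (1 - (norm z)\<^sup>2)) \<le> ln (16 / (1 - (norm z)\<^sup>2))"
    using p by (intro ln_mono) auto
  thus ?thesis unfolding inverse_w_log loglog_def
    using l by - (rule ln_mono, linarith+)
qed

lemma kernel_facts:
  fixes \<zeta> :: complex
  assumes "norm \<zeta> < 1"
  shows "1 - \<zeta> \<noteq> 0" "norm (1 - \<zeta>) \<le> 2" "1 - norm \<zeta> \<le> norm (1 - \<zeta>)"
    "16 / (1 - \<zeta>) \<notin> \<real>\<^sub>\<le>\<^sub>0" "Ln (16 / (1 - \<zeta>)) \<notin> \<real>\<^sub>\<le>\<^sub>0"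
    "ln (16 / norm (1 - \<zeta>)) \<le> norm (Ln (16 / (1 - \<zeta>)))"
    "1 \<le> ln (16 / norm (1 - \<zeta>))"
    "norm (Ln (16 / (1 - \<zeta>))) \<le> ln (16 / norm (1 - \<zeta>)) + pi"
proof -
  show nz: "1 - \<zeta> \<noteq> 0" using assms by auto
  show n2: "norm (1 - \<zeta>) \<le> 2" using norm_triangle_ineq4[of 1 \<zeta>] assms by simp
  show "1 - norm \<zeta> \<le> norm (1 - \<zeta>)" using norm_triangle_ineq2[of 1 \<zeta>] by simp
  have n0: "0 < norm (1 - \<zeta>)" using nz by simp
  have "Re \<zeta> < 1" using complex_Re_le_cmod[of \<zeta>] assms by linarith
  moreover from this have "0 < (1 - Re \<zeta>)\<^sup>2 + (Im \<zeta>)\<^sup>2" by (intro add_pos_nonneg) auto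
  ultimately have "0 < Re (16 / (1 - \<zeta>))" by (simp add: Re_divide)
  thus "16 / (1 - \<zeta>) \<notin> \<real>\<^sub>\<le>\<^sub>0" by (auto simp: complex_nonpos_Reals_iff)
  have q: "16 / (1 - \<zeta>) \<noteq> 0" using nz by simp
  have re: "Re (Ln (16 / (1 - \<zeta>))) = ln (16 / norm (1 - \<zeta>))"
    using q by (simp add: norm_divide)
  have "4 \<le> 16 / norm (1 - \<zeta>)" using n2 n0 by (simp add: field_simps)
  hence l1: "1 < ln (16 / norm (1 - \<zeta>))" by (rule loglog_pos(1))
  thus "1 \<le> ln (16 / norm (1 - \<zeta>))" by simp
  show "Ln (16 / (1 - \<zeta>)) \<notin> \<real>\<^sub>\<le>\<^sub>0" using l1 re by (auto simp: complex_nonpos_Reals_iff)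
  show "ln (16 / norm (1 - \<zeta>)) \<le> norm (Ln (16 / (1 - \<zeta>)))"
    using complex_Re_le_cmod[of "Ln (16 / (1 - \<zeta>))"] re by simp
  have "norm (Ln (16 / (1 - \<zeta>))) \<le> \<bar>Re (Ln (16 / (1 - \<zeta>)))\<bar> + \<bar>Im (Ln (16 / (1 - \<zeta>)))\<bar>"
    by (rule cmod_le)
  also have "\<bar>Im (Ln (16 / (1 - \<zeta>)))\<bar> \<le> pi"
    using mpi_less_Im_Ln[OF q] Im_Ln_le_pi[OF q] by linarith
  also have "\<bar>Re (Ln (16 / (1 - \<zeta>)))\<bar> = ln (16 / norm (1 - \<zeta>))" using re l1 by simp
  finally show "norm (Ln (16 / (1 - \<zeta>))) \<le> ln (16 / norm (1 - \<zeta>)) + pi" by simp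
qed

lemma loglog_kernel_deriv:
  assumes "norm \<zeta> < 1"
  shows "(loglog_kernel has_field_derivative 1 / (Ln (16 / (1 - \<zeta>)) * (1 - \<zeta>))) (at \<zeta>)"
proof -
  note k = kernel_facts[OF assms]
  have 1: "((\<lambda>\<zeta>. 16 / (1 - \<zeta>)) has_field_derivative 16 / (1 - \<zeta>)\<^sup>2) (at \<zeta>)"
    using k(1) by (auto intro!: derivative_eq_intros simp: power2_eq_square)
  have 2: "((\<lambda>\<zeta>. Ln (16 / (1 - \<zeta>))) has_field_derivative inverse (16 / (1 - \<zeta>)) * (16 / (1 - \<zeta>)\<^sup>2)) (at \<zeta>)"
    by (rule DERIV_chain2[OF has_field_derivative_Ln[OF k(4)] 1])
  have 3: "(loglog_kernel has_field_derivative inverse (Ln (16 / (1 - \<zeta>))) * (inverse (16 / (1 - \<zeta>)) * (16 / (1 - \<zeta>)\<^sup>2))) (at \<zeta>)"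
    unfolding loglog_kernel_def by (rule DERIV_chain2[OF has_field_derivative_Ln[OF k(5)] 2])
  have "inverse (16 / u) * (16 / u\<^sup>2) = 1 / u" for u :: complex by (simp add: power2_eq_square)
  moreover have "inverse l * (1 / u) = 1 / (l * u)" for l u :: complex by (simp add: divide_inverse)
  ultimately show ?thesis using 3 by (simp only:)
qed

text \<open>
  The modulus of each of the two logarithms exceeds the modulus of its real part by at most pi, so
  the kernel is, up to a constant, not larger than its value at the real point \<rho>.
\<close>
lemma loglog_kernel_bound:
  assumes "norm \<zeta> \<le> \<rho>" "\<rho> < 1"
  shows "norm (loglog_kernel \<zeta>) \<le> (1 + (ln 3 + pi) / ln 2) * loglog \<rho>"
proof -
  have \<zeta>: "norm \<zeta> < 1" and \<rho>0: "0 \<le> \<rho>" using assms norm_ge_zero[of \<zeta>] by linarith+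
  note k = kernel_facts[OF \<zeta>]
  define Y where "Y = ln (16 / (1 - \<rho>))"
  have Y: "2 \<le> Y" unfolding Y_def by (rule ln_radial_ge[OF \<rho>0 assms(2)])
  have n0: "0 < norm (1 - \<zeta>)" using k(1) by simp
  have "16 / norm (1 - \<zeta>) \<le> 16 / (1 - \<rho>)"
    using k(3) assms n0 by (intro divide_left_mono mult_pos_pos) auto
  hence "ln (16 / norm (1 - \<zeta>)) \<le> Y" unfolding Y_def using n0 by (intro ln_mono) auto
  moreover have "pi \<le> 2 * Y" using Y pi_less_4 by linarith
  ultimately have l3: "norm (Ln (16 / (1 - \<zeta>))) \<le> 3 * Y" using k(8) by linarith
  have l1: "1 \<le> norm (Ln (16 / (1 - \<zeta>)))" using k(6,7) by linarith
  have q: "Ln (16 / (1 - \<zeta>)) \<noteq> 0" using l1 by auto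
  have "norm (loglog_kernel \<zeta>) \<le> \<bar>Re (loglog_kernel \<zeta>)\<bar> + \<bar>Im (loglog_kernel \<zeta>)\<bar>" by (rule cmod_le)
  also have "\<bar>Im (loglog_kernel \<zeta>)\<bar> \<le> pi"
    unfolding loglog_kernel_def using mpi_less_Im_Ln[OF q] Im_Ln_le_pi[OF q] by linarith
  also have "\<bar>Re (loglog_kernel \<zeta>)\<bar> = ln (norm (Ln (16 / (1 - \<zeta>))))"
    unfolding loglog_kernel_def using q l1 by simp
  also have "\<dots> \<le> ln (3 * Y)" using l3 l1 by (intro ln_mono) auto
  also have "\<dots> = ln 3 + loglog \<rho>" unfolding loglog_def Y_def[symmetric] using Y by (subst ln_mult) auto
  finally have "norm (loglog_kernel \<zeta>) \<le> (ln 3 + pi) * 1 + loglog \<rho>" by simp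
  also have "\<dots> \<le> (ln 3 + pi) * (loglog \<rho> / ln 2) + loglog \<rho>"
    using loglog_ge[OF \<rho>0 assms(2)]
    by (intro add_right_mono mult_left_mono) (auto simp: le_divide_eq)
  finally show ?thesis by (simp add: algebra_simps)
qed

lemma loglog_kernel_of_real:
  assumes "0 \<le> x" "x < 1"
  shows "loglog_kernel (of_real x) = of_real (loglog x)"
proof -
  have p: "0 < 16 / (1 - x)" using assms by simp
  have l: "0 < ln (16 / (1 - x))" using ln_radial_ge[OF assms] by linarith
  have "16 / (1 - complex_of_real x) = of_real (16 / (1 - x))" by simp
  hence "loglog_kernel (of_real x) = Ln (Ln (of_real (16 / (1 - x))))" by (simp only: loglog_kernel_def)
  also have "\<dots> = of_real (loglog x)"
    unfolding loglog_def using p l by (simp only: Ln_of_real)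
  finally show ?thesis .
qed

text \<open>
  The derivative of the kernel is the reciprocal of the product on the right, so this bounds it
  by 1/v.
\<close>
lemma kernel_v_log:
  fixes \<zeta> z :: complex
  assumes "norm \<zeta> \<le> norm z" "norm z < 1"
  shows "v_log z \<le> norm (Ln (16 / (1 - \<zeta>)) * (1 - \<zeta>))"
proof -
  have \<zeta>: "norm \<zeta> < 1" using assms by simp
  note k = kernel_facts[OF \<zeta>]
  have "v_log z \<le> (1 - norm z) * ln (16 / (1 - norm z))"
    unfolding v_log_def using assms
    by (intro mult_left_mono ln_mono divide_right_mono) auto
  also have "\<dots> \<le> norm (1 - \<zeta>) * ln (16 / norm (1 - \<zeta>))"
  proof (rule id_times_ln_div_mono)
    have "norm (1 - \<zeta>) * exp 1 \<le> 2 * 3" using k(2) exp_le by (intro mult_mono) auto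
    thus "norm (1 - \<zeta>) * exp 1 \<le> 16" by simp
  qed (use assms k(3) in auto)
  also have "\<dots> \<le> norm (1 - \<zeta>) * norm (Ln (16 / (1 - \<zeta>)))"
    using k(6) by (intro mult_left_mono) auto
  finally show ?thesis by (simp add: norm_mult mult.commute)
qed

text \<open>
  Take f_a' (z) = l(conj(a) z)^2 / l(|a|^2), where l is the loglog kernel. At z = a this is l(|a|^2),
  at least 1/w(a). In f_a'' one factor l(conj(a) z) is compensated by the denominator and the
  derivative of l is O(1/v), so the norms are bounded. On compact sets the numerator is bounded
  while the denominator tends to infinity as |a| tends to 1; the exponent 2 is there to make this
  decay possible without lowering the value at a.
\<close>
lemma loglog_test_functions:
  "\<exists>K>0. \<exists>A f. \<forall>a\<in>unit_disk. zygmund_le v_log K (f a) \<and>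
     inverse (w_log a) \<le> norm (deriv (f a) a) \<and>
     (\<forall>z\<in>unit_disk. norm (f a z) \<le> A z * w_log a)"
proof -
  define D :: real where "D = 1 + (ln 3 + pi) / ln 2"
  have D: "1 \<le> D" unfolding D_def using pi_gt_zero by (simp add: add_nonneg_nonneg)
  define P where "P = (\<lambda>a::complex. loglog ((norm a)\<^sup>2))"
  define G where "G = (\<lambda>a z. (loglog_kernel (cnj a * z))\<^sup>2 / of_real (P a))"
  define G' where "G' = (\<lambda>a z. 2 * loglog_kernel (cnj a * z) * (cnj a / (Ln (16 / (1 - cnj a * z)) * (1 - cnj a * z))) / of_real (P a))"
  define f where "f = (\<lambda>a. (\<lambda>z\<in>unit_disk. contour_integral (linepath 0 z) (G a)))"
  have P: "0 < P a" if "a \<in> unit_disk" for a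
    unfolding P_def using that by (intro loglog_gt_0) (auto simp: abs_square_less_1)
  have az: "norm (cnj a * z) < 1" "norm (cnj a * z) \<le> norm z" "norm (cnj a * z) \<le> norm a"
    if "a \<in> unit_disk" "z \<in> unit_disk" for a z :: complex
  proof -
    have "norm a * norm z \<le> 1 * norm z" using that by (intro mult_right_mono) auto
    moreover have "norm a * norm z \<le> norm a * 1" using that by (intro mult_left_mono) auto
    ultimately show "norm (cnj a * z) < 1" "norm (cnj a * z) \<le> norm z" "norm (cnj a * z) \<le> norm a"
      using that by (auto simp: norm_mult)
  qed
  have dG: "(G a has_field_derivative G' a z) (at z)" if a: "a \<in> unit_disk" and z: "z \<in> unit_disk" for a z
  proof -
    define c where "c = 1 / (Ln (16 / (1 - cnj a * z)) * (1 - cnj a * z))"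
    have "((\<lambda>z. cnj a * z) has_field_derivative cnj a) (at z)"
      by (auto intro!: derivative_eq_intros)
    from DERIV_chain2[OF loglog_kernel_deriv[OF az(1)[OF a z]] this]
    have "((\<lambda>z. loglog_kernel (cnj a * z)) has_field_derivative c * cnj a) (at z)" by (simp add: c_def)
    hence "((\<lambda>z. (loglog_kernel (cnj a * z))\<^sup>2 / of_real (P a)) has_field_derivative
        2 * loglog_kernel (cnj a * z) * (c * cnj a) / of_real (P a)) (at z)"
      using P[OF a] by (auto intro!: derivative_eq_intros)
    thus ?thesis by (simp add: G_def G'_def c_def)
  qed
  have hG: "G a holomorphic_on unit_disk" if "a \<in> unit_disk" for a
    unfolding holomorphic_on_def field_differentiable_def
    using dG[OF that] by (blast intro: has_field_derivative_at_within)
  have df: "(f a has_field_derivative G a z) (at z)" if "a \<in> unit_disk" "z \<in> unit_disk" for a z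
    unfolding f_def by (rule disk_primitive[OF hG[OF that(1)] that(2)])
  have loglog_kernel_a: "norm (loglog_kernel (cnj a * z)) \<le> 2 * D * P a" if a: "a \<in> unit_disk" and z: "z \<in> unit_disk" for a z
  proof -
    have "norm (loglog_kernel (cnj a * z)) \<le> D * loglog (norm a)"
      unfolding D_def using az[OF a z] a by (intro loglog_kernel_bound) auto
    also have "\<dots> \<le> D * (2 * P a)"
      unfolding P_def using a D by (intro mult_left_mono loglog_le_double_square) auto
    finally show ?thesis by simp
  qed
  have loglog_kernel_z: "norm (loglog_kernel (cnj a * z)) \<le> D * loglog (norm z)" if a: "a \<in> unit_disk" and z: "z \<in> unit_disk" for a z
    unfolding D_def using az[OF a z] z by (intro loglog_kernel_bound) auto
  have wP: "inverse (P a) \<le> w_log a" if a: "a \<in> unit_disk" for a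
    using le_imp_inverse_le[OF inverse_w_log_le_loglog[OF a]] w_log_pos[OF a] by (simp add: P_def)
  have Gz: "norm (G a z) \<le> (D * loglog (norm z))\<^sup>2 * w_log a" if a: "a \<in> unit_disk" and z: "z \<in> unit_disk" for a z
  proof -
    have "norm (G a z) = (norm (loglog_kernel (cnj a * z)))\<^sup>2 * inverse (P a)"
      using P[OF a] by (simp add: G_def norm_divide norm_power field_simps)
    also have "\<dots> \<le> (D * loglog (norm z))\<^sup>2 * w_log a"
      using loglog_kernel_z[OF a z] wP[OF a] P[OF a] by (intro mult_mono power_mono) auto
    finally show ?thesis .
  qed
  define A where "A = (\<lambda>z::complex. (D * loglog (norm z))\<^sup>2 * norm z)"
  define K where "K = (D * loglog 0)\<^sup>2 * w_log 0 + 4 * D"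
  show ?thesis
  proof (intro exI[of _ K] conjI exI[of _ A] exI[of _ f] ballI)
    show "0 < K" unfolding K_def using D w_log_pos[of 0] by (intro add_nonneg_pos) auto
    fix a :: complex assume a: "a \<in> unit_disk"
    have dd1: "f a holomorphic_on unit_disk"
      and dd2: "z \<in> unit_disk \<Longrightarrow> deriv (f a) z = G a z"
      and dd3: "z \<in> unit_disk \<Longrightarrow> deriv (deriv (f a)) z = G' a z" for z
      using disk_derivs[OF df[OF a] dG[OF a]] by blast+
    show "zygmund_le v_log K (f a)"
      unfolding zygmund_le_def
    proof (intro conjI ballI dd1)
      fix z :: complex assume z: "z \<in> unit_disk"
      have f0: "f a 0 = 0" by (simp add: f_def)
      have "norm (deriv (f a) 0) \<le> (D * loglog 0)\<^sup>2 * w_log a"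
        using dd2[of 0] Gz[OF a, of 0] by simp
      also have "\<dots> \<le> (D * loglog 0)\<^sup>2 * w_log 0"
        using w_log_le[OF a] by (intro mult_left_mono) auto
      finally have f1: "norm (deriv (f a) 0) \<le> (D * loglog 0)\<^sup>2 * w_log 0" .
      have v: "v_log z \<le> norm (Ln (16 / (1 - cnj a * z)) * (1 - cnj a * z))"
        using az[OF a z] z by (intro kernel_v_log) auto
      have v0: "0 < v_log z" by (rule v_log_pos[OF z])
      have "norm (deriv (deriv (f a)) z) = 2 * norm (loglog_kernel (cnj a * z)) * (norm a / norm (Ln (16 / (1 - cnj a * z)) * (1 - cnj a * z))) / P a"
        using dd3[OF z] P[OF a] by (simp add: G'_def norm_mult norm_divide)
      also have "\<dots> \<le> 2 * (2 * D * P a) * (1 / v_log z) / P a"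
        using loglog_kernel_a[OF a z] a v v0 P[OF a] D
        by (intro divide_right_mono mult_mono frac_le) auto
      also have "\<dots> = 4 * D / v_log z" using P[OF a] by simp
      finally have "v_log z * norm (deriv (deriv (f a)) z) \<le> 4 * D" using v0 by (simp add: field_simps)
      thus "norm (f a 0) + norm (deriv (f a) 0) + v_log z * norm (deriv (deriv (f a)) z) \<le> K"
        using f0 f1 by (simp add: K_def)
    qed
    have "cnj a * a = of_real ((norm a)\<^sup>2)" by (simp add: complex_norm_square[symmetric] mult.commute)
    hence "loglog_kernel (cnj a * a) = of_real (P a)"
      unfolding P_def using a loglog_kernel_of_real[of "(norm a)\<^sup>2"] by (simp add: abs_square_less_1)
    hence "deriv (f a) a = of_real (P a)"
      using dd2[OF a] P[OF a] by (simp add: G_def power2_eq_square)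
    thus "inverse (w_log a) \<le> norm (deriv (f a) a)"
      using inverse_w_log_le_loglog[OF a] P[OF a] by (simp add: P_def)
    fix z :: complex assume z: "z \<in> unit_disk"
    have "norm (f a z - f a 0) \<le> (D * loglog (norm z))\<^sup>2 * w_log a * norm (z - 0)"
    proof (rule field_differentiable_bound[of "cball 0 (norm z)" "f a" "G a"])
      fix x :: complex assume x: "x \<in> cball 0 (norm z)"
      hence xd: "x \<in> unit_disk" using z by simp
      show "(f a has_field_derivative G a x) (at x within cball 0 (norm z))"
        using df[OF a xd] by (rule has_field_derivative_at_within)
      have "norm (loglog_kernel (cnj a * x)) \<le> D * loglog (norm z)"
        unfolding D_def using az[OF a xd] x z by (intro loglog_kernel_bound) auto
      hence "(norm (loglog_kernel (cnj a * x)))\<^sup>2 * inverse (P a) \<le> (D * loglog (norm z))\<^sup>2 * w_log a"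
        using wP[OF a] P[OF a] by (intro mult_mono power_mono) auto
      thus "norm (G a x) \<le> (D * loglog (norm z))\<^sup>2 * w_log a"
        using P[OF a] by (simp add: G_def norm_divide norm_power field_simps)
    qed auto
    thus "norm (f a z) \<le> A z * w_log a" by (simp add: A_def f_def mult_ac)
  qed
qed

lemma w_log_tendsto_0:
  assumes "\<And>k. a k \<in> unit_disk" "\<And>k. 1 - 1 / (real k + 1) < norm (a k)"
  shows "(\<lambda>k. w_log (a k)) \<longlonglongrightarrow> 0"
proof -
  have lower: "ln (ln (real k)) \<le> inverse (w_log (a k))" if k: "k \<ge> 3" for k
  proof -
    note l = loglog_pos[OF four_le_radial[OF assms(1)[of k]]]
    have n1: "norm (a k) < 1" using assms(1)[of k] by simp
    have p: "0 < 1 - (norm (a k))\<^sup>2" using n1 by (simp add: abs_square_less_1)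
    have "(1 - norm (a k)) * (1 + norm (a k)) \<le> (1 - norm (a k)) * 2"
      using n1 by (intro mult_left_mono) auto
    hence "1 - (norm (a k))\<^sup>2 \<le> 2 * (1 - norm (a k))" by (simp add: power2_eq_square algebra_simps)
    also have "\<dots> \<le> 2 * (1 / (real k + 1))" using assms(2)[of k] by (intro mult_left_mono) auto
    finally have "real k * (1 - (norm (a k))\<^sup>2) \<le> real k * (2 * (1 / (real k + 1)))"
      by (intro mult_left_mono) auto
    also have "\<dots> \<le> 4" by (simp add: field_simps)
    finally have "real k \<le> 4 / (1 - (norm (a k))\<^sup>2)" using p by (simp add: field_simps)
    hence "ln (real k) \<le> ln (4 / (1 - (norm (a k))\<^sup>2))" using k by (intro ln_mono) auto
    moreover have "1 \<le> ln (real k)"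
    proof -
      have "exp 1 \<le> real k" using exp_le k by linarith
      thus ?thesis using k by (subst ln_ge_iff) auto
    qed
    ultimately show ?thesis unfolding inverse_w_log by - (rule ln_mono, linarith+)
  qed
  have "filterlim (\<lambda>k. inverse (w_log (a k))) at_top sequentially"
  proof (rule filterlim_at_top_mono)
    show "filterlim (\<lambda>k. ln (ln (real k))) at_top sequentially"
      by (intro filterlim_compose[OF ln_at_top] filterlim_real_sequentially)
    show "\<forall>\<^sub>F k in sequentially. ln (ln (real k)) \<le> inverse (w_log (a k))"
      using lower unfolding eventually_sequentially by blast
  qed
  from tendsto_inverse_0_at_top[OF this] show ?thesis by simp
qed

section \<open>Compactness of the composition operator\<close>

locale disk_self_map =
  fixes \<phi> :: "complex \<Rightarrow> complex"
  assumes hol: "\<phi> holomorphic_on unit_disk" and im: "\<phi> ` unit_disk \<subseteq> unit_disk"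
begin

text \<open>
  The moduli of the coefficients of f''(\<phi>) and of f'(\<phi>) in v (f o \<phi>)'' are \<psi>1 and \<psi>2.
\<close>
definition \<psi>1 :: "complex \<Rightarrow> real" where "\<psi>1 z = v_log z * (norm (deriv \<phi> z))\<^sup>2"
definition \<psi>2 :: "complex \<Rightarrow> real" where "\<psi>2 z = v_log z * norm (deriv (deriv \<phi>) z)"

lemma in_disk: "z \<in> unit_disk \<Longrightarrow> \<phi> z \<in> unit_disk"
  using im by blast

lemma \<psi>_nonneg: "z \<in> unit_disk \<Longrightarrow> 0 \<le> \<psi>1 z" "z \<in> unit_disk \<Longrightarrow> 0 \<le> \<psi>2 z"
  using v_log_pos by (auto simp: \<psi>1_def \<psi>2_def less_imp_le)

lemma comp_second_deriv_le:
  assumes f: "f holomorphic_on unit_disk" and z: "z \<in> unit_disk"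
  shows "v_log z * norm (deriv (deriv (\<lambda>z. f (\<phi> z))) z)
     \<le> norm (deriv (deriv f) (\<phi> z)) * \<psi>1 z + norm (deriv f (\<phi> z)) * \<psi>2 z"
proof -
  have "norm (deriv (deriv (\<lambda>z. f (\<phi> z))) z)
      \<le> norm (deriv (deriv f) (\<phi> z)) * (norm (deriv \<phi> z))\<^sup>2
        + norm (deriv f (\<phi> z)) * norm (deriv (deriv \<phi>) z)"
    unfolding comp_derivs(3)[OF f hol im z]
    using norm_triangle_ineq by (metis norm_mult norm_power)
  from mult_left_mono[OF this less_imp_le[OF v_log_pos[OF z]]]
  show ?thesis by (simp add: \<psi>1_def \<psi>2_def algebra_simps)
qed

text \<open>
  The pointwise condition equivalent to compactness and, for bounded \<psi>1 and \<psi>2, to the two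
  limits of the theorem being 0.
\<close>
definition vanishing :: bool where
  "vanishing \<longleftrightarrow> (\<exists>M. \<forall>z\<in>unit_disk. \<psi>1 z \<le> M \<and> \<psi>2 z \<le> M) \<and>
     little_o_along \<phi> \<psi>1 v_log \<and> little_o_along \<phi> \<psi>2 w_log"

text \<open>
  At points with |\<phi>| > r the estimate is uniform over functions of norm N. At the other points, f
  enters only through its values on the compact disc of radius r.
\<close>
lemma vanishing_split:
  assumes "vanishing" and "0 < \<epsilon>"
  obtains r M where "0 \<le> r" "r < 1" "0 \<le> M"
    "\<And>f N z. \<lbrakk>zygmund_le v_log N f; z \<in> unit_disk; r < norm (\<phi> z)\<rbrakk> \<Longrightarrow>
       v_log z * norm (deriv (deriv (\<lambda>z. f (\<phi> z))) z) \<le> \<epsilon> * N"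
    "\<And>f z. \<lbrakk>f holomorphic_on unit_disk; z \<in> unit_disk\<rbrakk> \<Longrightarrow>
       v_log z * norm (deriv (deriv (\<lambda>z. f (\<phi> z))) z)
         \<le> M * (norm (deriv (deriv f) (\<phi> z)) + norm (deriv f (\<phi> z)))"
proof -
  obtain M where M: "\<And>z. z \<in> unit_disk \<Longrightarrow> \<psi>1 z \<le> M" "\<And>z. z \<in> unit_disk \<Longrightarrow> \<psi>2 z \<le> M"
    using assms(1) unfolding vanishing_def by blast
  have M0: "0 \<le> M" using M(1)[of 0] \<psi>_nonneg(1)[of 0] by simp
  obtain K where K: "0 < K" 
    "\<And>f N z. zygmund_le v_log N f \<Longrightarrow> z \<in> unit_disk \<Longrightarrow> norm (deriv f z) * w_log z \<le> K * N"
    using zygmund_growth by metis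
  define \<delta> where "\<delta> = \<epsilon> / (1 + K)"
  have \<delta>: "0 < \<delta>" using assms(2) K by (simp add: \<delta>_def)
  obtain r1 where r1: "r1 < 1" "\<And>z. z \<in> unit_disk \<Longrightarrow> r1 < norm (\<phi> z) \<Longrightarrow> \<psi>1 z \<le> \<delta> * v_log (\<phi> z)"
    using assms(1) \<delta> unfolding vanishing_def little_o_along_def by meson
  obtain r2 where r2: "r2 < 1" "\<And>z. z \<in> unit_disk \<Longrightarrow> r2 < norm (\<phi> z) \<Longrightarrow> \<psi>2 z \<le> \<delta> * w_log (\<phi> z)"
    using assms(1) \<delta> unfolding vanishing_def little_o_along_def by meson
  show ?thesis
  proof (rule that[of "max 0 (max r1 r2)" M])
    fix f N z
    assume f: "zygmund_le v_log N f" and z: "z \<in> unit_disk" and r: "max 0 (max r1 r2) < norm (\<phi> z)"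
    note a = in_disk[OF z]
    have d2: "norm (deriv (deriv f) (\<phi> z)) * v_log (\<phi> z) \<le> N"
      using zygmund_leD(2)[OF f a] norm_ge_zero[of "f 0"] norm_ge_zero[of "deriv f 0"]
      by (simp add: mult.commute, linarith)
    have "v_log z * norm (deriv (deriv (\<lambda>z. f (\<phi> z))) z)
        \<le> norm (deriv (deriv f) (\<phi> z)) * (\<delta> * v_log (\<phi> z)) + norm (deriv f (\<phi> z)) * (\<delta> * w_log (\<phi> z))"
      using comp_second_deriv_le[OF zygmund_leD(1)[OF f] z] r1(2)[OF z] r2(2)[OF z] r
      by (elim order_trans, intro add_mono mult_left_mono) auto
    also have "\<dots> = \<delta> * (norm (deriv (deriv f) (\<phi> z)) * v_log (\<phi> z) + norm (deriv f (\<phi> z)) * w_log (\<phi> z))"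
      by (simp add: algebra_simps)
    also have "\<dots> \<le> \<delta> * (N + K * N)"
      using \<delta> d2 K(2)[OF f a] by (intro mult_left_mono add_mono) auto
    also have "\<dots> = \<epsilon> * N" using K by (simp add: \<delta>_def field_simps)
    finally show "v_log z * norm (deriv (deriv (\<lambda>z. f (\<phi> z))) z) \<le> \<epsilon> * N" .
  next
    fix f z assume f: "f holomorphic_on unit_disk" and z: "z \<in> unit_disk"
    have "v_log z * norm (deriv (deriv (\<lambda>z. f (\<phi> z))) z)
        \<le> norm (deriv (deriv f) (\<phi> z)) * M + norm (deriv f (\<phi> z)) * M"
      using comp_second_deriv_le[OF f z] M[OF z]
      by (elim order_trans, intro add_mono mult_left_mono) auto
    thus "v_log z * norm (deriv (deriv (\<lambda>z. f (\<phi> z))) z)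
         \<le> M * (norm (deriv (deriv f) (\<phi> z)) + norm (deriv f (\<phi> z)))"
      by (simp add: algebra_simps)
  qed (use r1 r2 M0 in auto)
qed

lemma vanishing_maps_space:
  assumes van: "vanishing" and f: "zygmund_le v_log N f"
  shows "\<exists>B. zygmund_le v_log B (\<lambda>z. f (\<phi> z))"
proof -
  note hf = zygmund_leD(1)[OF f]
  obtain r M where r: "0 \<le> r" "r < 1" "0 \<le> M" and
    far: "\<And>f N z. \<lbrakk>zygmund_le v_log N f; z \<in> unit_disk; r < norm (\<phi> z)\<rbrakk> \<Longrightarrow>
       v_log z * norm (deriv (deriv (\<lambda>z. f (\<phi> z))) z) \<le> 1 * N" and
    near: "\<And>f z. \<lbrakk>f holomorphic_on unit_disk; z \<in> unit_disk\<rbrakk> \<Longrightarrow>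
       v_log z * norm (deriv (deriv (\<lambda>z. f (\<phi> z))) z)
         \<le> M * (norm (deriv (deriv f) (\<phi> z)) + norm (deriv f (\<phi> z)))"
    using vanishing_split[OF van zero_less_one] by blast
  have "continuous_on (cball 0 r) (\<lambda>z. norm (deriv (deriv f) z) + norm (deriv f z))"
  proof (intro continuous_intros holomorphic_on_imp_continuous_on)
    have "cball 0 r \<subseteq> unit_disk" using r by auto
    moreover have "deriv f holomorphic_on unit_disk" "deriv (deriv f) holomorphic_on unit_disk"
      using hf by (auto intro!: holomorphic_deriv)
    ultimately show "deriv (deriv f) holomorphic_on cball 0 r" "deriv f holomorphic_on cball 0 r"
      by (blast intro: holomorphic_on_subset)+
  qed
  hence "compact ((\<lambda>z. norm (deriv (deriv f) z) + norm (deriv f z)) ` cball 0 r)"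
    by (intro compact_continuous_image) auto
  then obtain D where D: "\<And>z. z \<in> cball 0 r \<Longrightarrow> norm (deriv (deriv f) z) + norm (deriv f z) \<le> D"
    using bounded_imp_bdd_above[OF compact_imp_bounded] by (force simp: bdd_above_def)
  show ?thesis
    unfolding zygmund_le_def
  proof (intro exI conjI ballI comp_derivs(1)[OF hf hol im])
    fix z assume z: "z \<in> unit_disk"
    have "v_log z * norm (deriv (deriv (\<lambda>z. f (\<phi> z))) z) \<le> max N (M * D)"
    proof (cases "r < norm (\<phi> z)")
      case True
      thus ?thesis using far[OF f z] by simp
    next
      case False
      hence "M * (norm (deriv (deriv f) (\<phi> z)) + norm (deriv f (\<phi> z))) \<le> M * D"
        using r by (intro mult_left_mono D) auto
      thus ?thesis using near[OF hf z] by linarith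
    qed
    thus "norm (f (\<phi> 0)) + norm (deriv (\<lambda>z. f (\<phi> z)) 0) + v_log z * norm (deriv (deriv (\<lambda>z. f (\<phi> z))) z)
        \<le> norm (f (\<phi> 0)) + norm (deriv (\<lambda>z. f (\<phi> z)) 0) + max N (M * D)" by simp
  qed
qed

text \<open>
  Where |\<phi>| > r the images are small by \<open>vanishing_split\<close>, uniformly in k. Where |\<phi>| \<le> r they
  are small because h k and its first two derivatives tend to 0 uniformly on the disc of radius r.
\<close>
lemma vanishing_converges:
  fixes h :: "nat \<Rightarrow> complex \<Rightarrow> complex"
  assumes van: "vanishing" and h: "\<And>k. zygmund_le v_log N (h k)"
    and unif: "\<And>S. compact S \<Longrightarrow> S \<subseteq> unit_disk \<Longrightarrow> uniform_limit S h (\<lambda>_. 0) sequentially"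
    and \<epsilon>: "0 < \<epsilon>"
  shows "\<forall>\<^sub>F k in sequentially. zygmund_le v_log \<epsilon> (\<lambda>z. h k (\<phi> z))"
proof -
  have N: "0 \<le> N" using zygmund_le_at_0(3)[OF h[of 0]] v_log_pos[of 0] by simp
  define \<delta> where "\<delta> = \<epsilon> / (2 * (N + 1))"
  have \<delta>: "0 < \<delta>" using \<epsilon> N by (simp add: \<delta>_def)
  have \<delta>N: "\<delta> * N \<le> \<epsilon> / 2"
  proof -
    have "\<delta> * N \<le> \<delta> * (N + 1)" using \<delta> by simp
    also have "\<dots> = \<epsilon> / 2" using N by (simp add: \<delta>_def field_simps)
    finally show ?thesis .
  qed
  obtain r M where r: "0 \<le> r" "r < 1" "0 \<le> M" and
    far: "\<And>f N z. \<lbrakk>zygmund_le v_log N f; z \<in> unit_disk; r < norm (\<phi> z)\<rbrakk> \<Longrightarrow>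
       v_log z * norm (deriv (deriv (\<lambda>z. f (\<phi> z))) z) \<le> \<delta> * N" and
    near: "\<And>f z. \<lbrakk>f holomorphic_on unit_disk; z \<in> unit_disk\<rbrakk> \<Longrightarrow>
       v_log z * norm (deriv (deriv (\<lambda>z. f (\<phi> z))) z)
         \<le> M * (norm (deriv (deriv f) (\<phi> z)) + norm (deriv f (\<phi> z)))"
    using vanishing_split[OF van \<delta>] by blast
  \<comment> \<open>The disc has to contain \<phi>(0) too, for the terms of the norm taken at 0.\<close>
  define \<rho> where "\<rho> = max r (norm (\<phi> 0))"
  have \<rho>: "0 \<le> \<rho>" "\<rho> < 1" using r in_disk[of 0] by (auto simp: \<rho>_def)
  define q where "q = 1 + norm (deriv \<phi> 0) + 2 * M"
  have p: "0 < q" unfolding q_def using r norm_ge_zero[of "deriv \<phi> 0"] by linarith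
  define \<eta> where "\<eta> = \<epsilon> / (2 * q)"
  have \<eta>: "0 < \<eta>" unfolding \<eta>_def using p \<epsilon> by (intro divide_pos_pos) auto
  have \<eta>e: "\<eta> * q = \<epsilon> / 2" using p by (simp add: \<eta>_def)
  have hh: "h k holomorphic_on unit_disk" for k by (rule zygmund_leD(1)[OF h])
  have "\<forall>\<^sub>F k in sequentially. \<forall>\<zeta>\<in>cball 0 \<rho>.
     norm (h k \<zeta>) \<le> \<eta> \<and> norm (deriv (h k) \<zeta>) \<le> \<eta> \<and> norm (deriv (deriv (h k)) \<zeta>) \<le> \<eta>"
    using hh unif \<rho> \<eta> by (rule locally_uniform_derivs)
  thus ?thesis
  proof eventually_elim
    case (elim k)
    have \<phi>0: "\<phi> 0 \<in> cball 0 \<rho>" by (simp add: \<rho>_def)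
    show ?case
      unfolding zygmund_le_def
    proof (intro conjI ballI comp_derivs(1)[OF hh hol im])
      fix z assume z: "z \<in> unit_disk"
      have 1: "norm (h k (\<phi> 0)) \<le> \<eta>" using elim \<phi>0 by blast
      have "norm (deriv (h k) (\<phi> 0)) * norm (deriv \<phi> 0) \<le> \<eta> * norm (deriv \<phi> 0)"
        using elim \<phi>0 by (intro mult_right_mono) auto
      hence 2: "norm (deriv (\<lambda>z. h k (\<phi> z)) 0) \<le> \<eta> * norm (deriv \<phi> 0)"
        using comp_derivs(2)[OF hh hol im, of 0] by (simp add: norm_mult)
      have 3: "v_log z * norm (deriv (deriv (\<lambda>z. h k (\<phi> z))) z) \<le> max (\<epsilon> / 2) (2 * M * \<eta>)"
      proof (cases "r < norm (\<phi> z)")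
        case True
        hence "v_log z * norm (deriv (deriv (\<lambda>z. h k (\<phi> z))) z) \<le> \<epsilon> / 2"
          using far[OF h z, of k] \<delta>N by linarith
        thus ?thesis by simp
      next
        case False
        hence "M * (norm (deriv (deriv (h k)) (\<phi> z)) + norm (deriv (h k) (\<phi> z))) \<le> M * (\<eta> + \<eta>)"
          using r elim by (intro mult_left_mono add_mono) (auto simp: \<rho>_def)
        thus ?thesis using near[OF hh z, of k] by (simp add: algebra_simps)
      qed
      have "\<eta> + \<eta> * norm (deriv \<phi> 0) + 2 * M * \<eta> = \<epsilon> / 2" "0 \<le> \<eta> * norm (deriv \<phi> 0)" "0 \<le> 2 * M * \<eta>"
        using \<eta>e \<eta> r by (auto simp: q_def algebra_simps)
      thus "norm (h k (\<phi> 0)) + norm (deriv (\<lambda>z. h k (\<phi> z)) 0)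
          + v_log z * norm (deriv (deriv (\<lambda>z. h k (\<phi> z))) z) \<le> \<epsilon>"
        using 1 2 3 \<epsilon> by linarith
    qed
  qed
qed

lemma composition_op_in_space:
  assumes "zygmund_le v_log B (\<lambda>z. f (\<phi> z))"
  shows "composition_op \<phi> f \<in> zygmund_space v_log"
  using assms by (intro zygmund_spaceI[of _ _ B]) (auto simp: composition_op_def zygmund_le_restrict)

text \<open>
  The image of the unit ball is sequentially compact itself, hence closed and equal to its closure.
\<close>
lemma vanishing_imp_compact:
  assumes van: "vanishing"
  shows "compact_on_zygmund v_log (composition_op \<phi>)"
proof -
  define Z where "Z = zygmund_space v_log"
  define B where "B = {f \<in> Z. zygmund_norm v_log f \<le> 1}"
  interpret Metric_space Z "zygmund_dist v_log"
    unfolding Z_def by (rule Metric_space_zygmund[OF v_log_pos])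
  have top: "zygmund_topology v_log = mtopology" by (simp add: zygmund_topology_def Z_def)
  have maps: "composition_op \<phi> f \<in> Z" if "f \<in> Z" for f
    using vanishing_maps_space[OF van zygmund_space_le_norm] composition_op_in_space that
    unfolding Z_def by blast
  have Ble: "zygmund_le v_log 1 f" if "f \<in> B" for f
    using zygmund_le_mono[OF zygmund_space_le_norm] that by (auto simp: B_def Z_def)
  have "compactin mtopology (composition_op \<phi> ` B)"
    unfolding compactin_sequentially
  proof (intro conjI allI impI)
    show "composition_op \<phi> ` B \<subseteq> Z" using maps by (auto simp: B_def)
    fix \<sigma> :: "nat \<Rightarrow> complex \<Rightarrow> complex"
    assume "range \<sigma> \<subseteq> composition_op \<phi> ` B"
    hence "\<forall>k. \<exists>f. f \<in> B \<and> \<sigma> k = composition_op \<phi> f" by blast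
    then obtain F where F: "\<And>k. F k \<in> B" "\<And>k. \<sigma> k = composition_op \<phi> (F k)" by metis
    obtain g r where g: "zygmund_le v_log 1 g" and r: "strict_mono (r :: nat \<Rightarrow> nat)" and
      unif: "\<And>S. compact S \<Longrightarrow> S \<subseteq> unit_disk \<Longrightarrow> uniform_limit S (\<lambda>k z. F (r k) z - g z) (\<lambda>_. 0) sequentially"
      using zygmund_ball_normal[of F, OF Ble[OF F(1)]] by blast
    define G where "G = restrict g unit_disk"
    have Gle: "zygmund_le v_log 1 G" using g by (simp add: G_def zygmund_le_restrict)
    have GB: "G \<in> B"
      unfolding B_def Z_def
      using zygmund_spaceI[OF _ Gle] zygmund_norm_le[OF Gle] by (auto simp: G_def)
    have conv: "(\<lambda>k. zygmund_dist v_log (\<sigma> (r k)) (composition_op \<phi> G)) \<longlonglongrightarrow> 0"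
    proof (rule LIMSEQ_I)
      fix \<epsilon> :: real assume \<epsilon>: "0 < \<epsilon>"
      have d: "zygmund_le v_log (1 + 1) (\<lambda>z. F (r k) z - g z)" for k
        using zygmund_le_diff[OF less_imp_le[OF v_log_pos] Ble[OF F(1)] g] by blast
      have e2: "0 < \<epsilon> / 2" using \<epsilon> by simp
      have "\<forall>\<^sub>F k in sequentially. zygmund_le v_log (\<epsilon> / 2) (\<lambda>z. F (r k) (\<phi> z) - g (\<phi> z))"
        using vanishing_converges[OF van d unif e2] by simp
      hence "\<forall>\<^sub>F k in sequentially. norm (zygmund_dist v_log (\<sigma> (r k)) (composition_op \<phi> G) - 0) < \<epsilon>"
      proof eventually_elim
        case (elim k)
        have "zygmund_le v_log (\<epsilon> / 2) (\<lambda>z. \<sigma> (r k) z - composition_op \<phi> G z)"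
          using elim in_disk
          by (subst zygmund_le_cong[where g = "\<lambda>z. F (r k) (\<phi> z) - g (\<phi> z)"])
            (auto simp: F(2) composition_op_def G_def)
        from zygmund_norm_le[OF this]
        have "zygmund_dist v_log (\<sigma> (r k)) (composition_op \<phi> G) \<le> \<epsilon> / 2"
          using \<epsilon> by (simp add: zygmund_dist_def)
        thus ?case using nonneg[of "\<sigma> (r k)" "composition_op \<phi> G"] \<epsilon> by simp
      qed
      thus "\<exists>no. \<forall>k\<ge>no. norm (zygmund_dist v_log (\<sigma> (r k)) (composition_op \<phi> G) - 0) < \<epsilon>"
        by (simp add: eventually_sequentially)
    qed
    have "limitin mtopology (\<sigma> \<circ> r) (composition_op \<phi> G) sequentially"
      unfolding limitin_metric_dist_null using conv maps F GB
      by (auto simp: B_def o_def)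
    thus "\<exists>l r. l \<in> composition_op \<phi> ` B \<and> strict_mono r \<and> limitin mtopology (\<sigma> \<circ> r) l sequentially"
      using r GB by blast
  qed
  moreover from this have "mtopology closure_of (composition_op \<phi> ` B) = composition_op \<phi> ` B"
    by (intro closure_of_closedin compactin_imp_closedin Hausdorff_space_mtopology)
  ultimately show ?thesis
    unfolding compact_on_zygmund_def top using maps by (auto simp: B_def Z_def)
qed

text \<open>
  Otherwise some subsequence of images stays away from 0 while converging in norm, by compactness.
  Norm convergence implies pointwise convergence, so its limit is 0, a contradiction.
\<close>
lemma compact_imp_null:
  fixes f :: "nat \<Rightarrow> complex \<Rightarrow> complex"
  assumes cpt: "compact_on_zygmund v_log (composition_op \<phi>)"
    and f: "\<And>k. zygmund_le v_log 1 (f k)"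
    and lim: "\<And>z. z \<in> unit_disk \<Longrightarrow> (\<lambda>k. f k z) \<longlonglongrightarrow> 0"
    and \<epsilon>: "0 < \<epsilon>"
  shows "\<forall>\<^sub>F k in sequentially. zygmund_le v_log \<epsilon> (\<lambda>z. f k (\<phi> z))"
proof (rule ccontr)
  assume "\<not> ?thesis"
  from not_eventually_sequentiallyD[OF this] obtain r where r: "strict_mono (r :: nat \<Rightarrow> nat)"
    and bad: "\<And>n. \<not> zygmund_le v_log \<epsilon> (\<lambda>z. f (r n) (\<phi> z))" by blast
  define Z where "Z = zygmund_space v_log"
  define B where "B = {f \<in> Z. zygmund_norm v_log f \<le> 1}"
  define T where "T = composition_op \<phi>"
  interpret Metric_space Z "zygmund_dist v_log"
    unfolding Z_def by (rule Metric_space_zygmund[OF v_log_pos])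
  have top: "zygmund_topology v_log = mtopology" by (simp add: zygmund_topology_def Z_def)
  have maps: "T ` Z \<subseteq> Z" and cl: "compactin mtopology (mtopology closure_of (T ` B))"
    using cpt by (auto simp: compact_on_zygmund_def top T_def B_def Z_def)
  define F where "F = (\<lambda>n. restrict (f (r n)) unit_disk)"
  have Fle: "zygmund_le v_log 1 (F n)" for n using f by (simp add: F_def zygmund_le_restrict)
  have FB: "F n \<in> B" for n
    unfolding B_def Z_def
    using zygmund_spaceI[OF _ Fle] zygmund_norm_le[OF Fle] by (auto simp: F_def)
  have TF: "T (F n) z = f (r n) (\<phi> z)" if "z \<in> unit_disk" for n z
    using that in_disk by (simp add: T_def composition_op_def F_def)
  have "T ` B \<subseteq> Z" using maps by (auto simp: B_def)
  hence "T ` B \<subseteq> mtopology closure_of (T ` B)" by (intro closure_of_subset) simp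
  hence "range (\<lambda>n. T (F n)) \<subseteq> mtopology closure_of (T ` B)" using FB by blast
  then obtain l s where s: "strict_mono (s :: nat \<Rightarrow> nat)"
    and l: "limitin mtopology ((\<lambda>n. T (F n)) \<circ> s) l sequentially"
    using cl unfolding compactin_sequentially by meson
  have lZ: "l \<in> Z" and dist: "(\<lambda>n. zygmund_dist v_log (T (F (s n))) l) \<longlonglongrightarrow> 0"
    using l unfolding limitin_metric_dist_null by (auto simp: o_def)
  have TZ: "T (F n) \<in> Z" for n using FB maps by (auto simp: B_def)
  have le: "zygmund_le v_log (zygmund_dist v_log (T (F n)) l) (\<lambda>z. T (F n) z - l z)" for n
  proof -
    have "(\<lambda>z. T (F n) z - l z) holomorphic_on unit_disk"
      using TZ lZ by (intro holomorphic_intros) (auto simp: Z_def zygmund_space_def)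
    moreover have "bdd_above ((\<lambda>z. v_log z * norm (deriv (deriv (\<lambda>z. T (F n) z - l z)) z)) ` unit_disk)"
      using zygmund_bdd_diff[of v_log, OF v_log_pos] TZ lZ by (simp add: Z_def)
    ultimately have "zygmund_le v_log (zygmund_norm v_log (\<lambda>z. T (F n) z - l z)) (\<lambda>z. T (F n) z - l z)"
      by (rule zygmund_le_norm)
    thus ?thesis using TZ lZ by (simp add: zygmund_dist_def Z_def)
  qed
  obtain K where K: "0 < K" 
    "\<And>f N z. zygmund_le v_log N f \<Longrightarrow> z \<in> unit_disk \<Longrightarrow> norm (f z) * w_log z \<le> K * N"
    using zygmund_growth by metis
  have l0: "l z = 0" if z: "z \<in> unit_disk" for z
  proof -
    have "(\<lambda>n. T (F (s n)) z - l z) \<longlonglongrightarrow> 0"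
    proof (rule Lim_null_comparison)
      have "norm (T (F (s n)) z - l z) \<le> K / w_log z * zygmund_dist v_log (T (F (s n))) l" for n
        using K(2)[OF le z, of "s n"] w_log_pos[OF z] by (simp add: field_simps)
      thus "\<forall>\<^sub>F n in sequentially. norm (T (F (s n)) z - l z)
          \<le> K / w_log z * zygmund_dist v_log (T (F (s n))) l" by simp
      show "(\<lambda>n. K / w_log z * zygmund_dist v_log (T (F (s n))) l) \<longlonglongrightarrow> 0"
        by (rule tendsto_mult_right_zero[OF dist])
    qed
    moreover have "(\<lambda>n. T (F (s n)) z - l z) \<longlonglongrightarrow> 0 - l z"
    proof (intro tendsto_diff tendsto_const)
      have "(\<lambda>n. f ((r \<circ> s) n) (\<phi> z)) \<longlonglongrightarrow> 0"
        using LIMSEQ_subseq_LIMSEQ[OF lim[OF in_disk[OF z]] strict_mono_o[OF r s]] by (simp add: o_def)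
      thus "(\<lambda>n. T (F (s n)) z) \<longlonglongrightarrow> 0" by (simp add: TF[OF z])
    qed
    ultimately show ?thesis using LIMSEQ_unique by fastforce
  qed
  have "\<forall>\<^sub>F n in sequentially. zygmund_dist v_log (T (F (s n))) l < \<epsilon>"
    using order_tendstoD(2)[OF dist \<epsilon>] .
  then obtain n where "zygmund_dist v_log (T (F (s n))) l < \<epsilon>"
    using eventually_happens'[OF sequentially_bot] by blast
  hence "zygmund_le v_log \<epsilon> (\<lambda>z. T (F (s n)) z - l z)"
    using zygmund_le_mono[OF le] by force
  hence "zygmund_le v_log \<epsilon> (\<lambda>z. f (r (s n)) (\<phi> z))"
    by (rule zygmund_le_cong[THEN iffD1, rotated]) (simp add: TF l0)
  thus False using bad by blast
qed

section \<open>Monomial conditions\<close>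

definition moment1 :: "nat \<Rightarrow> real" where "moment1 n = (SUP z\<in>unit_disk. \<psi>1 z * norm (\<phi> z) ^ n)"
definition moment2 :: "nat \<Rightarrow> real" where "moment2 n = (SUP z\<in>unit_disk. \<psi>2 z * norm (\<phi> z) ^ n)"

lemma power_norm_le_1: "z \<in> unit_disk \<Longrightarrow> norm (\<phi> z) ^ n \<le> 1"
  using in_disk[of z] by (intro power_le_one) auto

lemma weighted_power_le:
  assumes "z \<in> unit_disk" "0 \<le> x" "x \<le> M"
  shows "x * norm (\<phi> z) ^ n \<le> M"
  using mult_mono[OF assms(3) power_norm_le_1[OF assms(1), of n]] assms by simp

lemma le_moment:
  assumes "\<And>z. z \<in> unit_disk \<Longrightarrow> \<psi>1 z \<le> M" "\<And>z. z \<in> unit_disk \<Longrightarrow> \<psi>2 z \<le> M"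
    and z: "z \<in> unit_disk"
  shows "\<psi>1 z * norm (\<phi> z) ^ n \<le> moment1 n" "\<psi>2 z * norm (\<phi> z) ^ n \<le> moment2 n"
  unfolding moment1_def moment2_def using assms \<psi>_nonneg
  by (auto intro!: cSUP_upper bdd_aboveI2[of _ _ M] weighted_power_le)

lemma moment_nonneg:
  assumes M: "\<And>z. z \<in> unit_disk \<Longrightarrow> \<psi>1 z \<le> M" "\<And>z. z \<in> unit_disk \<Longrightarrow> \<psi>2 z \<le> M"
  shows "0 \<le> moment1 n" "0 \<le> moment2 n"
proof -
  have 0: "0 \<le> \<psi>1 0 * norm (\<phi> 0) ^ n" "0 \<le> \<psi>2 0 * norm (\<phi> 0) ^ n"
    using \<psi>_nonneg[of 0] by (auto intro!: mult_nonneg_nonneg)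
  have "\<psi>1 0 * norm (\<phi> 0) ^ n \<le> moment1 n" using M by (rule le_moment(1)) auto
  thus "0 \<le> moment1 n" using 0(1) by linarith
  have "\<psi>2 0 * norm (\<phi> 0) ^ n \<le> moment2 n" using M by (rule le_moment(2)) auto
  thus "0 \<le> moment2 n" using 0(2) by linarith
qed

text \<open>
  Apply the operator to z and z^2: the image \<phi> bounds \<psi>2, and from (\<phi>^2)'' = 2 \<phi>'^2 + 2 \<phi> \<phi>'' a
  bound on \<psi>1 follows.
\<close>
lemma bounded_of_maps:
  assumes maps: "composition_op \<phi> ` zygmund_space v_log \<subseteq> zygmund_space v_log"
  shows "\<exists>M. \<forall>z\<in>unit_disk. \<psi>1 z \<le> M \<and> \<psi>2 z \<le> M"
proof -
  have img: "\<exists>B. zygmund_le v_log B (\<lambda>z. f (\<phi> z))" if "zygmund_le v_log N f" for f N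
  proof -
    have "restrict f unit_disk \<in> zygmund_space v_log"
      using that by (intro zygmund_spaceI[of _ _ N]) (auto simp: zygmund_le_restrict)
    hence "composition_op \<phi> (restrict f unit_disk) \<in> zygmund_space v_log" using maps by blast
    from zygmund_space_le_norm[OF this]
    have "\<exists>B. zygmund_le v_log B (composition_op \<phi> (restrict f unit_disk))" by blast
    moreover have "zygmund_le v_log B (composition_op \<phi> (restrict f unit_disk))
        \<longleftrightarrow> zygmund_le v_log B (\<lambda>z. f (\<phi> z))" for B
      using in_disk by (intro zygmund_le_cong) (auto simp: composition_op_def)
    ultimately show ?thesis by blast
  qed
  have d1: "deriv (\<lambda>z::complex. z) = (\<lambda>z. 1)" by (rule ext) simp
  have "zygmund_le v_log 1 (\<lambda>z. z)"
    by (auto simp: zygmund_le_def d1 intro!: holomorphic_intros)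
  from img[OF this] obtain B1 where B1: "zygmund_le v_log B1 \<phi>" by auto
  have d2: "deriv (\<lambda>z::complex. z\<^sup>2) z = 2 * z" "deriv (deriv (\<lambda>z::complex. z\<^sup>2)) z = 2" for z
    using monomial_derivs[of 0 z] by (simp_all add: numeral_2_eq_2)
  have "zygmund_le v_log 4 (\<lambda>z. z\<^sup>2)"
    using v_log_le by (auto simp: zygmund_le_def d2 intro!: holomorphic_intros)
  from img[OF this] obtain B2 where B2: "zygmund_le v_log B2 (\<lambda>z. (\<phi> z)\<^sup>2)" by auto
  have hsq: "(\<lambda>z::complex. z\<^sup>2) holomorphic_on unit_disk" by (intro holomorphic_intros)
  have 2: "\<psi>2 z \<le> B1" if z: "z \<in> unit_disk" for z
    using zygmund_leD(2)[OF B1 z] norm_ge_zero[of "\<phi> 0"] norm_ge_zero[of "deriv \<phi> 0"]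
    unfolding \<psi>2_def by linarith
  have 1: "\<psi>1 z \<le> B2 + 2 * B1" if z: "z \<in> unit_disk" for z
  proof -
    note v = v_log_pos[OF z]
    have n1: "norm (\<phi> z) \<le> 1" using in_disk[OF z] by simp
    define X where "X = deriv (deriv (\<lambda>z. (\<phi> z)\<^sup>2)) z"
    have X: "X = 2 * (deriv \<phi> z)\<^sup>2 + 2 * \<phi> z * deriv (deriv \<phi>) z"
      using comp_derivs(3)[OF hsq hol im z] by (simp add: X_def d2)
    have vX: "v_log z * norm X \<le> B2"
      using zygmund_leD(2)[OF B2 z] norm_ge_zero[of "(\<phi> 0)\<^sup>2"]
        norm_ge_zero[of "deriv (\<lambda>z. (\<phi> z)\<^sup>2) 0"] unfolding X_def by linarith
    have "(norm (deriv \<phi> z))\<^sup>2 \<le> 2 * (norm (deriv \<phi> z))\<^sup>2" by simp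
    also have "2 * (norm (deriv \<phi> z))\<^sup>2 = norm (X - 2 * \<phi> z * deriv (deriv \<phi>) z)"
      by (simp add: X norm_mult norm_power)
    also have "\<dots> \<le> norm X + 2 * norm (\<phi> z) * norm (deriv (deriv \<phi>) z)"
      using norm_triangle_ineq4[of X "2 * \<phi> z * deriv (deriv \<phi>) z"] by (simp add: norm_mult)
    also have "\<dots> \<le> norm X + 2 * 1 * norm (deriv (deriv \<phi>) z)"
      using n1 by (intro add_left_mono mult_right_mono mult_left_mono) auto
    finally have "v_log z * (norm (deriv \<phi> z))\<^sup>2 \<le> v_log z * (norm X + 2 * 1 * norm (deriv (deriv \<phi>) z))"
      using v by (intro mult_left_mono) auto
    also have "\<dots> = v_log z * norm X + 2 * \<psi>2 z" by (simp add: \<psi>2_def algebra_simps)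
    finally show ?thesis using vX 2[OF z] unfolding \<psi>1_def by linarith
  qed
  have B10: "0 \<le> B1" using 2[of 0] \<psi>_nonneg(2)[of 0] by simp
  have B20: "0 \<le> B2" using zygmund_le_at_0(3)[OF B2] v_log_pos[of 0] by simp
  show ?thesis
  proof (intro exI[of _ "B2 + 2 * B1"] ballI conjI)
    fix z assume z: "z \<in> unit_disk"
    show "\<psi>1 z \<le> B2 + 2 * B1" by (rule 1[OF z])
    show "\<psi>2 z \<le> B2 + 2 * B1" using 2[OF z] B10 B20 by linarith
  qed
qed

text \<open>
  The functions z^(n+2) divided by their norms lie in the unit ball and have second derivative
  z^n / peak n. Their first derivatives are O(1/((n+1) peak n)), which tends to 0, so that in the
  norm of the composition only the term with \<psi>1 survives.
\<close>
lemma compact_imp_moment1: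
  assumes cpt: "compact_on_zygmund v_log (composition_op \<phi>)"
  shows "(\<lambda>n. moment1 n / peak v_log n) \<longlonglongrightarrow> 0"
proof -
  obtain M where M: "\<And>z. z \<in> unit_disk \<Longrightarrow> \<psi>1 z \<le> M" "\<And>z. z \<in> unit_disk \<Longrightarrow> \<psi>2 z \<le> M"
    using bounded_of_maps cpt unfolding compact_on_zygmund_def by meson
  have M0: "0 \<le> M" using M(1)[of 0] \<psi>_nonneg(1)[of 0] by simp
  define \<beta> where "\<beta> = peak v_log"
  have \<beta>: "0 < \<beta> n" for n unfolding \<beta>_def by (rule peak_v_log_pos)
  have \<beta>lim: "(\<lambda>n. inverse ((real n + 1) * \<beta> n)) \<longlonglongrightarrow> 0"
    unfolding \<beta>_def by (rule tendsto_inverse_0_at_top[OF peak_v_log_growth])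
  define c where "c = (\<lambda>n. complex_of_real (1 / ((real n + 2) * (real n + 1) * \<beta> n)))"
  define f where "f = (\<lambda>n z. c n * z ^ (n + 2))"
  have c: "norm (c n) = 1 / ((real n + 2) * (real n + 1) * \<beta> n)" for n
    unfolding c_def norm_of_real using \<beta>[of n] by (simp add: abs_mult)
  have fd: "(f n has_field_derivative (c n * (of_nat (n + 2) * z ^ (n + 1)))) (at z)"
    "((\<lambda>z. c n * (of_nat (n + 2) * z ^ (n + 1))) has_field_derivative (c n * (of_nat (n + 2) * of_nat (n + 1) * z ^ n))) (at z)" for n z
  proof -
    have p: "((\<lambda>z::complex. z ^ Suc m) has_field_derivative of_nat (Suc m) * z ^ m) (at z)" for m
      using DERIV_power[OF DERIV_ident, where n = "Suc m"] by simp
    show "(f n has_field_derivative (c n * (of_nat (n + 2) * z ^ (n + 1)))) (at z)"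
      unfolding f_def using DERIV_cmult[OF p[of "n + 1"], of "c n"] by simp
    show "((\<lambda>z. c n * (of_nat (n + 2) * z ^ (n + 1))) has_field_derivative (c n * (of_nat (n + 2) * of_nat (n + 1) * z ^ n))) (at z)"
      using DERIV_cmult[OF DERIV_cmult[OF p[of n], of "of_nat (n + 2)"], of "c n"] by (simp add: mult.assoc)
  qed
  have fh: "f n holomorphic_on unit_disk"
    and f1: "z \<in> unit_disk \<Longrightarrow> deriv (f n) z = c n * (of_nat (n + 2) * z ^ (n + 1))"
    and f2: "z \<in> unit_disk \<Longrightarrow> deriv (deriv (f n)) z = c n * (of_nat (n + 2) * of_nat (n + 1) * z ^ n)" for n z
    using disk_derivs[OF fd] by blast+
  have n1: "norm (c n) * (real n + 2) = 1 / ((real n + 1) * \<beta> n)"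
    and n2: "norm (c n) * ((real n + 2) * (real n + 1)) = 1 / \<beta> n" for n
  proof -
    have "1 / (p * q * b) * p = 1 / (q * b)" "1 / (p * q * b) * (p * q) = 1 / b"
      if "0 < p" "0 < q" "0 < b" for p q b :: real using that by simp_all
    thus "norm (c n) * (real n + 2) = 1 / ((real n + 1) * \<beta> n)"
      "norm (c n) * ((real n + 2) * (real n + 1)) = 1 / \<beta> n"
      unfolding c using \<beta>[of n] by simp_all
  qed
  have rn: "norm (of_nat (n + 2) :: complex) = real n + 2" "norm (of_nat (n + 1) :: complex) = real n + 1" for n
    using norm_of_nat[of "n + 2", where 'a = complex] norm_of_nat[of "n + 1", where 'a = complex]
    by simp_all
  have f2n: "norm (deriv (deriv (f n)) z) = norm z ^ n / \<beta> n" if "z \<in> unit_disk" for n z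
  proof -
    have "norm (deriv (deriv (f n)) z) = norm (c n) * ((real n + 2) * (real n + 1)) * norm z ^ n"
      unfolding f2[OF that] norm_mult norm_power rn by (simp only: mult.assoc)
    thus ?thesis unfolding n2 by simp
  qed
  have f1n: "norm (deriv (f n) z) = norm z ^ (n + 1) / ((real n + 1) * \<beta> n)" if "z \<in> unit_disk" for n z
  proof -
    have "norm (deriv (f n) z) = norm (c n) * (real n + 2) * norm z ^ (n + 1)"
      unfolding f1[OF that] norm_mult norm_power rn by (simp only: mult.assoc)
    thus ?thesis unfolding n1 by simp
  qed
  have fle: "zygmund_le v_log 1 (f n)" for n
    unfolding zygmund_le_def
  proof (intro conjI ballI fh)
    fix z :: complex assume z: "z \<in> unit_disk"
    have "v_log z * norm z ^ n \<le> \<beta> n" unfolding \<beta>_def by (rule peak_upper[OF v_log_pos v_log_le z])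
    hence "v_log z * (norm z ^ n / \<beta> n) \<le> 1" using \<beta>[of n] by (simp add: field_simps)
    thus "norm (f n 0) + norm (deriv (f n) 0) + v_log z * norm (deriv (deriv (f n)) z) \<le> 1"
      using f1n[of 0 n] f2n[OF z] by (simp add: f_def)
  qed
  have flim: "(\<lambda>n. f n z) \<longlonglongrightarrow> 0" if z: "z \<in> unit_disk" for z
  proof (rule Lim_null_comparison[OF _ \<beta>lim])
    show "\<forall>\<^sub>F n in sequentially. norm (f n z) \<le> inverse ((real n + 1) * \<beta> n)"
    proof (intro always_eventually allI)
      fix n
      have "norm (f n z) = norm (c n) * norm z ^ (n + 2)" by (simp add: f_def norm_mult norm_power)
      also have "\<dots> \<le> (norm (c n) * (real n + 2)) * 1"
        using z by (intro mult_mono power_le_one) (auto simp: mult_le_cancel_left1)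
      finally show "norm (f n z) \<le> inverse ((real n + 1) * \<beta> n)"
        unfolding n1 by (simp add: inverse_eq_divide)
    qed
  qed
  have moment1_nonneg: "0 \<le> moment1 n" for n using M by (rule moment_nonneg(1))
  show ?thesis
    unfolding \<beta>_def[symmetric]
  proof (rule LIMSEQ_I)
    fix \<epsilon> :: real assume \<epsilon>: "0 < \<epsilon>"
    have e4: "0 < \<epsilon> / 4" using \<epsilon> by simp
    have "(\<lambda>n. M * inverse ((real n + 1) * \<beta> n)) \<longlonglongrightarrow> 0"
      by (rule tendsto_mult_right_zero[OF \<beta>lim])
    from order_tendstoD(2)[OF this e4]
    have "\<forall>\<^sub>F n in sequentially. M * inverse ((real n + 1) * \<beta> n) < \<epsilon> / 4" .
    moreover have "\<forall>\<^sub>F n in sequentially. zygmund_le v_log (\<epsilon> / 4) (\<lambda>z. f n (\<phi> z))"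
      by (rule compact_imp_null[OF cpt fle flim e4])
    ultimately have "\<forall>\<^sub>F n in sequentially. norm (moment1 n / \<beta> n - 0) < \<epsilon>"
    proof eventually_elim
      case (elim n)
      have "moment1 n \<le> \<epsilon> / 2 * \<beta> n"
        unfolding moment1_def
      proof (rule cSUP_least)
        fix z :: complex assume z: "z \<in> unit_disk"
        note a = in_disk[OF z]
        define X where "X = deriv (deriv (\<lambda>z. f n (\<phi> z))) z"
        have vX: "v_log z * norm X \<le> \<epsilon> / 4"
          using zygmund_leD(2)[OF elim(2) z] norm_ge_zero[of "f n (\<phi> 0)"]
            norm_ge_zero[of "deriv (\<lambda>z. f n (\<phi> z)) 0"] unfolding X_def by linarith
        have "deriv (deriv (f n)) (\<phi> z) * (deriv \<phi> z)\<^sup>2 = X - deriv (f n) (\<phi> z) * deriv (deriv \<phi>) z"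
          unfolding X_def comp_derivs(3)[OF fh hol im z] by simp
        hence "norm (deriv (deriv (f n)) (\<phi> z)) * (norm (deriv \<phi> z))\<^sup>2
            \<le> norm X + norm (deriv (f n) (\<phi> z)) * norm (deriv (deriv \<phi>) z)"
          using norm_triangle_ineq4[of X "deriv (f n) (\<phi> z) * deriv (deriv \<phi>) z"]
          by (metis norm_mult norm_power)
        from mult_left_mono[OF this less_imp_le[OF v_log_pos[OF z]]]
        have "\<psi>1 z * norm (deriv (deriv (f n)) (\<phi> z)) \<le> v_log z * norm X + \<psi>2 z * norm (deriv (f n) (\<phi> z))"
          by (simp add: \<psi>1_def \<psi>2_def algebra_simps)
        also have "\<psi>2 z * norm (deriv (f n) (\<phi> z)) \<le> M * inverse ((real n + 1) * \<beta> n)"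
        proof -
          have "norm (\<phi> z) ^ (n + 1) * inverse ((real n + 1) * \<beta> n) \<le> 1 * inverse ((real n + 1) * \<beta> n)"
            using power_norm_le_1[OF z, of "n + 1"] \<beta>[of n] by (intro mult_right_mono) auto
          thus ?thesis
            unfolding f1n[OF a] using M(2)[OF z] \<psi>_nonneg(2)[OF z] M0 \<beta>[of n]
            by (intro mult_mono) (auto simp: divide_inverse)
        qed
        finally have "\<psi>1 z * norm (deriv (deriv (f n)) (\<phi> z)) \<le> \<epsilon> / 2"
          using vX elim(1) by linarith
        thus "\<psi>1 z * norm (\<phi> z) ^ n \<le> \<epsilon> / 2 * \<beta> n"
          unfolding f2n[OF a] using \<beta>[of n] by (simp add: field_simps)
      qed auto
      hence "moment1 n / \<beta> n \<le> \<epsilon> / 2" using \<beta>[of n] by (subst pos_divide_le_eq) auto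
      moreover have "0 \<le> moment1 n / \<beta> n" using moment1_nonneg[of n] \<beta>[of n] by (intro divide_nonneg_pos)
      ultimately show ?case using \<epsilon> unfolding real_norm_def diff_0_right by linarith
    qed
    thus "\<exists>no. \<forall>n\<ge>no. norm (moment1 n / \<beta> n - 0) < \<epsilon>" by (simp add: eventually_sequentially)
  qed
qed

text \<open>
  The relation for \<psi>1 comes from the monomials. If the one for \<psi>2 failed along points z_k, the
  test functions attached to a_k = \<phi>(z_k) would contradict \<open>compact_imp_null\<close>: their images have
  small norm at z_k, the contribution of \<psi>1 is small, and the remaining term f'(a_k) \<psi>2(z_k) is
  bounded below.
\<close>
lemma compact_imp_vanishing:
  assumes cpt: "compact_on_zygmund v_log (composition_op \<phi>)"
  shows vanishing
proof -
  obtain M where M: "\<And>z. z \<in> unit_disk \<Longrightarrow> \<psi>1 z \<le> M" "\<And>z. z \<in> unit_disk \<Longrightarrow> \<psi>2 z \<le> M"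
    using bounded_of_maps cpt unfolding compact_on_zygmund_def by meson
  have o1: "little_o_along \<phi> \<psi>1 v_log"
    using v_log_pos v_log_le peak_bounded_v_log im le_moment(1)[OF M] compact_imp_moment1[OF cpt]
    by (rule little_o_from_monomials)
  have "little_o_along \<phi> \<psi>2 w_log"
  proof (rule ccontr)
    assume "\<not> little_o_along \<phi> \<psi>2 w_log"
    then obtain \<epsilon> where \<epsilon>: "0 < \<epsilon>"
      and bad: "\<And>r. r < 1 \<Longrightarrow> \<exists>z\<in>unit_disk. r < norm (\<phi> z) \<and> \<epsilon> * w_log (\<phi> z) < \<psi>2 z"
      unfolding little_o_along_def by (meson not_le)
    have "\<forall>k. \<exists>z. z \<in> unit_disk \<and> 1 - 1 / (real k + 1) < norm (\<phi> z) \<and> \<epsilon> * w_log (\<phi> z) < \<psi>2 z"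
      using bad[of "1 - 1 / (real k + 1)" for k] by (auto simp: Bex_def)
    then obtain Z where Z: "\<And>k. Z k \<in> unit_disk" "\<And>k. 1 - 1 / (real k + 1) < norm (\<phi> (Z k))"
      "\<And>k. \<epsilon> * w_log (\<phi> (Z k)) < \<psi>2 (Z k)" by metis
    define a where "a = (\<lambda>k. \<phi> (Z k))"
    have a: "a k \<in> unit_disk" for k unfolding a_def by (rule in_disk[OF Z(1)])
    have wlim: "(\<lambda>k. w_log (a k)) \<longlonglongrightarrow> 0"
      using Z(2) by (intro w_log_tendsto_0 a) (simp add: a_def)
    obtain K where K: "0 < K" and "\<exists>A f. \<forall>a\<in>unit_disk. zygmund_le v_log K (f a) \<and>
       inverse (w_log a) \<le> norm (deriv (f a) a) \<and>
       (\<forall>z\<in>unit_disk. norm (f a z) \<le> A z * w_log a)"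
      using loglog_test_functions by blast
    then obtain A F where test: "\<forall>a\<in>unit_disk. zygmund_le v_log K (F a) \<and>
       inverse (w_log a) \<le> norm (deriv (F a) a) \<and>
       (\<forall>z\<in>unit_disk. norm (F a z) \<le> A z * w_log a)"
      by blast
    have F: "\<And>a. a \<in> unit_disk \<Longrightarrow> zygmund_le v_log K (F a)"
      and Fa: "\<And>a. a \<in> unit_disk \<Longrightarrow> inverse (w_log a) \<le> norm (deriv (F a) a)"
      and F0: "\<And>a z. a \<in> unit_disk \<Longrightarrow> z \<in> unit_disk \<Longrightarrow> norm (F a z) \<le> A z * w_log a"
      using test by blast+
    define q where "q = complex_of_real (inverse K)"
    have nq: "norm q = inverse K" unfolding q_def norm_of_real using K by simp
    define f where "f = (\<lambda>k z. q * F (a k) z)"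
    have Fh: "F (a k) holomorphic_on unit_disk" for k by (rule zygmund_leD(1)[OF F[OF a]])
    have fd: "(f k has_field_derivative q * deriv (F (a k)) z) (at z)"
      "((\<lambda>z. q * deriv (F (a k)) z) has_field_derivative
          q * deriv (deriv (F (a k))) z) (at z)"
      if z: "z \<in> unit_disk" for k z
      unfolding f_def using z Fh[of k]
      by (auto intro!: DERIV_cmult holomorphic_derivI[of _ unit_disk] holomorphic_deriv)
    have fh: "f k holomorphic_on unit_disk"
      and f1: "z \<in> unit_disk \<Longrightarrow> deriv (f k) z = q * deriv (F (a k)) z"
      and f2: "z \<in> unit_disk \<Longrightarrow> deriv (deriv (f k)) z = q * deriv (deriv (F (a k))) z" for k z
      using disk_derivs[OF fd] by blast+
    have fle: "zygmund_le v_log 1 (f k)" for k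
      unfolding zygmund_le_def
    proof (intro conjI ballI fh)
      fix z :: complex assume z: "z \<in> unit_disk"
      have "norm (f k 0) + norm (deriv (f k) 0) + v_log z * norm (deriv (deriv (f k)) z)
          = inverse K * (norm (F (a k) 0) + norm (deriv (F (a k)) 0) + v_log z * norm (deriv (deriv (F (a k))) z))"
        using f1[of 0 k] f2[OF z, of k] by (simp add: f_def norm_mult nq algebra_simps)
      also have "\<dots> \<le> inverse K * K"
        using zygmund_leD(2)[OF F[OF a] z] K by (intro mult_left_mono) auto
      finally show "norm (f k 0) + norm (deriv (f k) 0) + v_log z * norm (deriv (deriv (f k)) z) \<le> 1"
        using K by simp
    qed
    have flim: "(\<lambda>k. f k z) \<longlonglongrightarrow> 0" if z: "z \<in> unit_disk" for z
    proof (rule Lim_null_comparison)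
      have "norm (f k z) \<le> inverse K * A z * w_log (a k)" for k
        using mult_left_mono[OF F0[OF a z], of "inverse K"] K by (simp add: f_def norm_mult nq mult.assoc)
      thus "\<forall>\<^sub>F k in sequentially. norm (f k z) \<le> inverse K * A z * w_log (a k)" by simp
      show "(\<lambda>k. inverse K * A z * w_log (a k)) \<longlonglongrightarrow> 0"
        by (rule tendsto_mult_right_zero[OF wlim])
    qed
    \<comment> \<open>Both error terms will be at most \<delta>, against the lower bound \<epsilon>/K.\<close>
    define \<delta> where "\<delta> = \<epsilon> * inverse K / 2"
    have \<delta>: "0 < \<delta>" using \<epsilon> K by (simp add: \<delta>_def)
    obtain r where r: "r < 1" "\<And>z. z \<in> unit_disk \<Longrightarrow> r < norm (\<phi> z) \<Longrightarrow> \<psi>1 z \<le> \<delta> * v_log (\<phi> z)"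
      using o1 \<delta> unfolding little_o_along_def by meson
    have "(\<lambda>k. 1 - inverse (real k + 1)) \<longlonglongrightarrow> 1 - 0"
      using LIMSEQ_inverse_real_of_nat by (intro tendsto_intros) (simp add: add.commute)
    hence "\<forall>\<^sub>F k in sequentially. r < 1 - inverse (real k + 1)"
      using r(1) by (intro order_tendstoD(1)) auto
    moreover have "\<forall>\<^sub>F k in sequentially. zygmund_le v_log \<delta> (\<lambda>z. f k (\<phi> z))"
      by (rule compact_imp_null[OF cpt fle flim \<delta>])
    ultimately have "\<forall>\<^sub>F k in sequentially. r < 1 - inverse (real k + 1) \<and> zygmund_le v_log \<delta> (\<lambda>z. f k (\<phi> z))"
      by (rule eventually_conj)
    then obtain k where k: "r < 1 - inverse (real k + 1)" "zygmund_le v_log \<delta> (\<lambda>z. f k (\<phi> z))"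
      using eventually_happens'[OF sequentially_bot] by blast
    define z where "z = Z k"
    have z: "z \<in> unit_disk" and az: "a k = \<phi> z" using Z(1) by (simp_all add: z_def a_def)
    have rz: "r < norm (\<phi> z)" using k(1) Z(2)[of k] by (simp add: z_def inverse_eq_divide)
    note v = v_log_pos[OF z] and ad = in_disk[OF z]
    define X where "X = deriv (deriv (\<lambda>z. f k (\<phi> z))) z"
    have vX: "v_log z * norm X \<le> \<delta>"
      using zygmund_leD(2)[OF k(2) z] norm_ge_zero[of "f k (\<phi> 0)"]
        norm_ge_zero[of "deriv (\<lambda>z. f k (\<phi> z)) 0"] unfolding X_def by linarith
    have "deriv (f k) (\<phi> z) * deriv (deriv \<phi>) z = X - deriv (deriv (f k)) (\<phi> z) * (deriv \<phi> z)\<^sup>2"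
      unfolding X_def comp_derivs(3)[OF fh hol im z] by simp
    hence "norm (deriv (f k) (\<phi> z)) * norm (deriv (deriv \<phi>) z)
        \<le> norm X + norm (deriv (deriv (f k)) (\<phi> z)) * (norm (deriv \<phi> z))\<^sup>2"
      using norm_triangle_ineq4[of X "deriv (deriv (f k)) (\<phi> z) * (deriv \<phi> z)\<^sup>2"]
      by (metis norm_mult norm_power)
    from mult_left_mono[OF this less_imp_le[OF v]]
    have "\<psi>2 z * norm (deriv (f k) (\<phi> z)) \<le> v_log z * norm X + norm (deriv (deriv (f k)) (\<phi> z)) * \<psi>1 z"
      by (simp add: \<psi>1_def \<psi>2_def algebra_simps)
    also have "norm (deriv (deriv (f k)) (\<phi> z)) * \<psi>1 z \<le> norm (deriv (deriv (f k)) (\<phi> z)) * (\<delta> * v_log (\<phi> z))"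
      using r(2)[OF z rz] by (intro mult_left_mono) auto
    also have "\<dots> = \<delta> * (v_log (\<phi> z) * norm (deriv (deriv (f k)) (\<phi> z)))" by simp
    also have "\<dots> \<le> \<delta> * 1"
      using zygmund_leD(2)[OF fle ad, of k] norm_ge_zero[of "f k 0"] norm_ge_zero[of "deriv (f k) 0"] \<delta>
      by (intro mult_left_mono) linarith+
    finally have up: "\<psi>2 z * norm (deriv (f k) (\<phi> z)) \<le> 2 * \<delta>" using vX by linarith
    have w: "0 < w_log (\<phi> z)" by (rule w_log_pos[OF ad])
    have "2 * \<delta> = \<epsilon> * w_log (\<phi> z) * (inverse K * inverse (w_log (\<phi> z)))"
      using w by (simp add: \<delta>_def)
    also have "\<dots> < \<psi>2 z * (inverse K * inverse (w_log (\<phi> z)))"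
      using Z(3)[of k] w K by (intro mult_strict_right_mono) (auto simp: z_def)
    also have "\<dots> \<le> \<psi>2 z * (inverse K * norm (deriv (F (\<phi> z)) (\<phi> z)))"
      using Fa[OF ad] K \<psi>_nonneg(2)[OF z] by (intro mult_left_mono) auto
    also have "inverse K * norm (deriv (F (\<phi> z)) (\<phi> z)) = norm (deriv (f k) (\<phi> z))"
      using f1[OF ad, of k] by (simp add: az norm_mult nq)
    finally show False using up by linarith
  qed
  thus ?thesis using M o1 unfolding vanishing_def by blast
qed

lemma deriv_power_disk:
  assumes "z \<in> unit_disk"
  shows "deriv (\<lambda>z. \<phi> z ^ Suc n) z = of_nat (Suc n) * \<phi> z ^ n * deriv \<phi> z"
proof (rule DERIV_imp_deriv)
  have "(\<phi> has_field_derivative deriv \<phi> z) (at z)"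
    using hol assms by (intro holomorphic_derivI) auto
  from DERIV_power[OF this, of "Suc n"]
  show "((\<lambda>z. \<phi> z ^ Suc n) has_field_derivative of_nat (Suc n) * \<phi> z ^ n * deriv \<phi> z) (at z)"
    by (simp add: mult_ac)
qed

lemma op_norms:
  assumes M: "\<And>z. z \<in> unit_disk \<Longrightarrow> \<psi>1 z \<le> M" "\<And>z. z \<in> unit_disk \<Longrightarrow> \<psi>2 z \<le> M"
  shows "zygmund_norm v_log (op_J' (deriv \<phi>) (\<lambda>z. \<phi> z ^ n)) = moment2 n"
    and "zygmund_norm v_log (op_I' (deriv \<phi>) (\<lambda>z. \<phi> z ^ Suc n)) = (real n + 1) * moment1 n"
proof -
  have d\<phi>: "deriv \<phi> holomorphic_on unit_disk" using hol by (intro holomorphic_deriv) auto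
  have p: "(\<lambda>z. \<phi> z ^ m) holomorphic_on unit_disk" for m using hol by (intro holomorphic_intros)
  note J = op_J'_props[OF d\<phi> p] and I = op_I'_props[OF d\<phi> p]
  have "zygmund_norm v_log (op_J' (deriv \<phi>) (\<lambda>z. \<phi> z ^ n)) = 1 * moment2 n"
    unfolding moment2_def
  proof (rule zygmund_norm_flat[OF J(3,4)])
    fix z assume z: "z \<in> unit_disk"
    show "v_log z * norm (deriv (deriv (op_J' (deriv \<phi>) (\<lambda>z. \<phi> z ^ n))) z)
        = 1 * (\<psi>2 z * norm (\<phi> z) ^ n)"
      unfolding J(5)[OF z] \<psi>2_def by (simp add: norm_mult norm_power)
    show "\<psi>2 z * norm (\<phi> z) ^ n \<le> M"
      using \<psi>_nonneg(2)[OF z] M(2)[OF z] by (rule weighted_power_le[OF z])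
  qed simp
  thus "zygmund_norm v_log (op_J' (deriv \<phi>) (\<lambda>z. \<phi> z ^ n)) = moment2 n" by simp
  show "zygmund_norm v_log (op_I' (deriv \<phi>) (\<lambda>z. \<phi> z ^ Suc n)) = (real n + 1) * moment1 n"
    unfolding moment1_def
  proof (rule zygmund_norm_flat[OF I(3,4)])
    fix z assume z: "z \<in> unit_disk"
    have "norm (deriv (\<lambda>z. \<phi> z ^ Suc n) z) = (real n + 1) * norm (\<phi> z) ^ n * norm (deriv \<phi> z)"
      unfolding deriv_power_disk[OF z] norm_mult norm_power norm_of_nat by simp
    thus "v_log z * norm (deriv (deriv (op_I' (deriv \<phi>) (\<lambda>z. \<phi> z ^ Suc n))) z)
        = (real n + 1) * (\<psi>1 z * norm (\<phi> z) ^ n)"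
      unfolding I(5)[OF z] \<psi>1_def by (simp add: norm_mult power2_eq_square)
    show "\<psi>1 z * norm (\<phi> z) ^ n \<le> M"
      using \<psi>_nonneg(1)[OF z] M(1)[OF z] by (rule weighted_power_le[OF z])
  qed simp
qed

text \<open>
  The cases n = 0 for the first operator and n = 1 for the second already give \<psi>2 and \<psi>1 exactly.
\<close>
lemma op_members_iff:
  "(\<forall>n. op_J' (deriv \<phi>) (\<lambda>z. \<phi> z ^ n) \<in> zygmund_space v_log \<and>
        op_I' (deriv \<phi>) (\<lambda>z. \<phi> z ^ n) \<in> zygmund_space v_log)
   \<longleftrightarrow> (\<exists>M. \<forall>z\<in>unit_disk. \<psi>1 z \<le> M \<and> \<psi>2 z \<le> M)" (is "?L \<longleftrightarrow> ?R")
proof -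
  have d\<phi>: "deriv \<phi> holomorphic_on unit_disk" using hol by (intro holomorphic_deriv) auto
  have p: "(\<lambda>z. \<phi> z ^ m) holomorphic_on unit_disk" for m using hol by (intro holomorphic_intros)
  note J = op_J'_props[OF d\<phi> p] and I = op_I'_props[OF d\<phi> p]
  have J2: "v_log z * norm (deriv (deriv (op_J' (deriv \<phi>) (\<lambda>z. \<phi> z ^ n))) z) = \<psi>2 z * norm (\<phi> z) ^ n"
    if z: "z \<in> unit_disk" for z n
    unfolding J(5)[OF z] \<psi>2_def by (simp add: norm_mult norm_power)
  have I2: "v_log z * norm (deriv (deriv (op_I' (deriv \<phi>) (\<lambda>z. \<phi> z ^ Suc n))) z)
      = (real n + 1) * (\<psi>1 z * norm (\<phi> z) ^ n)" if z: "z \<in> unit_disk" for z n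
  proof -
    have "norm (deriv (\<lambda>z. \<phi> z ^ Suc n) z) = (real n + 1) * norm (\<phi> z) ^ n * norm (deriv \<phi> z)"
      unfolding deriv_power_disk[OF z] norm_mult norm_power norm_of_nat by simp
    thus ?thesis
      unfolding I(5)[OF z] \<psi>1_def by (simp add: norm_mult power2_eq_square)
  qed
  show ?thesis
  proof
    assume L: ?L
    have bdd: "\<exists>B. \<forall>z\<in>unit_disk. v_log z * norm (deriv (deriv f) z) \<le> B"
      if "f \<in> zygmund_space v_log" for f
      using that by (auto simp: zygmund_space_def bdd_above_def)
    obtain A where "\<forall>z\<in>unit_disk. v_log z * norm (deriv (deriv (op_J' (deriv \<phi>) (\<lambda>z. \<phi> z ^ 0))) z) \<le> A"
      using bdd[OF conjunct1[OF spec[OF L, of 0]]] by blast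
    hence A: "\<psi>2 z \<le> A" if "z \<in> unit_disk" for z
      using J2[OF that, of 0] that by fastforce
    obtain B where "\<forall>z\<in>unit_disk. v_log z * norm (deriv (deriv (op_I' (deriv \<phi>) (\<lambda>z. \<phi> z ^ Suc 0))) z) \<le> B"
      using bdd[OF conjunct2[OF spec[OF L, of "Suc 0"]]] by blast
    hence B: "\<psi>1 z \<le> B" if "z \<in> unit_disk" for z
      using I2[OF that, of 0] that by fastforce
    show ?R using A B by (intro exI[of _ "max A B"]) (auto simp: le_max_iff_disj)
  next
    assume ?R
    then obtain M where M: "\<And>z. z \<in> unit_disk \<Longrightarrow> \<psi>1 z \<le> M" "\<And>z. z \<in> unit_disk \<Longrightarrow> \<psi>2 z \<le> M"
      by blast
    show ?L
    proof (intro allI conjI)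
      fix n
      have "zygmund_le v_log M (op_J' (deriv \<phi>) (\<lambda>z. \<phi> z ^ n))"
        unfolding zygmund_le_def
        using M(2) \<psi>_nonneg(2) by (auto simp: J(2-4) J2 intro!: weighted_power_le)
      thus "op_J' (deriv \<phi>) (\<lambda>z. \<phi> z ^ n) \<in> zygmund_space v_log" by (rule zygmund_spaceI[OF J(1)])
      have "\<exists>N. zygmund_le v_log N (op_I' (deriv \<phi>) (\<lambda>z. \<phi> z ^ n))"
      proof (cases n)
        case 0
        show ?thesis
          unfolding zygmund_le_def 0 using op_I'_props(2-5)[OF d\<phi> p[of 0]] by (intro exI[of _ 0]) auto
      next
        case (Suc m)
        have "v_log z * norm (deriv (deriv (op_I' (deriv \<phi>) (\<lambda>z. \<phi> z ^ n))) z) \<le> (real m + 1) * M"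
          if z: "z \<in> unit_disk" for z
          unfolding Suc I2[OF z] using M(1)[OF z] \<psi>_nonneg(1)[OF z]
          by (intro mult_left_mono weighted_power_le[OF z]) auto
        thus ?thesis
          unfolding zygmund_le_def by (intro exI[of _ "(real m + 1) * M"]) (auto simp: I(2-4))
      qed
      thus "op_I' (deriv \<phi>) (\<lambda>z. \<phi> z ^ n) \<in> zygmund_space v_log"
        using zygmund_spaceI[OF I(1)] by blast
    qed
  qed
qed

lemma vanishing_from_monomials:
  assumes M: "\<And>z. z \<in> unit_disk \<Longrightarrow> \<psi>1 z \<le> M" "\<And>z. z \<in> unit_disk \<Longrightarrow> \<psi>2 z \<le> M"
    and "(\<lambda>n. moment1 n / peak v_log n) \<longlonglongrightarrow> 0" "(\<lambda>n. moment2 n / peak w_log n) \<longlonglongrightarrow> 0"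
  shows vanishing
proof -
  have "little_o_along \<phi> \<psi>1 v_log"
    using v_log_pos v_log_le peak_bounded_v_log im le_moment(1)[OF M] assms(3)
    by (rule little_o_from_monomials)
  moreover have "little_o_along \<phi> \<psi>2 w_log"
    using w_log_pos w_log_le peak_bounded_w_log im le_moment(2)[OF M] assms(4)
    by (rule little_o_from_monomials)
  ultimately show ?thesis using M unfolding vanishing_def by blast
qed

end


theorem corollary5p3:
  fixes \<phi> :: "complex \<Rightarrow> complex"
  assumes "\<phi> holomorphic_on unit_disk" and "\<phi> ` unit_disk \<subseteq> unit_disk"
  shows "compact_on_zygmund v_log (composition_op \<phi>) \<longleftrightarrow>
    (\<forall>n. op_J' (deriv \<phi>) (\<lambda>z. \<phi> z ^ n) \<in> zygmund_space v_log \<and>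
         op_I' (deriv \<phi>) (\<lambda>z. \<phi> z ^ n) \<in> zygmund_space v_log) \<and>
    (\<exists>L M :: real.
       (\<lambda>n. real (n + 2) * real (n + 1)
              * zygmund_norm v_log (op_J' (deriv \<phi>) (\<lambda>z. \<phi> z ^ n))
              / zygmund_norm w_log (g_pow (n + 2))) \<longlonglongrightarrow> L \<and>
       (\<lambda>n. real (n + 1)
              * zygmund_norm v_log (op_I' (deriv \<phi>) (\<lambda>z. \<phi> z ^ n))
              / zygmund_norm v_log (g_pow (n + 1))) \<longlonglongrightarrow> M \<and>
       max L M = 0)"
    (is "?C \<longleftrightarrow> ?B \<and> (\<exists>L M. ?J \<longlonglongrightarrow> L \<and> ?I \<longlonglongrightarrow> M \<and> max L M = 0)")
proof -
  interpret disk_self_map \<phi> using assms by unfold_locales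
  have ratios: "?J = (\<lambda>n. moment2 n / peak w_log n)" "(\<lambda>n. ?I (Suc n)) = (\<lambda>n. moment1 n / peak v_log n)"
    "0 \<le> moment1 n" "0 \<le> moment2 n"
    if B: ?B for n
  proof -
    obtain M where M: "\<And>z. z \<in> unit_disk \<Longrightarrow> \<psi>1 z \<le> M" "\<And>z. z \<in> unit_disk \<Longrightarrow> \<psi>2 z \<le> M"
      using B op_members_iff by blast
    have c: "x * y * s / (x * y * t) = s / t" if "x \<noteq> 0" "y \<noteq> 0" for x y s t :: real
      using that by simp
    have oJ: "zygmund_norm v_log (op_J' (deriv \<phi>) (\<lambda>z. \<phi> z ^ n)) = moment2 n" for n
      using M by (rule op_norms(1))
    have oI: "zygmund_norm v_log (op_I' (deriv \<phi>) (\<lambda>z. \<phi> z ^ Suc n)) = (real n + 1) * moment1 n" for n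
      using M by (rule op_norms(2))
    have gw: "zygmund_norm w_log (g_pow (n + 2)) = real (n + 2) * real (n + 1) * peak w_log n" for n
      using w_log_pos w_log_le by (rule zygmund_norm_g_pow)
    show "?J = (\<lambda>n. moment2 n / peak w_log n)"
      unfolding oJ gw by (rule ext, rule c) auto
    have g: "zygmund_norm v_log (g_pow (Suc n + 1)) = real (n + 2) * real (n + 1) * peak v_log n" for n
    proof -
      have "zygmund_norm v_log (g_pow (n + 2)) = real (n + 2) * real (n + 1) * peak v_log n"
        using v_log_pos v_log_le by (rule zygmund_norm_g_pow)
      thus ?thesis by simp
    qed
    show "(\<lambda>n. ?I (Suc n)) = (\<lambda>n. moment1 n / peak v_log n)"
    proof
      fix n
      have "?I (Suc n) = real (n + 2) * real (n + 1) * moment1 n / (real (n + 2) * real (n + 1) * peak v_log n)"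
        unfolding oI g by (simp add: mult.assoc add.commute)
      also have "\<dots> = moment1 n / peak v_log n" by (rule c) auto
      finally show "?I (Suc n) = moment1 n / peak v_log n" .
    qed
    show "0 \<le> moment1 n" using M by (rule moment_nonneg(1))
    show "0 \<le> moment2 n" using M by (rule moment_nonneg(2))
  qed
  show ?thesis
  proof
    assume C: ?C
    have van: vanishing by (rule compact_imp_vanishing[OF C])
    hence B: ?B unfolding op_members_iff by (simp add: vanishing_def)
    have "?J \<longlonglongrightarrow> 0"
    proof -
      obtain M where "\<And>z. z \<in> unit_disk \<Longrightarrow> \<psi>2 z \<le> M" using van unfolding vanishing_def by blast
      moreover have "little_o_along \<phi> \<psi>2 w_log" using van unfolding vanishing_def by blast
      ultimately show ?thesis
        unfolding ratios(1)[OF B] moment2_def using im \<psi>_nonneg(2)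
        by (intro monomials_from_little_o_w_log) auto
    qed
    moreover have "?I \<longlonglongrightarrow> 0"
    proof -
      \<comment> \<open>The degree is shifted by one because differentiating \<phi>^(n+1) leaves \<phi>^n.\<close>
      have "(\<lambda>n. ?I (Suc n)) \<longlonglongrightarrow> 0" unfolding ratios(2)[OF B] by (rule compact_imp_moment1[OF C])
      thus ?thesis by (rule LIMSEQ_imp_Suc)
    qed
    ultimately show "?B \<and> (\<exists>L M. ?J \<longlonglongrightarrow> L \<and> ?I \<longlonglongrightarrow> M \<and> max L M = 0)"
      using B by (intro conjI exI[of _ "0::real"]) auto
  next
    assume R: "?B \<and> (\<exists>L M. ?J \<longlonglongrightarrow> L \<and> ?I \<longlonglongrightarrow> M \<and> max L M = 0)"
    hence B: ?B by (rule conjunct1)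
    from conjunct2[OF R] obtain L M where J: "?J \<longlonglongrightarrow> L" and I: "?I \<longlonglongrightarrow> M" and max: "max L M = 0"
      by blast
    have J': "(\<lambda>n. moment2 n / peak w_log n) \<longlonglongrightarrow> L" using J unfolding ratios(1)[OF B] .
    have I': "(\<lambda>n. moment1 n / peak v_log n) \<longlonglongrightarrow> M" using LIMSEQ_Suc[OF I] unfolding ratios(2)[OF B] .
    have "0 \<le> L"
      by (rule LIMSEQ_le_const[OF J']) (use ratios(4)[OF B] peak_w_log_pos in \<open>auto intro!: divide_nonneg_pos\<close>)
    moreover have "0 \<le> M"
      by (rule LIMSEQ_le_const[OF I']) (use ratios(3)[OF B] peak_v_log_pos in \<open>auto intro!: divide_nonneg_pos\<close>)
    ultimately have L0: "L = 0" "M = 0" using max by linarith+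
    obtain N where "\<And>z. z \<in> unit_disk \<Longrightarrow> \<psi>1 z \<le> N" "\<And>z. z \<in> unit_disk \<Longrightarrow> \<psi>2 z \<le> N"
      using B op_members_iff by blast
    hence vanishing using I' J' unfolding L0 by (rule vanishing_from_monomials)
    thus ?C by (rule vanishing_imp_compact)
  qed
qed

end
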